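(* If $R\in\mathrm{int}(\mathcal K)$, then the entropy functional $\mathbb S(\rho\|I)=\int_{\mathcal S}\mathrm{trace}(\rho\log\rho)\,d\theta$ has a minimum over $\rho\in\mathfrak M_{R,+}$, which is unique and belongs to $$\mathfrak M_{\rm exp}=\Big\{\rho=\tfrac1e\exp(-L^*(\lambda)):\ \lambda\in\mathfrak R\Big\}.$$ Furthermore, for any $\lambda_0\in\mathfrak R$, the solution $\lambda_t$ of $$\frac{d}{dt}\lambda_t=\big(\nabla\kappa|_{\lambda_t}\big)^{-1}\Big(R-\tfrac1e L\big(\exp(-L^*(\lambda_t))\big)\Big)\qquad(\ast)$$ with initial value $\lambda_0$, where $$\nabla\kappa|_{\lambda_t}:\mathfrak R\to\mathfrak R,\qquad \delta\mapsto-\tfrac1e L\big(M_{\exp(-L^*(\lambda_t))}(L^*(\delta))\big),$$ remains bounded for $t\in[0,\infty)$ and converges as $t\to\infty$ to some $\hat\lambda\in\mathfrak R$ corresponding to the unique minimizer $\rho=\frac1e\exp(-L^*(\hat\lambda))$ of $\mathbb S(\rho\|I)$ subject to $R=L(\rho)$. The convergence is exponential, as $V(\lambda_t)=\|R-\frac1e L(\exp(-L^*(\lambda_t)))\|^2$ satisfies $$\frac{dV(\lambda_t)}{dt}=-2V(\lambda_t).$$ Conversely, if $R\in\mathfrak R$ and $R\notin\mathrm{int}(\mathcal K)$, then the differential equation $(\ast)$ (started at any $\lambda_0\in\mathfrak R$) diverges, i.e. $\lambda_t$ is unbounded on its maximal interval of existence, $t\ge0$.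
   Context: Let $\mathcal S$ be a closed interval of $\mathbb R$ or a multi-dimensional closed interval in $\mathbb R^k$ (compact, with nonempty interior). Let $\mathbb M$ be the real Hilbert space of square-integrable measurable functions on $\mathcal S$ with values in Hermitian $m\times m$ matrices, with inner product $\langle m_1,m_2\rangle=\int_{\mathcal S}\mathrm{trace}(m_1(\theta)m_2(\theta))\,d\theta$; let $\mathfrak M$ and $\mathfrak M_+$ be the cones of elements of $\mathbb M$ that are nonnegative definite, respectively positive definite, for all $\theta\in\mathcal S$. Let $G_{\rm left}:\mathcal S\to\mathbb C^{n_{\rm left}\times m}$ and $G_{\rm right}:\mathcal S\to\mathbb C^{m\times n_{\rm right}}$ be continuously differentiable, and let $$L(\rho)=\int_{\mathcal S}G_{\rm left}(\theta)\rho(\theta)G_{\rm right}(\theta)\,d\theta,\qquad \rho\in\mathbb M,$$ with range $\mathfrak R=L(\mathbb M)\subseteq\mathbb C^{n_{\rm left}\times n_{\rm right}}$, regarded as a real linear space with inner product $\langle\lambda,R\rangle=\mathrm{Re}\,\mathrm{trace}(\lambda^*R)$ and the associated norm $\|\cdot\|$. The adjoint is $L^*:\mathfrak R\to\mathbb M$, $L^*(\lambda)(\theta)=\big(G_{\rm left}(\theta)^*\lambda\,G_{\rm right}(\theta)^*\big)_{\rm Herm}$, where $(M)_{\rm Herm}=\frac12(M+M^* )$. Matrix functions ($\log$, $\exp$) and products of matrix-valued functions on $\mathcal S$ are taken pointwise in $\theta$. Define $\mathcal K=\overline{L(\mathfrak M)}$ (closure in $\mathfrak R$), $\mathrm{int}(\mathcal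 K)=L(\mathfrak M_+)$, and, for $R\in\mathfrak R$, $\mathfrak M_{R,+}=\{\rho\in\mathfrak M_+: L(\rho)=R\}$. For Hermitian matrices $C>0$ and $\Delta$, set $M_C(\Delta)=\int_0^1 C^{1-\tau}\Delta C^{\tau}\,d\tau$ (applied pointwise in $\theta$ to matrix-valued functions). *)

theory Defs
  imports "HOL-Analysis.Analysis"
begin

text \<open>
  A \<open>p \<times> q\<close> matrix has type \<open>complex^'q^'p\<close>. The type-class inner product on this type is
  \<open>A \<bullet> B = Re (trace (A\<^sup>* B))\<close>, and its norm is the Frobenius norm; so the real inner
  product and the norm on matrices used below are the library's own.
  On vectors, \<open>x \<bullet> y = Re (x\<^sup>* y)\<close>. The operation \<open>*\<close> on matrices is componentwise; the matrix
  product is \<open>**\<close>.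
\<close>

definition ctranspose :: "complex^'q^'p \<Rightarrow> complex^'p^'q" where
  "ctranspose A = (\<chi> i j. cnj (A $ j $ i))"

definition hermitian :: "complex^'m^'m \<Rightarrow> bool" where
  "hermitian A \<longleftrightarrow> ctranspose A = A"

definition herm_part :: "complex^'m^'m \<Rightarrow> complex^'m^'m" where
  "herm_part A = (1/2) *\<^sub>R (A + ctranspose A)"

text \<open>For Hermitian \<open>A\<close> the form \<open>x\<^sup>* A x\<close> is real, so nothing is lost by taking its real part
  \<open>x \<bullet> (A *v x)\<close>.\<close>

definition nonneg_definite :: "complex^'m^'m \<Rightarrow> bool" where
  "nonneg_definite A \<longleftrightarrow> hermitian A \<and> (\<forall>x. 0 \<le> x \<bullet> (A *v x))"

definition pos_definite :: "complex^'m^'m \<Rightarrow> bool" where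
  "pos_definite A \<longleftrightarrow> hermitian A \<and> (\<forall>x. x \<noteq> 0 \<longrightarrow> 0 < x \<bullet> (A *v x))"

definition mpow :: "complex^'m^'m \<Rightarrow> nat \<Rightarrow> complex^'m^'m" where
  "mpow A n = (((**) A) ^^ n) (mat 1)"

definition mexp :: "complex^'m^'m \<Rightarrow> complex^'m^'m" where
  "mexp A = (\<Sum>n. (1 / fact n) *\<^sub>R mpow A n)"

text \<open>The logarithm and the real powers are meaningful for positive definite \<open>C\<close>, for which
  there is exactly one Hermitian \<open>X\<close> with \<open>mexp X = C\<close>.\<close>

definition mlog :: "complex^'m^'m \<Rightarrow> complex^'m^'m" where
  "mlog C = (THE X. hermitian X \<and> mexp X = C)"

definition mpowr :: "complex^'m^'m \<Rightarrow> real \<Rightarrow> complex^'m^'m" where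
  "mpowr C s = mexp (s *\<^sub>R mlog C)"

definition nc_mult :: "complex^'m^'m \<Rightarrow> complex^'m^'m \<Rightarrow> complex^'m^'m" where
  "nc_mult C \<Delta> = (LINT \<tau>|lebesgue_on {0..1}. mpowr C (1 - \<tau>) ** \<Delta> ** mpowr C \<tau>)"


definition cont_diff_on :: "'s::euclidean_space set \<Rightarrow> ('s \<Rightarrow> 'b::real_normed_vector) \<Rightarrow> bool" where
  "cont_diff_on S f \<longleftrightarrow>
     (\<exists>f' :: 's \<Rightarrow> 's \<Rightarrow>\<^sub>L 'b.
        (\<forall>x\<in>S. (f has_derivative blinfun_apply (f' x)) (at x within S)) \<and> continuous_on S f')"

text \<open>Elements of the \<open>L\<^sup>2\<close> spaces are represented by functions on the whole type of which only
  the restriction to \<open>S\<close> matters; equality in the space is equality almost everywhere on \<open>S\<close>.\<close>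

definition herm_L2 :: "'s::euclidean_space set \<Rightarrow> ('s \<Rightarrow> complex^'m^'m) set" where
  "herm_L2 S = {\<rho>. \<rho> \<in> borel_measurable (lebesgue_on S)
                  \<and> integrable (lebesgue_on S) (\<lambda>\<theta>. (norm (\<rho> \<theta>))\<^sup>2)
                  \<and> (\<forall>\<theta>\<in>S. hermitian (\<rho> \<theta>))}"

definition nonneg_L2 :: "'s::euclidean_space set \<Rightarrow> ('s \<Rightarrow> complex^'m^'m) set" where
  "nonneg_L2 S = {\<rho> \<in> herm_L2 S. \<forall>\<theta>\<in>S. nonneg_definite (\<rho> \<theta>)}"

definition pos_L2 :: "'s::euclidean_space set \<Rightarrow> ('s \<Rightarrow> complex^'m^'m) set" where
  "pos_L2 S = {\<rho> \<in> herm_L2 S. \<forall>\<theta>\<in>S. pos_definite (\<rho> \<theta>)}"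

definition moment_map ::
  "'s::euclidean_space set \<Rightarrow> ('s \<Rightarrow> complex^'m^'nl) \<Rightarrow> ('s \<Rightarrow> complex^'nr^'m)
     \<Rightarrow> ('s \<Rightarrow> complex^'m^'m) \<Rightarrow> complex^'nr^'nl" where
  "moment_map S Gl Gr \<rho> = (LINT \<theta>|lebesgue_on S. Gl \<theta> ** \<rho> \<theta> ** Gr \<theta>)"

definition moment_range ::
  "'s::euclidean_space set \<Rightarrow> ('s \<Rightarrow> complex^'m^'nl) \<Rightarrow> ('s \<Rightarrow> complex^'nr^'m)
     \<Rightarrow> (complex^'nr^'nl) set" where
  "moment_range S Gl Gr = moment_map S Gl Gr ` herm_L2 S"

text \<open>The adjoint of the moment map with respect to the real inner products
  \<open>\<integral> trace (m\<^sub>1 m\<^sub>2)\<close> on Hermitian functions and \<open>Re (trace (\<Lambda>\<^sup>* R))\<close> on matrices.\<close>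

definition moment_adj ::
  "('s \<Rightarrow> complex^'m^'nl) \<Rightarrow> ('s \<Rightarrow> complex^'nr^'m)
     \<Rightarrow> complex^'nr^'nl \<Rightarrow> 's \<Rightarrow> complex^'m^'m" where
  "moment_adj Gl Gr \<Lambda> \<theta> = herm_part (ctranspose (Gl \<theta>) ** \<Lambda> ** ctranspose (Gr \<theta>))"

text \<open>The range of the moment map is a linear subspace of a finite-dimensional space, hence closed,
  so the closure in it is the closure in the ambient matrix space.\<close>

definition moment_cone ::
  "'s::euclidean_space set \<Rightarrow> ('s \<Rightarrow> complex^'m^'nl) \<Rightarrow> ('s \<Rightarrow> complex^'nr^'m)
     \<Rightarrow> (complex^'nr^'nl) set" where
  "moment_cone S Gl Gr = closure (moment_map S Gl Gr ` nonneg_L2 S)"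

text \<open>\<open>int(\<K>)\<close>, for \<open>\<K> = moment_cone S Gl Gr\<close>, is defined as the image of the positive definite
  functions, not topologically.\<close>

definition int_moment_cone ::
  "'s::euclidean_space set \<Rightarrow> ('s \<Rightarrow> complex^'m^'nl) \<Rightarrow> ('s \<Rightarrow> complex^'nr^'m)
     \<Rightarrow> (complex^'nr^'nl) set" where
  "int_moment_cone S Gl Gr = moment_map S Gl Gr ` pos_L2 S"

definition pos_solutions ::
  "'s::euclidean_space set \<Rightarrow> ('s \<Rightarrow> complex^'m^'nl) \<Rightarrow> ('s \<Rightarrow> complex^'nr^'m)
     \<Rightarrow> complex^'nr^'nl \<Rightarrow> ('s \<Rightarrow> complex^'m^'m) set" where
  "pos_solutions S Gl Gr R = {\<rho> \<in> pos_L2 S. moment_map S Gl Gr \<rho> = R}"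


text \<open>For positive definite \<open>\<rho> \<theta>\<close> the trace of \<open>\<rho> log \<rho>\<close> is a real number.\<close>

definition entropy :: "'s::euclidean_space set \<Rightarrow> ('s \<Rightarrow> complex^'m^'m) \<Rightarrow> real" where
  "entropy S \<rho> = (LINT \<theta>|lebesgue_on S. Re (trace (\<rho> \<theta> ** mlog (\<rho> \<theta>))))"

definition unique_entropy_min ::
  "'s::euclidean_space set \<Rightarrow> ('s \<Rightarrow> complex^'m^'m) set \<Rightarrow> ('s \<Rightarrow> complex^'m^'m) \<Rightarrow> bool" where
  "unique_entropy_min S A \<rho> \<longleftrightarrow>
     is_arg_min (entropy S) (\<lambda>\<sigma>. \<sigma> \<in> A) \<rho> \<and>
     (\<forall>\<sigma>. is_arg_min (entropy S) (\<lambda>\<sigma>. \<sigma> \<in> A) \<sigma> \<longrightarrow> (AE \<theta> in lebesgue_on S. \<sigma> \<theta> = \<rho> \<theta>))"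

definition exp_density ::
  "('s \<Rightarrow> complex^'m^'nl) \<Rightarrow> ('s \<Rightarrow> complex^'nr^'m)
     \<Rightarrow> complex^'nr^'nl \<Rightarrow> 's \<Rightarrow> complex^'m^'m" where
  "exp_density Gl Gr \<Lambda> \<theta> = (1 / exp 1) *\<^sub>R mexp (- moment_adj Gl Gr \<Lambda> \<theta>)"

definition exp_family ::
  "'s::euclidean_space set \<Rightarrow> ('s \<Rightarrow> complex^'m^'nl) \<Rightarrow> ('s \<Rightarrow> complex^'nr^'m)
     \<Rightarrow> ('s \<Rightarrow> complex^'m^'m) set" where
  "exp_family S Gl Gr = exp_density Gl Gr ` moment_range S Gl Gr"


definition residual ::
  "'s::euclidean_space set \<Rightarrow> ('s \<Rightarrow> complex^'m^'nl) \<Rightarrow> ('s \<Rightarrow> complex^'nr^'m)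
     \<Rightarrow> complex^'nr^'nl \<Rightarrow> complex^'nr^'nl \<Rightarrow> complex^'nr^'nl" where
  "residual S Gl Gr R \<Lambda> =
     R - (1 / exp 1) *\<^sub>R moment_map S Gl Gr (\<lambda>\<theta>. mexp (- moment_adj Gl Gr \<Lambda> \<theta>))"

definition grad_kappa ::
  "'s::euclidean_space set \<Rightarrow> ('s \<Rightarrow> complex^'m^'nl) \<Rightarrow> ('s \<Rightarrow> complex^'nr^'m)
     \<Rightarrow> complex^'nr^'nl \<Rightarrow> complex^'nr^'nl \<Rightarrow> complex^'nr^'nl" where
  "grad_kappa S Gl Gr \<Lambda> \<delta> =
     - ((1 / exp 1) *\<^sub>R moment_map S Gl Gr
          (\<lambda>\<theta>. nc_mult (mexp (- moment_adj Gl Gr \<Lambda> \<theta>)) (moment_adj Gl Gr \<delta> \<theta>)))"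

text \<open>The inverse is that of \<open>grad_kappa S Gl Gr \<Lambda>\<close> as a map from the range space to itself.\<close>

definition flow_field ::
  "'s::euclidean_space set \<Rightarrow> ('s \<Rightarrow> complex^'m^'nl) \<Rightarrow> ('s \<Rightarrow> complex^'nr^'m)
     \<Rightarrow> complex^'nr^'nl \<Rightarrow> complex^'nr^'nl \<Rightarrow> complex^'nr^'nl" where
  "flow_field S Gl Gr R \<Lambda> =
     inv_into (moment_range S Gl Gr) (grad_kappa S Gl Gr \<Lambda>) (residual S Gl Gr R \<Lambda>)"

definition flow_solution ::
  "'s::euclidean_space set \<Rightarrow> ('s \<Rightarrow> complex^'m^'nl) \<Rightarrow> ('s \<Rightarrow> complex^'nr^'m)
     \<Rightarrow> complex^'nr^'nl \<Rightarrow> complex^'nr^'nl \<Rightarrow> real set \<Rightarrow> (real \<Rightarrow> complex^'nr^'nl) \<Rightarrow> bool" where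
  "flow_solution S Gl Gr R \<Lambda>0 J \<Lambda> \<longleftrightarrow>
     is_interval J \<and> 0 \<in> J \<and> J \<subseteq> {0..} \<and> \<Lambda> 0 = \<Lambda>0 \<and>
     (\<forall>t\<in>J. \<Lambda> t \<in> moment_range S Gl Gr \<and>
        (\<Lambda> has_vector_derivative flow_field S Gl Gr R (\<Lambda> t)) (at t within J))"

definition maximal_flow_solution ::
  "'s::euclidean_space set \<Rightarrow> ('s \<Rightarrow> complex^'m^'nl) \<Rightarrow> ('s \<Rightarrow> complex^'nr^'m)
     \<Rightarrow> complex^'nr^'nl \<Rightarrow> complex^'nr^'nl \<Rightarrow> real set \<Rightarrow> (real \<Rightarrow> complex^'nr^'nl) \<Rightarrow> bool" where
  "maximal_flow_solution S Gl Gr R \<Lambda>0 J \<Lambda> \<longleftrightarrow>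
     flow_solution S Gl Gr R \<Lambda>0 J \<Lambda> \<and>
     (\<forall>J' \<Lambda>'. flow_solution S Gl Gr R \<Lambda>0 J' \<Lambda>' \<and> J \<subseteq> J' \<and> (\<forall>t\<in>J. \<Lambda>' t = \<Lambda> t) \<longrightarrow> J' = J)"

definition the_flow_solution ::
  "'s::euclidean_space set \<Rightarrow> ('s \<Rightarrow> complex^'m^'nl) \<Rightarrow> ('s \<Rightarrow> complex^'nr^'m)
     \<Rightarrow> complex^'nr^'nl \<Rightarrow> complex^'nr^'nl \<Rightarrow> real set \<Rightarrow> (real \<Rightarrow> complex^'nr^'nl) \<Rightarrow> bool" where
  "the_flow_solution S Gl Gr R \<Lambda>0 J \<Lambda> \<longleftrightarrow>
     maximal_flow_solution S Gl Gr R \<Lambda>0 J \<Lambda> \<and>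
     (\<forall>J' \<Lambda>'. maximal_flow_solution S Gl Gr R \<Lambda>0 J' \<Lambda>' \<longrightarrow> J' = J \<and> (\<forall>t\<in>J. \<Lambda>' t = \<Lambda> t))"

end

theory Submission
  imports Defs
begin

text \<open>
  Write \<open>\<kappa> \<lambda> = L (exp (- L\<^sup>* \<lambda>)) / e\<close>. By the Duhamel formula \<open>\<kappa>\<close> is differentiable with
  derivative \<open>grad_kappa\<close>, which is negative definite on the range \<open>V\<close> of \<open>L\<close>; hence \<open>\<kappa>\<close> is a
  diffeomorphism of \<open>V\<close> onto an open subset. Inside the convex set \<open>L (pos_L2)\<close> this subset is
  also closed, since \<open>\<kappa>\<close> is proper there, so the two sets agree. Along the flow
  \<open>R - \<kappa> (\<lambda> t)\<close> decays like \<open>exp (- t)\<close>; so the flow is the preimage under \<open>\<kappa>\<close> of the segment from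
  \<open>\<kappa> (\<lambda> 0)\<close> to \<open>R\<close>, and existence, uniqueness, convergence and divergence are read off from the
  position of this segment, without any theory of differential equations. That \<open>exp_density\<close>
  minimises the entropy is Klein's inequality, integrated.
\<close>

section \<open>Self-adjoint operators and Hermitian matrices\<close>

text \<open>Spectral arguments run over the reals: a Hermitian matrix is diagonalised by a real
  orthonormal basis of \<open>complex^'m\<close>, a space of real dimension
  \<open>2 * CARD('m)\<close>, so traces and Frobenius products appear with a factor
  \<open>2\<close>. The factor \<open>1 / exp 1\<close> comes from stationarity of the entropy under
  the moment constraint, \<open>mlog \<rho> + 1 = - L_adj x\<close>. The map \<open>kappa\<close> is
  minus the gradient of the convex function
  \<open>x \<mapsto> (1/e) \<integral> trace (exp (- L_adj x))\<close>; convexity is strict on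
  \<open>V\<close> because \<open>L_adj\<close> is injective on the range of \<open>L\<close>. The
  delicate point is properness: parameters might tend to infinity while their moments converge. If
  the limit of the moments lies in \<open>W\<close>, this is excluded by playing a linear upper
  bound for the integrated trace of the exponential against lower bounds of arbitrarily large slope.
  If the prescribed moment lies outside \<open>W\<close>, such an escape is exactly what makes the
  flow diverge.\<close>

definition orthonormal_basis :: "'a::euclidean_space set \<Rightarrow> bool" where
  "orthonormal_basis B \<longleftrightarrow> finite B \<and> pairwise orthogonal B \<and> (\<forall>b\<in>B. norm b = 1) \<and> span B = UNIV"

lemma orthonormal_basis_sum:
  assumes "orthonormal_basis B"
  shows "(\<Sum>b\<in>B. (x \<bullet> b) *\<^sub>R b) = x"
  using assms unfolding orthonormal_basis_def
  by (intro orthonormal_basis_expand) auto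

lemma orthonormal_basis_inner:
  assumes "orthonormal_basis B"
  shows "(\<Sum>b\<in>B. (x \<bullet> b) * (y \<bullet> b)) = x \<bullet> y"
proof -
  have "x \<bullet> y = x \<bullet> (\<Sum>b\<in>B. (y \<bullet> b) *\<^sub>R b)"
    using orthonormal_basis_sum[OF assms] by simp
  then show ?thesis by (simp add: inner_sum_right mult.commute)
qed

lemma orthonormal_basis_norm1: "orthonormal_basis B \<Longrightarrow> b \<in> B \<Longrightarrow> norm b = 1"
  and orthonormal_basis_inner_self: "orthonormal_basis B \<Longrightarrow> b \<in> B \<Longrightarrow> b \<bullet> b = 1"
  and orthonormal_basis_finite: "orthonormal_basis B \<Longrightarrow> finite B"
  by (auto simp: orthonormal_basis_def norm_eq_1)

lemma orthonormal_basis_card: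
  fixes B :: "'a::euclidean_space set"
  assumes "orthonormal_basis B" shows "card B = DIM('a)"
proof -
  have "0 \<notin> B" using assms by (auto simp: orthonormal_basis_def)
  then have "independent B"
    using assms pairwise_orthogonal_independent by (auto simp: orthonormal_basis_def)
  then show ?thesis
    using assms by (metis dim_UNIV dim_span_eq_card_independent orthonormal_basis_def)
qed

text \<open>Induction on the dimension: the quotient \<open>(x \<bullet> f x) / (x \<bullet> x)\<close> attains its
  maximum on the invariant subspace at an eigenvector, whose complement is again invariant.\<close>

lemma selfadjoint_invariant_subspace_basis:
  fixes f :: "'a::euclidean_space \<Rightarrow> 'a"
  assumes lin: "linear f" and sa: "\<And>x y. x \<bullet> f y = f x \<bullet> y"
    and "subspace W" and "\<And>x. x \<in> W \<Longrightarrow> f x \<in> W"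
  shows "\<exists>B\<subseteq>W. finite B \<and> pairwise orthogonal B \<and> (\<forall>b\<in>B. norm b = 1) \<and> span B = W \<and>
           (\<forall>b\<in>B. \<exists>c. f b = c *\<^sub>R b)"
  using assms(3,4)
proof (induction "dim W" arbitrary: W rule: less_induct)
  case less
  show ?case
  proof (cases "W \<subseteq> {0}")
    case True
    then have "W = {0}" using subspace_0[OF less.prems(1)] by auto
    then show ?thesis by (intro exI[of _ "{}"]) auto
  next
    case False
    then obtain w where w: "w \<in> W" "w \<noteq> 0" by auto
    let ?K = "W \<inter> sphere 0 1"
    have cont: "continuous_on T f" for T
      using lin linear_continuous_on linear_conv_bounded_linear by blast
    have K: "compact ?K"
      by (simp add: closed_Int_compact closed_subspace less.prems(1))
    have "w /\<^sub>R norm w \<in> ?K"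
      using w less.prems(1) by (auto intro: subspace_scale)
    then have ne: "?K \<noteq> {}" by blast
    have ct: "continuous_on ?K (\<lambda>x. x \<bullet> f x)"
      by (intro continuous_intros cont)
    obtain v where v: "v \<in> ?K" and max: "\<And>x. x \<in> ?K \<Longrightarrow> x \<bullet> f x \<le> v \<bullet> f v"
      using continuous_attains_sup[OF K ne ct] by blast
    define c where "c = v \<bullet> f v"
    have vW: "v \<in> W" and nv: "norm v = 1" and vv: "v \<bullet> v = 1"
      using v by (auto simp: norm_eq_1)
    have bound: "x \<bullet> f x \<le> c * (x \<bullet> x)" if "x \<in> W" for x
    proof (cases "x = 0")
      case True
      then show ?thesis by simp
    next
      case False
      then have "x /\<^sub>R norm x \<in> ?K"
        using that less.prems(1) by (auto intro: subspace_scale)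
      from max[OF this] have "(x \<bullet> f x) / (norm x)\<^sup>2 \<le> c"
        by (simp add: linear_cmul[OF lin] c_def power2_eq_square divide_simps)
      then show ?thesis using False by (simp add: divide_simps dot_square_norm)
    qed
    have perp: "y \<bullet> f v = 0" if y: "y \<in> W" "y \<bullet> v = 0" for y
    proof (rule ccontr)
      assume ne: "y \<bullet> f v \<noteq> 0"
      define p where "p = y \<bullet> f v"
      define q where "q = c * (y \<bullet> y) - y \<bullet> f y"
      \<comment> \<open>\<open>bound\<close> expanded at \<open>v + t y\<close>. It holds for every
        real \<open>t\<close>, so the coefficient \<open>p\<close> of the linear term has to
        vanish.\<close>
      have key: "2 * t * p \<le> t\<^sup>2 * q" for t
      proof -
        have "v + t *\<^sub>R y \<in> W" using vW y less.prems(1) by (simp add: subspace_add subspace_scale)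
        from bound[OF this] have
          "(v + t *\<^sub>R y) \<bullet> f (v + t *\<^sub>R y) \<le> c * ((v + t *\<^sub>R y) \<bullet> (v + t *\<^sub>R y))" .
        moreover have "v \<bullet> f y = p" using sa[of v y] by (simp add: p_def inner_commute)
        ultimately show ?thesis using y
          by (simp add: linear_add[OF lin] linear_cmul[OF lin] inner_add_left inner_add_right
             c_def[symmetric] vv p_def[symmetric] q_def inner_commute algebra_simps power2_eq_square)
      qed
      have "q \<ge> 0" using bound[OF y(1)] by (simp add: q_def)
      have p2: "p\<^sup>2 > 0" using ne by (simp add: p_def)
      \<comment> \<open>This \<open>t\<close> makes the linear term dominate; the \<open>+ 1\<close>
        covers \<open>q = 0\<close>.\<close>
      have "2 * (p / (q + 1)) * p \<le> (p / (q+1))\<^sup>2 * q" by (rule key)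
      then have "2 * p\<^sup>2 * (q + 1) \<le> p\<^sup>2 * q"
        using \<open>q \<ge> 0\<close> by (simp add: divide_simps power2_eq_square split: if_splits)
      then have "p\<^sup>2 * (2 * (q + 1)) \<le> p\<^sup>2 * q" by (simp add: algebra_simps)
      then have "2 * (q + 1) \<le> q"
        using p2 by (simp only: mult_le_cancel_left_pos)
      with \<open>q \<ge> 0\<close> show False by simp
    qed
    have fv: "f v = c *\<^sub>R v"
    proof -
      define z where "z = f v - c *\<^sub>R v"
      have zW: "z \<in> W" using vW less.prems by (simp add: z_def subspace_diff subspace_scale)
      have zv: "z \<bullet> v = 0" by (simp add: z_def inner_diff_left inner_diff_right c_def vv inner_commute)
      from perp[OF zW zv] zv have "z \<bullet> z = 0" by (simp add: z_def inner_diff_right)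
      then show ?thesis by (simp add: z_def)
    qed
    define W' where "W' = W \<inter> {x. v \<bullet> x = 0}"
    have sW': "subspace W'"
      unfolding W'_def by (intro subspace_inter less.prems subspace_hyperplane)
    have vW': "v \<notin> W'" by (simp add: W'_def vv)
    have "dim W' < dim W"
    proof (rule dim_psubset)
      show "span W' \<subset> span W"
        unfolding span_eq_iff[THEN iffD2, OF sW'] span_eq_iff[THEN iffD2, OF less.prems(1)]
        using vW vW' W'_def by blast
    qed
    moreover have "f x \<in> W'" if "x \<in> W'" for x
      using that less.prems(2) sa[of v x] by (auto simp: W'_def fv)
    ultimately obtain B where B: "B \<subseteq> W'" "finite B" "pairwise orthogonal B"
      "\<forall>b\<in>B. norm b = 1" "span B = W'" "\<forall>b\<in>B. \<exists>c. f b = c *\<^sub>R b"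
      using less.hyps sW' by metis
    have "span (insert v B) = W"
    proof
      show "span (insert v B) \<subseteq> W"
        using B(1) vW by (intro span_minimal less.prems) (auto simp: W'_def)
      show "W \<subseteq> span (insert v B)"
      proof
        fix x assume "x \<in> W"
        then have "x - (v \<bullet> x) *\<^sub>R v \<in> W'"
          using vW less.prems(1)
          by (auto simp: W'_def subspace_diff subspace_scale inner_diff_right vv)
        then have "x - (v \<bullet> x) *\<^sub>R v \<in> span B" using B(5) by simp
        then show "x \<in> span (insert v B)" by (auto simp: span_insert)
      qed
    qed
    moreover have "pairwise orthogonal (insert v B)"
      using B(1,3) unfolding pairwise_insert
      by (auto simp: W'_def orthogonal_def inner_commute)
    ultimately show ?thesis
      using B vW nv fv by (intro exI[of _ "insert v B"]) (auto simp: W'_def)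
  qed
qed

theorem selfadjoint_eigenbasis:
  fixes f :: "'a::euclidean_space \<Rightarrow> 'a"
  assumes "linear f" and "\<And>x y. x \<bullet> f y = f x \<bullet> y"
  obtains B c where "orthonormal_basis B" "\<And>b. b \<in> B \<Longrightarrow> f b = c b *\<^sub>R b"
proof -
  obtain B where "orthonormal_basis B" "\<forall>b\<in>B. \<exists>c. f b = c *\<^sub>R b"
    using selfadjoint_invariant_subspace_basis[OF assms subspace_UNIV]
    unfolding orthonormal_basis_def by auto
  then show thesis using that by metis
qed

section \<open>Complex matrices as real-linear operators\<close>

lemma linear_mv: "linear ((*v) (A :: complex^'q^'p))"
  by (rule linearI)
    (simp_all add: vec_eq_iff matrix_vector_mult_def scaleR_sum_right distrib_left sum.distrib)

lemma inner_complex_mult: "(x::complex) \<bullet> (a * y) = (cnj a * x) \<bullet> y"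
  by (simp add: inner_complex_def algebra_simps)

text \<open>Both real coordinates of an entry are real inner products, with the conjugated row and
  with \<open>\<i>\<close> times it. Summing over a real orthonormal basis thereby becomes
  Parseval's identity, once per coordinate.\<close>

lemma mv_nth_eq:
  fixes A :: "complex^'q^'p"
  shows "(A *v x) $ i = Complex (x \<bullet> (\<chi> j. cnj (A$i$j))) (x \<bullet> (\<chi> j. \<i> * cnj (A$i$j)))"
proof (rule complex_eqI)
  show "Re ((A *v x) $ i) = Re (Complex (x \<bullet> (\<chi> j. cnj (A$i$j))) (x \<bullet> (\<chi> j. \<i> * cnj (A$i$j))))"
    unfolding matrix_vector_mult_def inner_vec_def vec_lambda_beta complex.sel Re_sum
    by (intro sum.cong refl) (simp add: inner_complex_def)
  show "Im ((A *v x) $ i) = Im (Complex (x \<bullet> (\<chi> j. cnj (A$i$j))) (x \<bullet> (\<chi> j. \<i> * cnj (A$i$j))))"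
    unfolding matrix_vector_mult_def inner_vec_def vec_lambda_beta complex.sel Im_sum
    by (intro sum.cong refl) (simp add: inner_complex_def)
qed

text \<open>The factor \<open>2\<close> arises because \<open>complex^'q\<close> has real dimension \<open>2 * CARD('q)\<close>.\<close>

lemma inner_matrix_orthonormal_basis:
  fixes A C :: "complex^'q^'p"
  assumes "orthonormal_basis B"
  shows "(\<Sum>b\<in>B. (A *v b) \<bullet> (C *v b)) = 2 * (A \<bullet> C)"
proof -
  have "(\<Sum>b\<in>B. (A *v b) \<bullet> (C *v b)) =
     (\<Sum>i\<in>UNIV. \<Sum>b\<in>B. (A *v b)$i \<bullet> (C *v b)$i)"
    unfolding inner_vec_def[where 'a=complex and 'b='p] by (rule sum.swap)
  also have "\<dots> = (\<Sum>i\<in>UNIV. (\<chi> j. cnj (A$i$j)) \<bullet> (\<chi> j. cnj (C$i$j)) +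
      (\<chi> j. \<i> * cnj (A$i$j)) \<bullet> (\<chi> j. \<i> * cnj (C$i$j)))"
  proof (intro sum.cong refl)
    fix i
    have "(\<Sum>b\<in>B. (b \<bullet> u) * (b \<bullet> w)) = u \<bullet> w" for u w :: "complex^'q"
      using orthonormal_basis_inner[OF assms, of u w] by (simp only: inner_commute)
    then show "(\<Sum>b\<in>B. (A *v b)$i \<bullet> (C *v b)$i) =
      (\<chi> j. cnj (A$i$j)) \<bullet> (\<chi> j. cnj (C$i$j)) +
      (\<chi> j. \<i> * cnj (A$i$j)) \<bullet> (\<chi> j. \<i> * cnj (C$i$j))"
      unfolding mv_nth_eq inner_complex_def complex.sel sum.distrib by (simp only:)
  qed
  also have "\<dots> = (\<Sum>i\<in>UNIV. 2 * (A$i \<bullet> C$i))"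
  proof (intro sum.cong refl)
    fix i
    have "(\<chi> j. cnj (A$i$j)) \<bullet> (\<chi> j. cnj (C$i$j)) = A$i \<bullet> C$i"
      "(\<chi> j. \<i> * cnj (A$i$j)) \<bullet> (\<chi> j. \<i> * cnj (C$i$j)) = A$i \<bullet> C$i"
      unfolding inner_vec_def by (intro sum.cong refl; simp add: inner_complex_def)+
    then show "(\<chi> j. cnj (A$i$j)) \<bullet> (\<chi> j. cnj (C$i$j)) +
      (\<chi> j. \<i> * cnj (A$i$j)) \<bullet> (\<chi> j. \<i> * cnj (C$i$j)) = 2 * (A$i \<bullet> C$i)"
      by simp
  qed
  finally show ?thesis by (simp add: inner_vec_def[of A] sum_distrib_left)
qed

lemma ctranspose_ctranspose [simp]: "ctranspose (ctranspose A) = A"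
  by (simp add: ctranspose_def vec_eq_iff)

lemma inner_ctranspose_mv: "x \<bullet> (A *v y) = (ctranspose A *v x) \<bullet> y"
proof -
  have "x \<bullet> (A *v y) = (\<Sum>i\<in>UNIV. \<Sum>j\<in>UNIV. x$i \<bullet> (A$i$j * y$j))"
    by (simp add: inner_vec_def matrix_vector_mult_def inner_sum_right)
  also have "\<dots> = (\<Sum>i\<in>UNIV. \<Sum>j\<in>UNIV. (cnj (A$i$j) * x$i) \<bullet> y$j)"
    by (simp only: inner_complex_mult)
  also have "\<dots> = (\<Sum>j\<in>UNIV. \<Sum>i\<in>UNIV. (cnj (A$i$j) * x$i) \<bullet> y$j)" by (rule sum.swap)
  also have "\<dots> = (ctranspose A *v x) \<bullet> y"
    by (simp add: inner_vec_def matrix_vector_mult_def inner_sum_left ctranspose_def)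
  finally show ?thesis .
qed

lemma matrix_eqI_inner:
  fixes A C :: "complex^'q^'p"
  assumes "\<And>x y. x \<bullet> (A *v y) = x \<bullet> (C *v y)" shows "A = C"
proof -
  have "A *v y = C *v y" for y
    using assms by (metis vector_eq_ldot)
  then show ?thesis by (simp add: matrix_eq)
qed

lemma hermitian_iff_selfadjoint:
  "hermitian A \<longleftrightarrow> (\<forall>x y. x \<bullet> (A *v y) = (A *v x) \<bullet> y)"
proof
  show "hermitian A \<Longrightarrow> (\<forall>x y. x \<bullet> (A *v y) = (A *v x) \<bullet> y)"
    by (metis hermitian_def inner_ctranspose_mv)
next
  assume *: "\<forall>x y. x \<bullet> (A *v y) = (A *v x) \<bullet> y"
  show "hermitian A"
    unfolding hermitian_def
  proof (rule matrix_eqI_inner)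
    fix x y
    show "x \<bullet> (ctranspose A *v y) = x \<bullet> (A *v y)"
      using * inner_ctranspose_mv[of x "ctranspose A" y] by simp
  qed
qed

lemma hermitian_eigenbasis:
  assumes "hermitian A"
  obtains B c where "orthonormal_basis B" "\<And>b. b \<in> B \<Longrightarrow> A *v b = c b *\<^sub>R b"
  using selfadjoint_eigenbasis[OF linear_mv, of A] assms
  unfolding hermitian_iff_selfadjoint by metis

text \<open>The standard way to prove matrix identities below: a real eigenbasis spans over the
  reals, so the identity need only be checked on eigenvectors.\<close>

lemma matrix_eqI_basis:
  fixes A C :: "complex^'q^'p"
  assumes "orthonormal_basis B" and "\<And>b. b \<in> B \<Longrightarrow> A *v b = C *v b"
  shows "A = C"
proof -
  have "A *v x = C *v x" for x
    by (rule linear_eq_on[OF linear_mv linear_mv, of _ B])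
      (use assms in \<open>auto simp: orthonormal_basis_def\<close>)
  then show ?thesis by (simp add: matrix_eq)
qed

lemma ctranspose_mult: "ctranspose (A ** B) = ctranspose B ** ctranspose A"
  by (simp add: ctranspose_def matrix_matrix_mult_def vec_eq_iff mult.commute)

lemma linear_ctranspose: "linear (ctranspose :: complex^'q^'p \<Rightarrow> _)"
  by (rule linearI) (simp_all add: ctranspose_def vec_eq_iff)

lemma inner_ctranspose: "ctranspose A \<bullet> ctranspose B = A \<bullet> B"
proof -
  have "ctranspose A \<bullet> ctranspose B = (\<Sum>i\<in>UNIV. \<Sum>j\<in>UNIV. A$j$i \<bullet> B$j$i)"
    by (simp add: inner_vec_def ctranspose_def inner_complex_def)
  also have "\<dots> = A \<bullet> B" unfolding inner_vec_def by (rule sum.swap)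
  finally show ?thesis .
qed

lemma inner_mm_left: "X \<bullet> (A ** B) = (ctranspose A ** X) \<bullet> (B :: complex^'r^'q)"
proof -
  \<comment> \<open>Any orthonormal basis will do; the identity map has one consisting of
    eigenvectors.\<close>
  obtain E :: "(complex^'r) set" and c where E: "orthonormal_basis E"
    using selfadjoint_eigenbasis[of "\<lambda>x. x"] by (metis linear_ident)
  have "2 * (X \<bullet> (A ** B)) = 2 * ((ctranspose A ** X) \<bullet> B)"
    unfolding inner_matrix_orthonormal_basis[OF E, symmetric]
    by (simp add: matrix_vector_mul_assoc[symmetric] inner_ctranspose_mv)
  then show ?thesis by simp
qed

lemma inner_mm_right: "X \<bullet> (A ** B) = (X ** ctranspose B) \<bullet> (A :: complex^'q^'p)"
proof -
  have "X \<bullet> (A ** B) = ctranspose X \<bullet> (ctranspose B ** ctranspose A)"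
    by (metis ctranspose_mult inner_ctranspose)
  also have "\<dots> = (B ** ctranspose X) \<bullet> ctranspose A" by (simp add: inner_mm_left)
  also have "\<dots> = (X ** ctranspose B) \<bullet> A"
    by (metis ctranspose_ctranspose ctranspose_mult inner_ctranspose)
  finally show ?thesis .
qed

lemma Re_trace_mult: "Re (trace (A ** B)) = ctranspose A \<bullet> B"
proof -
  have "Re (trace (A ** B)) = (\<Sum>i\<in>UNIV. \<Sum>k\<in>UNIV. cnj (A$i$k) \<bullet> B$k$i)"
    by (simp add: trace_def matrix_matrix_mult_def inner_complex_def Re_sum)
  also have "\<dots> = (\<Sum>k\<in>UNIV. \<Sum>i\<in>UNIV. cnj (A$i$k) \<bullet> B$k$i)" by (rule sum.swap)
  finally show ?thesis by (simp add: inner_vec_def ctranspose_def)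
qed

lemma bounded_bilinear_mm:
  "bounded_bilinear ((**) :: complex^'q^'p \<Rightarrow> complex^'r^'q \<Rightarrow> complex^'r^'p)"
  unfolding bilinear_conv_bounded_bilinear[symmetric] bilinear_def
  by (intro conjI allI linearI)
    (simp_all add: matrix_matrix_mult_def vec_eq_iff sum.distrib scaleR_sum_right algebra_simps)

lemma bounded_bilinear_mv:
  "bounded_bilinear ((*v) :: complex^'q^'p \<Rightarrow> complex^'q \<Rightarrow> complex^'p)"
  unfolding bilinear_conv_bounded_bilinear[symmetric] bilinear_def
  by (intro conjI allI linearI)
    (simp_all add: matrix_vector_mult_def vec_eq_iff sum.distrib scaleR_sum_right algebra_simps)

section \<open>The matrix exponential and logarithm\<close>

lemma subspace_hermitian: "subspace {A. hermitian A}"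
  unfolding hermitian_def
  by (intro subspaceI) (simp_all add: linear_0[OF linear_ctranspose] linear_add[OF linear_ctranspose]
      linear_cmul[OF linear_ctranspose])

lemma hermitian_0: "hermitian 0"
  and hermitian_add: "hermitian A \<Longrightarrow> hermitian B \<Longrightarrow> hermitian (A + B)"
  and hermitian_diff: "hermitian A \<Longrightarrow> hermitian B \<Longrightarrow> hermitian (A - B)"
  and hermitian_scaleR: "hermitian A \<Longrightarrow> hermitian (r *\<^sub>R A)"
  and hermitian_minus: "hermitian A \<Longrightarrow> hermitian (- A)"
  using subspace_0[OF subspace_hermitian] subspace_add[OF subspace_hermitian] subspace_diff[OF subspace_hermitian]
    subspace_scale[OF subspace_hermitian] subspace_neg[OF subspace_hermitian] by auto

lemma hermitian_mat_1: "hermitian (mat 1)"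
  by (simp add: hermitian_def ctranspose_def mat_def vec_eq_iff)

lemma scaleR_mv: "(r *\<^sub>R A) *v x = r *\<^sub>R (A *v x :: complex^'p)"
  using linear_cmul[OF bounded_linear.linear[OF bounded_bilinear.bounded_linear_left[OF bounded_bilinear_mv]]] .

lemma mv_scaleR: "A *v (r *\<^sub>R x) = r *\<^sub>R (A *v x :: complex^'p)"
  by (rule linear_cmul[OF linear_mv])

lemma mv_sum: "A *v (\<Sum>i\<in>I. f i) = (\<Sum>i\<in>I. A *v f i :: complex^'p)"
  by (rule linear_sum[OF linear_mv])

lemma diagonal_inner:
  fixes M :: "complex^'m^'m"
  assumes B: "orthonormal_basis B" and d: "\<And>b. b \<in> B \<Longrightarrow> M *v b = d b *\<^sub>R b"
  shows "x \<bullet> (M *v y) = (\<Sum>b\<in>B. d b * ((x \<bullet> b) * (y \<bullet> b)))"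
proof -
  have "M *v y = M *v (\<Sum>b\<in>B. (y \<bullet> b) *\<^sub>R b)" by (simp add: orthonormal_basis_sum[OF B])
  also have "\<dots> = (\<Sum>b\<in>B. (y \<bullet> b) *\<^sub>R d b *\<^sub>R b)"
    by (simp add: mv_sum mv_scaleR d)
  finally show ?thesis by (simp add: inner_sum_right algebra_simps)
qed

lemma hermitian_diagonal:
  fixes M :: "complex^'m^'m"
  assumes B: "orthonormal_basis B" and d: "\<And>b. b \<in> B \<Longrightarrow> M *v b = d b *\<^sub>R b"
  shows "hermitian M"
  unfolding hermitian_iff_selfadjoint
proof (intro allI)
  fix x y
  show "x \<bullet> (M *v y) = (M *v x) \<bullet> y"
    using diagonal_inner[OF B d, of x y] diagonal_inner[OF B d, of y x]
    by (simp add: inner_commute[of "M *v x" y] mult.commute mult.left_commute)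
qed

lemma pos_definite_diagonal:
  fixes M :: "complex^'m^'m"
  assumes B: "orthonormal_basis B" and d: "\<And>b. b \<in> B \<Longrightarrow> M *v b = d b *\<^sub>R b"
    and pos: "\<And>b. b \<in> B \<Longrightarrow> d b > 0"
  shows "pos_definite M"
  unfolding pos_definite_def
proof (intro conjI allI impI)
  show "hermitian M" by (rule hermitian_diagonal[OF B d])
  fix x :: "complex^'m" assume "x \<noteq> 0"
  then obtain b where b: "b \<in> B" "x \<bullet> b \<noteq> 0"
    using orthonormal_basis_sum[OF B, of x] sum.neutral[of B "\<lambda>b. (x \<bullet> b) *\<^sub>R b"] by fastforce
  have "x \<bullet> (M *v x) = (\<Sum>b\<in>B. d b * ((x \<bullet> b) * (x \<bullet> b)))"
    by (rule diagonal_inner[OF B d])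
  also have "\<dots> > 0"
  proof (rule sum_pos2[OF orthonormal_basis_finite[OF B] b(1)])
    show "0 < d b * ((x \<bullet> b) * (x \<bullet> b))" 
      using b not_real_square_gt_zero[of "x \<bullet> b"] pos[of b] by (intro mult_pos_pos[of "d b"]) (simp_all only: simp_thms)
    show "\<And>i. i \<in> B \<Longrightarrow> 0 \<le> d i * ((x \<bullet> i) * (x \<bullet> i))" using pos by (simp add: less_imp_le)
  qed
  finally show "0 < x \<bullet> (M *v x)" .
qed

text \<open>The squares of all eigenvalues over the real basis add up to
  \<open>2 * (norm A)^2\<close>; the factor \<open>2\<close> in the bound rounds the square root of
  \<open>2\<close> up.\<close>

lemma eigenvalue_bound:
  fixes A :: "complex^'m^'m"
  assumes B: "orthonormal_basis B" and d: "\<And>b. b \<in> B \<Longrightarrow> A *v b = c b *\<^sub>R b" and b: "b \<in> B"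
  shows "\<bar>c b\<bar> \<le> 2 * norm A"
proof -
  have "(c b)\<^sup>2 = (A *v b) \<bullet> (A *v b)"
    by (simp add: d[OF b] orthonormal_basis_inner_self[OF B b] power2_eq_square)
  also have "\<dots> \<le> (\<Sum>b\<in>B. (A *v b) \<bullet> (A *v b))"
    by (rule member_le_sum[OF b]) (use orthonormal_basis_finite[OF B] in auto)
  also have "\<dots> = 2 * (norm A)\<^sup>2"
    unfolding inner_matrix_orthonormal_basis[OF B] by (simp only: dot_square_norm)
  also have "\<dots> \<le> (2 * norm A)\<^sup>2" by (simp add: power_mult_distrib)
  finally have "\<bar>c b\<bar>\<^sup>2 \<le> (2 * norm A)\<^sup>2" by simp
  then show ?thesis by (rule power2_le_imp_le) simp
qed

section \<open>The exponential on eigenvectors\<close>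

lemma mpow_eigenvector: "A *v b = c *\<^sub>R b \<Longrightarrow> mpow A n *v b = c ^ n *\<^sub>R b"
proof (induction n)
  case 0
  then show ?case by (simp add: mpow_def)
next
  case (Suc n)
  have "mpow A (Suc n) *v b = A *v (mpow A n *v b)"
    by (simp add: mpow_def matrix_vector_mul_assoc)
  then show ?case using Suc by (simp add: mv_scaleR)
qed

lemma summable_mexp: "summable (\<lambda>n. (1 / fact n) *\<^sub>R mpow (A :: complex^'m^'m) n)"
proof -
  obtain K where K: "K > 0" "\<And>(X :: complex^'m^'m) (Y :: complex^'m^'m). norm (X ** Y) \<le> norm X * norm Y * K"
    using bounded_bilinear.pos_bounded[OF bounded_bilinear_mm] by blast
  have bound: "norm (mpow A n) \<le> norm (mat 1 :: complex^'m^'m) * (K * norm A) ^ n" for n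
  proof (induction n)
    case 0
    then show ?case by (simp add: mpow_def)
  next
    case (Suc n)
    have "norm (mpow A (Suc n)) \<le> norm A * norm (mpow A n) * K"
      using K(2)[of A "mpow A n"] by (simp add: mpow_def)
    also have "\<dots> \<le> norm A * (norm (mat 1 :: complex^'m^'m) * (K * norm A) ^ n) * K"
      using K(1) Suc by (intro mult_right_mono mult_left_mono) auto
    finally show ?case by (simp add: algebra_simps)
  qed
  show ?thesis
  proof (rule summable_comparison_test')
    show "summable (\<lambda>n. norm (mat 1 :: complex^'m^'m) * (inverse (fact n) * (K * norm A) ^ n))"
      by (intro summable_mult summable_exp)
    show "\<And>n. n \<ge> 0 \<Longrightarrow> norm ((1 / fact n) *\<^sub>R mpow A n)
        \<le> norm (mat 1 :: complex^'m^'m) * (inverse (fact n) * (K * norm A) ^ n)"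
      using bound by (simp add: divide_simps mult.commute)
  qed
qed

text \<open>Evaluation at \<open>b\<close> is bounded and linear in the matrix, so the series may be
  evaluated term by term. Later facts about \<open>mexp\<close> rest on this lemma and not on the
  series.\<close>

lemma mexp_eigenvector:
  assumes "A *v b = c *\<^sub>R b"
  shows "mexp A *v b = exp c *\<^sub>R b"
proof -
  have "(\<lambda>n. ((1 / fact n) *\<^sub>R mpow A n) *v b) sums (mexp A *v b)"
    unfolding mexp_def
    by (rule bounded_linear.sums[OF bounded_bilinear.bounded_linear_left[OF bounded_bilinear_mv]])
      (use summable_mexp in \<open>blast intro: summable_sums\<close>)
  moreover have "((1 / fact n) *\<^sub>R mpow A n) *v b = (c ^ n /\<^sub>R fact n) *\<^sub>R b" for n
    by (simp add: scaleR_mv mpow_eigenvector[OF assms] divide_inverse mult.commute)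
  moreover have "(\<lambda>n. (c ^ n /\<^sub>R fact n) *\<^sub>R b) sums (exp c *\<^sub>R b)"
    by (intro bounded_linear.sums[OF bounded_linear_scaleR_left] exp_converges)
  ultimately show ?thesis by (simp add: sums_unique2)
qed

lemma mexp_scaleR_eigenvector: "A *v b = c *\<^sub>R b \<Longrightarrow> mexp (t *\<^sub>R A) *v b = exp (t * c) *\<^sub>R b"
  by (rule mexp_eigenvector) (simp add: scaleR_mv)

lemma pos_definite_mexp:
  assumes "hermitian A" shows "pos_definite (mexp A)"
proof -
  obtain B c where B: "orthonormal_basis B" "\<And>b. b \<in> B \<Longrightarrow> A *v b = c b *\<^sub>R b"
    using hermitian_eigenbasis[OF assms] by blast
  show ?thesis
    by (rule pos_definite_diagonal[OF B(1), of _ "\<lambda>b. exp (c b)"]) (simp_all add: mexp_eigenvector B)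
qed

lemma hermitian_mexp: "hermitian A \<Longrightarrow> hermitian (mexp A)"
  using pos_definite_mexp pos_definite_def by blast

lemma mexp_0: "mexp 0 = (mat 1 :: complex^'m^'m)"
proof -
  obtain B :: "(complex^'m) set" and c where B: "orthonormal_basis B"
    using hermitian_eigenbasis[OF hermitian_0] by metis
  show ?thesis
    by (rule matrix_eqI_basis[OF B]) (simp add: mexp_eigenvector[where c=0])
qed

text \<open>Turns the prefactor \<open>1/e\<close> of the densities into a shift of their
  logarithm.\<close>

lemma mexp_diff_mat_1:
  assumes "hermitian A" shows "mexp (A - mat 1) = (1 / exp 1) *\<^sub>R mexp A"
proof -
  obtain B c where B: "orthonormal_basis B" "\<And>b. b \<in> B \<Longrightarrow> A *v b = c b *\<^sub>R b"
    using hermitian_eigenbasis[OF assms] by blast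
  show ?thesis
  proof (rule matrix_eqI_basis[OF B(1)])
    fix b assume b: "b \<in> B"
    have "(A - mat 1) *v b = (c b - 1) *\<^sub>R b"
      by (simp add: B(2)[OF b] matrix_vector_mult_diff_rdistrib scaleR_diff_left)
    from mexp_eigenvector[OF this]
    show "mexp (A - mat 1) *v b = ((1 / exp 1) *\<^sub>R mexp A) *v b"
      by (simp add: mexp_eigenvector[OF B(2)[OF b]] scaleR_mv exp_diff)
  qed
qed

lemma mexp_commute:
  assumes "hermitian A" shows "A ** mexp (t *\<^sub>R A) = mexp (t *\<^sub>R A) ** A"
proof -
  obtain B c where B: "orthonormal_basis B" "\<And>b. b \<in> B \<Longrightarrow> A *v b = c b *\<^sub>R b"
    using hermitian_eigenbasis[OF assms] by blast
  show ?thesis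
    by (rule matrix_eqI_basis[OF B(1)])
      (simp add: matrix_vector_mul_assoc[symmetric] mexp_scaleR_eigenvector[OF B(2)] B(2) mv_scaleR)
qed

text \<open>One eigenbasis of \<open>A\<close> serves all \<open>t\<close>, so the pairing with a
  fixed matrix \<open>X\<close> is a finite combination of the functions
  \<open>exp (t * c b)\<close>. The derivative of the matrix function is assembled from these
  pairings.\<close>

lemma has_vector_derivative_mexp:
  fixes A :: "complex^'m^'m"
  assumes "hermitian A"
  shows "((\<lambda>t. mexp (t *\<^sub>R A)) has_vector_derivative A ** mexp (t *\<^sub>R A)) (at t within T)"
proof -
  obtain B c where B: "orthonormal_basis B" "\<And>b. b \<in> B \<Longrightarrow> A *v b = c b *\<^sub>R b"
    using hermitian_eigenbasis[OF assms] by blast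
  have *: "M \<bullet> X = (\<Sum>b\<in>B. (M *v b) \<bullet> (X *v b)) / 2" for M X :: "complex^'m^'m"
    using inner_matrix_orthonormal_basis[OF B(1), of M X] by simp
  have "((\<lambda>t. mexp (t *\<^sub>R A) \<bullet> X) has_real_derivative (A ** mexp (t *\<^sub>R A)) \<bullet> X) (at t within T)" for X
    unfolding *
    by (auto simp: matrix_vector_mul_assoc[symmetric] mexp_scaleR_eigenvector[OF B(2)] B(2) mv_scaleR
        intro!: derivative_eq_intros sum.cong)
  then have "((\<lambda>t. mexp (t *\<^sub>R A) \<bullet> X) has_derivative
      (\<lambda>h. (h *\<^sub>R (A ** mexp (t *\<^sub>R A))) \<bullet> X)) (at t within T)" for X
    by (simp add: has_field_derivative_def mult_commute_abs)
  then show ?thesis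
    unfolding has_vector_derivative_def has_derivative_componentwise_within[of "\<lambda>t. mexp (t *\<^sub>R A)"]
    by blast
qed

text \<open>Duhamel's formula: the product \<open>exp ((1 - s) A) exp (s C)\<close> runs from
  \<open>exp A\<close> to \<open>exp C\<close>, and the integrand is its derivative. The terms with
  \<open>A\<close> and \<open>C\<close> meet in the middle because \<open>A\<close> commutes with
  its own exponential.\<close>

lemma has_integral_mexp_diff:
  assumes A: "hermitian A" and C: "hermitian C"
  shows "((\<lambda>s. mexp ((1 - s) *\<^sub>R A) ** (C - A) ** mexp (s *\<^sub>R C)) has_integral (mexp C - mexp A)) {0..1}"
proof -
  let ?E = "\<lambda>s. mexp ((1 - s) *\<^sub>R A)" and ?F = "\<lambda>s. mexp (s *\<^sub>R C)"
  have E: "(?E has_vector_derivative - (?E s ** A)) (at s within {0..1})" for s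
  proof -
    have "((\<lambda>t. mexp (t *\<^sub>R A)) \<circ> (\<lambda>s. 1 - s) has_vector_derivative (-1) *\<^sub>R (A ** ?E s)) (at s within {0..1})"
      by (rule vector_diff_chain_within)
        (auto intro!: derivative_eq_intros has_vector_derivative_mexp[OF A])
    then show ?thesis by (simp add: mexp_commute[OF A] o_def)
  qed
  have "((\<lambda>s. ?E s ** ?F s) has_vector_derivative ?E s ** (C - A) ** ?F s) (at s within {0..1})" for s
  proof -
    have "((\<lambda>s. ?E s ** ?F s) has_vector_derivative ?E s ** (C ** ?F s) + (- (?E s ** A)) ** ?F s) (at s within {0..1})"
      by (rule bounded_bilinear.has_vector_derivative[OF bounded_bilinear_mm E has_vector_derivative_mexp[OF C]])
    moreover have "?E s ** (C ** ?F s) + (- (?E s ** A)) ** ?F s = ?E s ** (C - A) ** ?F s"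
      by (simp add: bounded_bilinear.minus_left[OF bounded_bilinear_mm]
          bounded_bilinear.diff_left[OF bounded_bilinear_mm] bounded_bilinear.diff_right[OF bounded_bilinear_mm]
          matrix_mul_assoc)
    ultimately show ?thesis by simp
  qed
  from fundamental_theorem_of_calculus[OF _ this]
  show ?thesis by (simp add: mexp_0)
qed

text \<open>Every eigenvalue of the exponential is at most \<open>exp (2 * norm A)\<close> by
  \<open>eigenvalue_bound\<close>, and there are \<open>DIM\<close> of them. Only boundedness on
  balls is wanted, so the constants are crude.\<close>

lemma norm_mexp_le:
  assumes "hermitian (A :: complex^'m^'m)"
  shows "norm (mexp A) \<le> DIM(complex^'m) * exp (2 * norm A)"
proof -
  obtain B c where B: "orthonormal_basis B" "\<And>b. b \<in> B \<Longrightarrow> A *v b = c b *\<^sub>R b"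
    using hermitian_eigenbasis[OF assms] by blast
  have "2 * (norm (mexp A))\<^sup>2 = (\<Sum>b\<in>B. (exp (c b))\<^sup>2)"
    unfolding dot_square_norm[symmetric] inner_matrix_orthonormal_basis[OF B(1), symmetric]
    by (intro sum.cong refl) (simp add: mexp_eigenvector[OF B(2)] orthonormal_basis_inner_self[OF B(1)] power2_eq_square)
  also have "\<dots> \<le> (\<Sum>b\<in>B. (exp (2 * norm A))\<^sup>2)"
  proof (intro sum_mono power_mono)
    fix b assume "b \<in> B"
    from eigenvalue_bound[OF B this] show "exp (c b) \<le> exp (2 * norm A)" by simp
  qed simp
  also have "\<dots> \<le> 2 * (DIM(complex^'m) * exp (2 * norm A))\<^sup>2"
  proof -
    have "real d \<le> 2 * (real d)\<^sup>2" for d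
      by (cases "d = 0") (auto simp: power2_eq_square intro: order_trans[OF _ mult_left_mono[of 1 "real d" "real d"]])
    then show ?thesis
      by (simp add: orthonormal_basis_card[OF B(1)] power_mult_distrib del: DIM_cart)
  qed
  finally have "(norm (mexp A))\<^sup>2 \<le> (DIM(complex^'m) * exp (2 * norm A))\<^sup>2" by simp
  then show ?thesis by (rule power2_le_imp_le) simp
qed

text \<open>Klein's inequality, evaluated in eigenbases \<open>B\<close> of \<open>X\<close> and \<open>E\<close> of \<open>Y\<close>: with the weights
  \<open>(b \<bullet> e)\<^sup>2\<close> it reduces to \<open>exp \<beta> \<ge> exp \<alpha> + exp \<alpha> (\<beta> - \<alpha>)\<close> for the eigenvalues.\<close>

lemma Klein:
  fixes X Y :: "complex^'m^'m"
  assumes X: "hermitian X" and Y: "hermitian Y"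
  shows "mexp X \<bullet> (X - Y) - mat 1 \<bullet> mexp X + mat 1 \<bullet> mexp Y \<ge> 0" (is "?k \<ge> 0")
    and "mexp X \<bullet> (X - Y) - mat 1 \<bullet> mexp X + mat 1 \<bullet> mexp Y = 0 \<Longrightarrow> X = Y"
proof -
  obtain B c where B: "orthonormal_basis B" "\<And>b. b \<in> B \<Longrightarrow> X *v b = c b *\<^sub>R b"
    using hermitian_eigenbasis[OF X] by blast
  obtain E d where E: "orthonormal_basis E" "\<And>b. b \<in> E \<Longrightarrow> Y *v b = d b *\<^sub>R b"
    using hermitian_eigenbasis[OF Y] by blast
  define w where "w b e = (b \<bullet> e)\<^sup>2" for b e :: "complex^'m"
  define h where "h b e = exp (c b) * (c b - d e) - exp (c b) + exp (d e)" for b e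
  have h0: "h b e \<ge> 0" and h1: "h b e = 0 \<Longrightarrow> c b = d e" for b e
  proof -
    have *: "h b e = exp (c b) * (exp (d e - c b) - (1 + (d e - c b)))"
      by (simp add: h_def exp_diff algebra_simps)
    show "h b e \<ge> 0" unfolding * using exp_ge_add_one_self[of "d e - c b"] by simp
    assume "h b e = 0"
    then have "exp (d e - c b) = 1 + (d e - c b)" by (simp add: *)
    then have "ln (exp (d e - c b)) = exp (d e - c b) - 1"
      using ln_exp[of "d e - c b"] by linarith
    then have "exp (d e - c b) = 1" by (intro ln_eq_minus_one) auto
    then show "c b = d e" by simp
  qed
  have wE: "(\<Sum>e\<in>E. w b e) = 1" if "b \<in> B" for b
    using orthonormal_basis_inner[OF E(1), of b b] orthonormal_basis_inner_self[OF B(1) that]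
    by (simp add: w_def power2_eq_square)
  have wB: "(\<Sum>b\<in>B. w b e) = 1" if "e \<in> E" for e
    using orthonormal_basis_inner[OF B(1), of e e] orthonormal_basis_inner_self[OF E(1) that]
    by (simp add: w_def power2_eq_square inner_commute)
  have bXb: "b \<bullet> (Y *v b) = (\<Sum>e\<in>E. d e * w b e)" for b
    by (simp add: diagonal_inner[OF E] w_def power2_eq_square)
  have "2 * ?k = (\<Sum>b\<in>B. exp (c b) * (c b - (\<Sum>e\<in>E. d e * w b e)) - exp (c b)) + (\<Sum>e\<in>E. exp (d e))"
  proof -
    have "2 * (mexp X \<bullet> (X - Y)) = (\<Sum>b\<in>B. exp (c b) * (c b - (\<Sum>e\<in>E. d e * w b e)))"
      unfolding inner_matrix_orthonormal_basis[OF B(1), symmetric] bXb[symmetric]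
      by (intro sum.cong refl) (simp add: mexp_eigenvector[OF B(2)] matrix_vector_mult_diff_rdistrib B(2)
          inner_diff_right orthonormal_basis_inner_self[OF B(1)] algebra_simps)
    moreover have "2 * (mat 1 \<bullet> mexp X) = (\<Sum>b\<in>B. exp (c b))"
      unfolding inner_matrix_orthonormal_basis[OF B(1), symmetric]
      by (intro sum.cong refl) (simp add: mexp_eigenvector[OF B(2)] orthonormal_basis_inner_self[OF B(1)])
    moreover have "2 * (mat 1 \<bullet> mexp Y) = (\<Sum>e\<in>E. exp (d e))"
      unfolding inner_matrix_orthonormal_basis[OF E(1), symmetric]
      by (intro sum.cong refl) (simp add: mexp_eigenvector[OF E(2)] orthonormal_basis_inner_self[OF E(1)])
    ultimately show ?thesis by (simp add: sum_subtractf)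
  qed
  also have "(\<Sum>e\<in>E. exp (d e)) = (\<Sum>e\<in>E. \<Sum>b\<in>B. exp (d e) * w b e)"
    by (intro sum.cong refl) (simp add: sum_distrib_left[symmetric] wB)
  also have "\<dots> = (\<Sum>b\<in>B. \<Sum>e\<in>E. exp (d e) * w b e)" by (rule sum.swap)
  also have "(\<Sum>b\<in>B. exp (c b) * (c b - (\<Sum>e\<in>E. d e * w b e)) - exp (c b)) =
     (\<Sum>b\<in>B. \<Sum>e\<in>E. (exp (c b) * (c b - d e) - exp (c b)) * w b e)"
  proof (intro sum.cong refl)
    fix b assume b: "b \<in> B"
    have "(\<Sum>e\<in>E. (exp (c b) * (c b - d e) - exp (c b)) * w b e) =
      (\<Sum>e\<in>E. (exp (c b) * c b - exp (c b)) * w b e - exp (c b) * (d e * w b e))"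
      by (intro sum.cong refl) (simp add: algebra_simps)
    also have "\<dots> = (exp (c b) * c b - exp (c b)) * (\<Sum>e\<in>E. w b e) - exp (c b) * (\<Sum>e\<in>E. d e * w b e)"
      by (simp add: sum_subtractf sum_distrib_left)
    finally show "exp (c b) * (c b - (\<Sum>e\<in>E. d e * w b e)) - exp (c b) =
      (\<Sum>e\<in>E. (exp (c b) * (c b - d e) - exp (c b)) * w b e)"
      by (simp add: wE[OF b] algebra_simps)
  qed
  finally have k: "2 * ?k = (\<Sum>b\<in>B. \<Sum>e\<in>E. h b e * w b e)"
    by (simp add: sum.distrib[symmetric] h_def algebra_simps)
  have nn: "0 \<le> h b e * w b e" for b e using h0 by (simp add: w_def)
  then have "0 \<le> 2 * ?k" unfolding k by (intro sum_nonneg)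
  then show "?k \<ge> 0" by simp
  assume "?k = 0"
  then have "\<forall>b\<in>B. \<forall>e\<in>E. h b e * w b e = 0"
    using k nn orthonormal_basis_finite[OF B(1)] orthonormal_basis_finite[OF E(1)]
    by (simp add: sum_nonneg_eq_0_iff sum_nonneg)
  \<comment> \<open>If the weight vanishes, both sides are \<open>0\<close>; otherwise
    \<open>h b e = 0\<close> forces the two eigenvalues to agree.\<close>
  then have eq: "c b * (e \<bullet> b) = d e * (e \<bullet> b)" if "b \<in> B" "e \<in> E" for b e
    using that h1[of b e] by (fastforce simp: w_def inner_commute)
  show "X = Y"
  proof (rule matrix_eqI_basis[OF E(1)])
    fix e assume e: "e \<in> E"
    have "X *v e = (\<Sum>b\<in>B. (c b * (e \<bullet> b)) *\<^sub>R b)"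
      using arg_cong[OF orthonormal_basis_sum[OF B(1), of e], of "(*v) X"]
      by (simp add: mv_sum mv_scaleR B(2) mult.commute)
    also have "\<dots> = d e *\<^sub>R (\<Sum>b\<in>B. (e \<bullet> b) *\<^sub>R b)"
      by (simp add: eq e scaleR_sum_right cong: sum.cong)
    finally show "X *v e = Y *v e"
      by (simp add: orthonormal_basis_sum[OF B(1)] E(2)[OF e])
  qed
qed

text \<open>With equal exponentials the Klein expressions for \<open>X, Y\<close> and for
  \<open>Y, X\<close> are negatives of each other; both are nonnegative, hence
  \<open>0\<close>.\<close>

lemma mexp_inject:
  assumes "hermitian X" "hermitian Y" "mexp X = mexp Y" shows "X = Y"
  using Klein[OF assms(1,2)] Klein(1)[OF assms(2,1)] assms(3) by (simp add: inner_diff_right)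

lemma mlog_mexp: "hermitian X \<Longrightarrow> mlog (mexp X) = X"
  unfolding mlog_def by (rule the_equality) (auto intro: mexp_inject)

lemma mpowr_mexp: "hermitian A \<Longrightarrow> mpowr (mexp A) s = mexp (s *\<^sub>R A)"
  by (simp add: mpowr_def mlog_mexp)

text \<open>The operator defined by the logarithms of the eigenvalues on a real orthonormal eigenbasis
  commutes with multiplication by \<open>\<i>\<close>, because the eigenspaces do, hence it is a complex matrix.\<close>

lemma pos_definite_eq_mexp:
  fixes C :: "complex^'m^'m"
  assumes "pos_definite C"
  obtains X where "hermitian X" "mexp X = C"
proof -
  have hC: "hermitian C" using assms by (simp add: pos_definite_def)
  obtain B c where B: "orthonormal_basis B" "\<And>b. b \<in> B \<Longrightarrow> C *v b = c b *\<^sub>R b"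
    using hermitian_eigenbasis[OF hC] by blast
  have cpos: "c b > 0" if "b \<in> B" for b
  proof -
    have "b \<noteq> 0" using orthonormal_basis_norm1[OF B(1) that] by auto
    then have "0 < b \<bullet> (C *v b)" using assms by (simp add: pos_definite_def)
    then show ?thesis by (simp add: B(2)[OF that] orthonormal_basis_inner_self[OF B(1) that])
  qed
  define f where "f x = (\<Sum>b\<in>B. (ln (c b) * (x \<bullet> b)) *\<^sub>R b)" for x
  have linf: "linear f"
    by (rule linearI) (simp_all add: f_def inner_add_left algebra_simps sum.distrib scaleR_sum_right)
  \<comment> \<open>On the whole eigenspace of \<open>C\<close> for \<open>r\<close>, not just on
    basis members, \<open>f\<close> acts as \<open>ln r\<close>: by self-adjointness
    \<open>y\<close> has components only along those \<open>b\<close> with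
    \<open>c b = r\<close>.\<close>
  have f_eig: "f y = ln r *\<^sub>R y" if "C *v y = r *\<^sub>R y" for y r
  proof -
    have "ln (c b) * (y \<bullet> b) = ln r * (y \<bullet> b)" if "b \<in> B" for b
    proof -
      have "b \<bullet> (C *v y) = (C *v b) \<bullet> y" using hC by (simp add: hermitian_iff_selfadjoint)
      then have "r * (y \<bullet> b) = c b * (y \<bullet> b)"
        using \<open>C *v y = r *\<^sub>R y\<close> B(2)[OF \<open>b \<in> B\<close>] by (simp add: inner_commute)
      then show ?thesis by auto
    qed
    then have "f y = ln r *\<^sub>R (\<Sum>b\<in>B. (y \<bullet> b) *\<^sub>R b)"
      unfolding f_def scaleR_sum_right by (intro sum.cong refl) (simp only: scaleR_scaleR)
    then show ?thesis by (simp add: orthonormal_basis_sum[OF B(1)])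
  qed
  have fB: "f b = ln (c b) *\<^sub>R b" if "b \<in> B" for b using f_eig B(2)[OF that] .
  have lin_s: "linear (\<lambda>x :: complex^'m. z *s x)" for z
    by (rule linearI) (simp_all add: vec_eq_iff algebra_simps)
  have fz: "f (z *s x) = z *s f x" for z x
  proof -
    have "(f \<circ> (\<lambda>x. z *s x)) x = ((\<lambda>x. z *s x) \<circ> f) x"
    proof (rule linear_eq_on[of "f \<circ> (\<lambda>x. z *s x)" "(\<lambda>x. z *s x) \<circ> f" x B])
      show "x \<in> span B" using B(1) by (simp add: orthonormal_basis_def)
      fix b assume b: "b \<in> B"
      have "C *v (z *s b) = z *s (C *v b)" by (simp add: vec_eq_iff matrix_vector_mult_def sum_distrib_left algebra_simps)
      also have "\<dots> = c b *\<^sub>R (z *s b)" by (simp add: B(2)[OF b] vec_eq_iff)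
      finally have "f (z *s b) = ln (c b) *\<^sub>R (z *s b)" by (rule f_eig)
      then show "(f \<circ> (\<lambda>x. z *s x)) b = ((\<lambda>x. z *s x) \<circ> f) b"
        by (simp add: fB[OF b] vec_eq_iff)
    qed (intro linear_compose linf lin_s)+
    then show ?thesis by simp
  qed
  \<comment> \<open>Real linearity would not be enough here: only a complex-linear map is given by a
    complex matrix.\<close>
  have "Vector_Spaces.linear (*s) (*s) f"
    by unfold_locales (simp_all add: vec_eq_iff fz linear_add[OF linf] algebra_simps)
  then have X: "matrix f *v x = f x" for x by (rule matrix_works)
  show thesis
  proof (rule that)
    show "hermitian (matrix f)" by (rule hermitian_diagonal[OF B(1), where d="\<lambda>b. ln (c b)"]) (simp add: X fB)
    show "mexp (matrix f) = C"
    proof (rule matrix_eqI_basis[OF B(1)])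
      fix b assume b: "b \<in> B"
      have "mexp (matrix f) *v b = exp (ln (c b)) *\<^sub>R b"
        by (rule mexp_eigenvector) (simp add: X fB b)
      then show "mexp (matrix f) *v b = C *v b" using cpos b by (simp add: B(2))
    qed
  qed
qed

section \<open>Estimates for the matrix exponential\<close>

lemma mexp_segment_bound:
  assumes "hermitian (A :: complex^'m^'m)" "norm A \<le> r" "0 \<le> s" "s \<le> 1"
  shows "norm (mexp (s *\<^sub>R A)) \<le> DIM(complex^'m) * exp (2 * r)"
proof -
  have "s * norm A \<le> 1 * r" using assms by (intro mult_mono) auto
  then have "exp (2 * norm (s *\<^sub>R A)) \<le> exp (2 * r)" using assms(3) by simp
  with norm_mexp_le[OF hermitian_scaleR[OF assms(1)], of s] show ?thesis
    by (meson mult_left_mono of_nat_0_le_iff order_trans)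
qed

text \<open>In Duhamel's formula both exponentials are bounded on the ball of radius
  \<open>r\<close>, and the remaining factor is \<open>C - A\<close>.\<close>

lemma mexp_lipschitz:
  obtains L where "L > 0" "\<And>A C :: complex^'m^'m. hermitian A \<Longrightarrow> hermitian C \<Longrightarrow> norm A \<le> r \<Longrightarrow>
    norm C \<le> r \<Longrightarrow> norm (mexp C - mexp A) \<le> L * norm (C - A)"
proof -
  obtain K where K: "K > 0" "\<And>(X :: complex^'m^'m) (Y :: complex^'m^'m). norm (X ** Y) \<le> norm X * norm Y * K"
    using bounded_bilinear.pos_bounded[OF bounded_bilinear_mm] by blast
  define M where "M = DIM(complex^'m) * exp (2 * r)"
  have M: "M > 0" by (simp add: M_def)
  have "norm (mexp C - mexp A) \<le> (M * K * M * K) * norm (C - A)"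
    if A: "hermitian A" "norm A \<le> r" and C: "hermitian C" "norm C \<le> r" for A C :: "complex^'m^'m"
  proof -
    have "norm (mexp ((1 - s) *\<^sub>R A) ** (C - A) ** mexp (s *\<^sub>R C)) \<le> (M * K * M * K) * norm (C - A)"
      if s: "s \<in> {0..1}" for s
    proof -
      have E: "norm (mexp ((1 - s) *\<^sub>R A)) \<le> M" and F: "norm (mexp (s *\<^sub>R C)) \<le> M"
        unfolding M_def using s by (intro mexp_segment_bound A C; simp)+
      have "norm (mexp ((1 - s) *\<^sub>R A) ** (C - A) ** mexp (s *\<^sub>R C))
        \<le> norm (mexp ((1 - s) *\<^sub>R A)) * norm (C - A) * K * norm (mexp (s *\<^sub>R C)) * K"
        by (rule order_trans[OF K(2)], intro mult_right_mono K(2)) (use K(1) in auto)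
      also have "\<dots> \<le> M * norm (C - A) * K * M * K"
        using K(1) E F M by (intro mult_mono mult_nonneg_nonneg) auto
      finally show ?thesis by (simp add: algebra_simps)
    qed
    then show ?thesis
      using has_integral_bound_real[OF _ _ has_integral_mexp_diff[OF A(1) C(1)], of "(M * K * M * K) * norm (C - A)" "{}"] K(1) M
      by simp
  qed
  with K(1) M show thesis by (intro that[of "M * K * M * K"]) auto
qed

lemma continuous_on_mexp_hermitian: "continuous_on {A :: complex^'m^'m. hermitian A} mexp"
  unfolding continuous_on_def
proof
  fix A :: "complex^'m^'m" assume A: "A \<in> {A. hermitian A}"
  \<comment> \<open>The radius \<open>norm A + 1\<close> contains the unit ball around
    \<open>A\<close>, so one Lipschitz constant serves near \<open>A\<close>.\<close>
  obtain L where L: "\<And>A' C :: complex^'m^'m. hermitian A' \<Longrightarrow> hermitian C \<Longrightarrow> norm A' \<le> norm A + 1 \<Longrightarrow>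
    norm C \<le> norm A + 1 \<Longrightarrow> norm (mexp C - mexp A') \<le> L * norm (C - A')"
    using mexp_lipschitz by blast
  have "\<forall>\<^sub>F C in at A within {A. hermitian A}. hermitian C \<and> norm (C - A) < 1"
    using eventually_at_ball[of 1 A "{A. hermitian A}"]
    by (auto simp: dist_norm norm_minus_commute elim!: eventually_mono)
  then have ev: "\<forall>\<^sub>F C in at A within {A. hermitian A}. norm (mexp C - mexp A) \<le> L * norm (C - A)"
  proof (eventually_elim)
    case (elim C)
    then have "norm C \<le> norm A + 1" using norm_triangle_sub[of C A] by linarith
    then show ?case using L[of A C] A elim by simp
  qed
  have lim: "((\<lambda>C. L * norm (C - A)) \<longlongrightarrow> L * norm (A - A)) (at A within {A. hermitian A})"
    by (intro tendsto_intros)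
  have "((\<lambda>C. mexp C - mexp A) \<longlongrightarrow> 0) (at A within {A. hermitian A})"
    using Lim_null_comparison[OF ev] lim by simp
  then show "(mexp \<longlongrightarrow> mexp A) (at A within {A. hermitian A})" by (simp add: LIM_zero_iff)
qed

lemma continuous_on_mexp [continuous_intros]:
  assumes "continuous_on T f" "\<And>x. x \<in> T \<Longrightarrow> hermitian (f x)"
  shows "continuous_on T (\<lambda>x. mexp (f x))"
  by (rule continuous_on_compose2[OF continuous_on_mexp_hermitian assms(1)]) (use assms(2) in auto)

lemmas continuous_on_mm [continuous_intros] = bounded_bilinear.continuous_on[OF bounded_bilinear_mm]

section \<open>The derivative of the exponential\<close>

lemma nc_mult_has_integral:
  assumes A: "hermitian A"
  shows "((\<lambda>s. mexp ((1 - s) *\<^sub>R A) ** D ** mexp (s *\<^sub>R A)) has_integral nc_mult (mexp A) D) {0..1}"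
proof -
  have "continuous_on {0..1} (\<lambda>s. mexp ((1 - s) *\<^sub>R A) ** D ** mexp (s *\<^sub>R A))"
    by (intro continuous_intros hermitian_scaleR A)
  then have "integrable (lebesgue_on {0..1}) (\<lambda>s. mexp ((1 - s) *\<^sub>R A) ** D ** mexp (s *\<^sub>R A))"
    by (rule continuous_imp_integrable_real)
  from has_integral_integral_lebesgue_on[OF this]
  show ?thesis by (simp add: nc_mult_def mpowr_mexp[OF A])
qed

text \<open>The integral for \<open>nc_mult\<close> is Duhamel's with \<open>exp (s A)\<close> in
  place of \<open>exp (s C)\<close> on the right. The difference thus contains \<open>C - A\<close>
  once explicitly and once more through the Lipschitz bound, which makes the remainder
  quadratic.\<close>

lemma mexp_taylor:
  obtains L where "L > 0" "\<And>A C :: complex^'m^'m. hermitian A \<Longrightarrow> hermitian C \<Longrightarrow> norm A \<le> r \<Longrightarrow>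
    norm C \<le> r \<Longrightarrow> norm (mexp C - mexp A - nc_mult (mexp A) (C - A)) \<le> L * (norm (C - A))\<^sup>2"
proof -
  obtain K where K: "K > 0" "\<And>(X :: complex^'m^'m) (Y :: complex^'m^'m). norm (X ** Y) \<le> norm X * norm Y * K"
    using bounded_bilinear.pos_bounded[OF bounded_bilinear_mm] by blast
  define M where "M = DIM(complex^'m) * exp (2 * r)"
  have M: "M > 0" by (simp add: M_def)
  obtain L where L: "L > 0" "\<And>A C :: complex^'m^'m. hermitian A \<Longrightarrow> hermitian C \<Longrightarrow> norm A \<le> r \<Longrightarrow>
    norm C \<le> r \<Longrightarrow> norm (mexp C - mexp A) \<le> L * norm (C - A)"
    using mexp_lipschitz by blast
  have "norm (mexp C - mexp A - nc_mult (mexp A) (C - A)) \<le> (M * K * L * K) * (norm (C - A))\<^sup>2"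
    if A: "hermitian A" "norm A \<le> r" and C: "hermitian C" "norm C \<le> r" for A C :: "complex^'m^'m"
  proof -
    have "norm (mexp ((1 - s) *\<^sub>R A) ** (C - A) ** mexp (s *\<^sub>R C) - mexp ((1 - s) *\<^sub>R A) ** (C - A) ** mexp (s *\<^sub>R A))
       \<le> (M * K * L * K) * (norm (C - A))\<^sup>2"
      if s: "s \<in> {0..1}" for s
    proof -
      have sr: "s * x \<le> r" if "x \<le> r" "x \<ge> 0" for x
        using s that mult_mono[of s 1 x r] by simp
      have E: "norm (mexp ((1 - s) *\<^sub>R A)) \<le> M"
        unfolding M_def using s by (intro mexp_segment_bound A C; simp)
      have "norm (mexp (s *\<^sub>R C) - mexp (s *\<^sub>R A)) \<le> L * norm (s *\<^sub>R C - s *\<^sub>R A)"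
        using s by (intro L hermitian_scaleR A C) (simp_all add: sr A C)
      also have "\<dots> = L * (s * norm (C - A))" using s by (simp add: scaleR_diff_right[symmetric])
      also have "\<dots> \<le> L * norm (C - A)" using s L(1) by (intro mult_left_mono mult_left_le_one_le) auto
      finally have F: "norm (mexp (s *\<^sub>R C) - mexp (s *\<^sub>R A)) \<le> L * norm (C - A)" .
      have "norm (mexp ((1 - s) *\<^sub>R A) ** (C - A) ** mexp (s *\<^sub>R C) - mexp ((1 - s) *\<^sub>R A) ** (C - A) ** mexp (s *\<^sub>R A))
        = norm (mexp ((1 - s) *\<^sub>R A) ** (C - A) ** (mexp (s *\<^sub>R C) - mexp (s *\<^sub>R A)))"
        by (simp add: bounded_bilinear.diff_right[OF bounded_bilinear_mm])
      also have "\<dots> \<le> norm (mexp ((1 - s) *\<^sub>R A)) * norm (C - A) * K * norm (mexp (s *\<^sub>R C) - mexp (s *\<^sub>R A)) * K"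
        by (rule order_trans[OF K(2)], intro mult_right_mono K(2)) (use K(1) in auto)
      also have "\<dots> \<le> M * norm (C - A) * K * (L * norm (C - A)) * K"
        using K(1) E F M L(1) by (intro mult_mono mult_nonneg_nonneg) auto
      finally show ?thesis by (simp add: algebra_simps power2_eq_square)
    qed
    then show ?thesis
      using has_integral_bound_real[OF _ _ has_integral_diff[OF has_integral_mexp_diff[OF A(1) C(1)]
            nc_mult_has_integral[OF A(1), of "C - A"]], of "(M * K * L * K) * (norm (C - A))\<^sup>2" "{}"] K(1) M L(1)
      by simp
  qed
  with K(1) M L(1) show thesis by (intro that[of "M * K * L * K"]) auto
qed

text \<open>Taking adjoints reverses the order of the factors, and the substitution
  \<open>s \<mapsto> 1 - s\<close> restores it.\<close>

lemma hermitian_nc_mult: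
  fixes A D :: "complex^'m^'m"
  assumes A: "hermitian A" and D: "hermitian D"
  shows "hermitian (nc_mult (mexp A) D)"
proof -
  let ?f = "\<lambda>s. mexp ((1 - s) *\<^sub>R A) ** D ** mexp (s *\<^sub>R A)"
  have ct: "bounded_linear (ctranspose :: complex^'m^'m \<Rightarrow> _)"
    using linear_ctranspose by (simp add: linear_conv_bounded_linear)
  have ce: "ctranspose (mexp (s *\<^sub>R A)) = mexp (s *\<^sub>R A)" for s
    using hermitian_mexp[OF hermitian_scaleR[OF A]] by (simp add: hermitian_def)
  have "((\<lambda>s. ctranspose (?f (- s + 1))) has_integral ctranspose (nc_mult (mexp A) D)) {0..1}"
  proof -
    have "((\<lambda>s. ?f ((-1) *\<^sub>R s + 1)) has_integral nc_mult (mexp A) D) {0..1}"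
    proof -
      have "(\<lambda>x::real. (1 / (-1)) *\<^sub>R x + - ((1 / (-1)) *\<^sub>R 1)) ` cbox 0 1 = {0..1}"
        by (auto simp: image_iff intro!: bexI[of _ "1 - _"])
      with has_integral_affinity[of ?f "nc_mult (mexp A) D" 0 1 "-1" 1] nc_mult_has_integral[OF A, of D]
      show ?thesis by simp
    qed
    from has_integral_linear[OF this ct] show ?thesis by (simp add: o_def)
  qed
  moreover have "ctranspose (?f (- s + 1)) = ?f s" for s
    using D by (simp add: ctranspose_mult ce hermitian_def matrix_mul_assoc)
  ultimately have "(?f has_integral ctranspose (nc_mult (mexp A) D)) {0..1}" by simp
  then show ?thesis
    unfolding hermitian_def using nc_mult_has_integral[OF A, of D] by (rule has_integral_unique)
qed

text \<open>In an eigenbasis of \<open>A\<close> the integrand pairs with \<open>D\<close> as half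
  the sum of \<open>exp (s * c b)\<close> times the form of \<open>exp ((1 - s) A)\<close> at
  \<open>D *v b\<close>. Either exponential is bounded below by \<open>exp (- 2 * norm A)\<close>;
  hence the \<open>4\<close>.\<close>

lemma nc_mult_positive:
  fixes A D :: "complex^'m^'m"
  assumes A: "hermitian A"
  shows "D \<bullet> nc_mult (mexp A) D \<ge> exp (- 4 * norm A) * (norm D)\<^sup>2"
proof -
  obtain B c where B: "orthonormal_basis B" "\<And>b. b \<in> B \<Longrightarrow> A *v b = c b *\<^sub>R b"
    using hermitian_eigenbasis[OF A] by blast
  let ?f = "\<lambda>s. mexp ((1 - s) *\<^sub>R A) ** D ** mexp (s *\<^sub>R A)"
  have bound: "exp (s * c b) \<ge> exp (- 2 * norm A)" if "b \<in> B" "0 \<le> s" "s \<le> 1" for s b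
  proof -
    have "\<bar>s * c b\<bar> \<le> 2 * norm A"
      using eigenvalue_bound[OF B that(1)] that mult_mono[of s 1 "\<bar>c b\<bar>" "2 * norm A"] by (simp add: abs_mult)
    then show ?thesis by simp
  qed
  have quad: "x \<bullet> (mexp (s *\<^sub>R A) *v x) \<ge> exp (- 2 * norm A) * (x \<bullet> x)" if "0 \<le> s" "s \<le> 1" for s x
  proof -
    have "x \<bullet> (mexp (s *\<^sub>R A) *v x) = (\<Sum>b\<in>B. exp (s * c b) * ((x \<bullet> b) * (x \<bullet> b)))"
      by (rule diagonal_inner[OF B(1)]) (rule mexp_scaleR_eigenvector[OF B(2)])
    also have "\<dots> \<ge> (\<Sum>b\<in>B. exp (- 2 * norm A) * ((x \<bullet> b) * (x \<bullet> b)))"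
      using bound that by (intro sum_mono mult_right_mono) auto
    finally show ?thesis
      by (simp add: sum_distrib_left[symmetric] orthonormal_basis_inner[OF B(1)])
  qed
  have key: "exp (- 4 * norm A) * (norm D)\<^sup>2 \<le> D \<bullet> ?f s" if s: "s \<in> {0..1}" for s
  proof -
    have "2 * (exp (- 4 * norm A) * (norm D)\<^sup>2) = (\<Sum>b\<in>B. exp (- 2 * norm A) * (exp (- 2 * norm A) * ((D *v b) \<bullet> (D *v b))))"
    proof -
      have "exp (- 4 * norm A) = exp (- 2 * norm A) * exp (- 2 * norm A)" by (simp add: exp_add[symmetric])
      then show ?thesis
        by (simp add: sum_distrib_left[symmetric] inner_matrix_orthonormal_basis[OF B(1)] del: dot_square_norm)
          (simp add: dot_square_norm)
    qed
    also have "\<dots> \<le> (\<Sum>b\<in>B. exp (s * c b) * ((D *v b) \<bullet> (mexp ((1 - s) *\<^sub>R A) *v (D *v b))))"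
      using s bound quad by (intro sum_mono mult_mono) auto
    also have "\<dots> = 2 * (D \<bullet> ?f s)"
      unfolding inner_matrix_orthonormal_basis[OF B(1), symmetric]
      by (intro sum.cong refl)
        (simp add: matrix_vector_mul_assoc[symmetric] mexp_scaleR_eigenvector[OF B(2)] mv_scaleR)
    finally show ?thesis by simp
  qed
  have "((\<lambda>s. D \<bullet> ?f s) has_integral D \<bullet> nc_mult (mexp A) D) {0..1}"
    using has_integral_linear[OF nc_mult_has_integral[OF A, of D] bounded_linear_inner_right[of D]]
    by (simp add: o_def)
  moreover have "((\<lambda>s::real. exp (- 4 * norm A) * (norm D)\<^sup>2) has_integral exp (- 4 * norm A) * (norm D)\<^sup>2) {0..1}"
    using has_integral_const_real[of "exp (- 4 * norm A) * (norm D)\<^sup>2" 0 1] by simp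
  ultimately show ?thesis using key by (metis (no_types, lifting) has_integral_le)
qed

lemma continuous_on_nc_mult:
  assumes A: "continuous_on T A" "\<And>x. x \<in> T \<Longrightarrow> hermitian (A x)" and D: "continuous_on T D"
  shows "continuous_on T (\<lambda>x. nc_mult (mexp (A x)) (D x))"
proof -
  have 1: "continuous_on (T \<times> cbox 0 1) (\<lambda>z. A (fst z))" "continuous_on (T \<times> cbox 0 1) (\<lambda>z. D (fst z))"
    by (auto intro!: continuous_on_compose2[OF A(1)] continuous_on_compose2[OF D] continuous_intros)
  have "continuous_on (T \<times> cbox 0 1) (\<lambda>z. mexp ((1 - snd z) *\<^sub>R A (fst z)) ** D (fst z) ** mexp (snd z *\<^sub>R A (fst z)))"
    by (intro continuous_intros 1 hermitian_scaleR A) auto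
  then have "continuous_on T (\<lambda>x. integral (cbox 0 1) (\<lambda>s. mexp ((1 - s) *\<^sub>R A x) ** D x ** mexp (s *\<^sub>R A x)))"
    by (intro integral_continuous_on_param) (simp add: case_prod_unfold)
  then show ?thesis
    by (rule continuous_on_eq) (use nc_mult_has_integral[OF A(2)] in \<open>auto intro!: integral_unique\<close>)
qed

text \<open>In an eigenbasis of \<open>A\<close> the pairing is, up to the factor \<open>2\<close>,
  the sum of the eigenvalues of \<open>A\<close> with the strictly positive weights
  \<open>b \<bullet> (P *v b)\<close>.\<close>

lemma inner_pos_definite:
  fixes A P :: "complex^'m^'m"
  assumes A: "hermitian A" and nn: "\<And>x. 0 \<le> x \<bullet> (A *v x)" and P: "pos_definite P"
  shows "A \<bullet> P \<ge> 0" and "A \<bullet> P = 0 \<Longrightarrow> A = 0"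
proof -
  obtain B c where B: "orthonormal_basis B" "\<And>b. b \<in> B \<Longrightarrow> A *v b = c b *\<^sub>R b"
    using hermitian_eigenbasis[OF A] by blast
  have c: "c b \<ge> 0" if "b \<in> B" for b
    using nn[of b] by (simp add: B(2)[OF that] orthonormal_basis_inner_self[OF B(1) that])
  have p: "b \<bullet> (P *v b) > 0" if "b \<in> B" for b
  proof -
    have "b \<noteq> 0" using orthonormal_basis_norm1[OF B(1) that] by auto
    then show ?thesis using P by (simp add: pos_definite_def)
  qed
  have eq: "2 * (A \<bullet> P) = (\<Sum>b\<in>B. c b * (b \<bullet> (P *v b)))"
    unfolding inner_matrix_orthonormal_basis[OF B(1), symmetric]
    by (intro sum.cong refl) (simp add: B(2))
  have cp: "0 \<le> c b * (b \<bullet> (P *v b))" if "b \<in> B" for b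
    using c[OF that] p[OF that] by simp
  have "0 \<le> 2 * (A \<bullet> P)" unfolding eq using cp by (intro sum_nonneg)
  then show "A \<bullet> P \<ge> 0" by simp
  assume "A \<bullet> P = 0"
  then have "(\<Sum>b\<in>B. c b * (b \<bullet> (P *v b))) = 0" using eq by simp
  then have "\<forall>b\<in>B. c b * (b \<bullet> (P *v b)) = 0"
    by (subst (asm) sum_nonneg_eq_0_iff)
      (use cp orthonormal_basis_finite[OF B(1)] in auto)
  then have "c b = 0" if "b \<in> B" for b using that p[OF that] by auto
  then show "A = 0" by (intro matrix_eqI_basis[OF B(1)]) (simp add: B(2))
qed

lemma trace_nonneg_pos_definite: "pos_definite P \<Longrightarrow> mat 1 \<bullet> P \<ge> 0"
  by (rule inner_pos_definite(1)[OF hermitian_mat_1]) simp_all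

text \<open>On eigenvalues this is \<open>a exp (- a) \<le> 1 - exp (- a)\<close>.\<close>

lemma inner_mexp_minus_le:
  fixes A :: "complex^'m^'m"
  assumes A: "hermitian A"
  shows "A \<bullet> mexp (- A) \<le> CARD('m) - mat 1 \<bullet> mexp (- A)"
proof -
  obtain B c where B: "orthonormal_basis B" "\<And>b. b \<in> B \<Longrightarrow> A *v b = c b *\<^sub>R b"
    using hermitian_eigenbasis[OF A] by blast
  have e: "mexp (- A) *v b = exp (- c b) *\<^sub>R b" if "b \<in> B" for b
    using mexp_scaleR_eigenvector[OF B(2)[OF that], of "-1"] by simp
  have "2 * (A \<bullet> mexp (- A)) = (\<Sum>b\<in>B. c b * exp (- c b))"
    unfolding inner_matrix_orthonormal_basis[OF B(1), symmetric]
    by (intro sum.cong refl) (simp add: B(2) e orthonormal_basis_inner_self[OF B(1)])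
  also have "\<dots> \<le> (\<Sum>b\<in>B. 1 - exp (- c b))"
  proof (intro sum_mono)
    fix b
    have "(1 + c b) * exp (- c b) \<le> exp (c b) * exp (- c b)"
      using exp_ge_add_one_self[of "c b"] by (intro mult_right_mono) auto
    then show "c b * exp (- c b) \<le> 1 - exp (- c b)" by (simp add: exp_minus algebra_simps)
  qed
  also have "\<dots> = 2 * (CARD('m) - mat 1 \<bullet> mexp (- A))"
  proof -
    have "2 * (mat 1 \<bullet> mexp (- A)) = (\<Sum>b\<in>B. exp (- c b))"
      unfolding inner_matrix_orthonormal_basis[OF B(1), symmetric]
      by (intro sum.cong refl) (simp add: e orthonormal_basis_inner_self[OF B(1)])
    moreover have "card B = 2 * CARD('m)" using orthonormal_basis_card[OF B(1)] by simp
    ultimately show ?thesis by (simp add: sum_subtractf)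
  qed
  finally show ?thesis by simp
qed

text \<open>The number \<open>x \<bullet> (A *v x)\<close> is a weighted mean of the eigenvalues, so
  some eigenvalue is at least as large, and its exponential is one summand of the doubled
  trace.\<close>

lemma trace_mexp_ge:
  fixes A :: "complex^'m^'m"
  assumes A: "hermitian A" and x: "norm x = 1"
  shows "2 * (mat 1 \<bullet> mexp A) \<ge> exp (x \<bullet> (A *v x))"
proof -
  obtain B c where B: "orthonormal_basis B" "\<And>b. b \<in> B \<Longrightarrow> A *v b = c b *\<^sub>R b"
    using hermitian_eigenbasis[OF A] by blast
  have w: "(\<Sum>b\<in>B. (x \<bullet> b) * (x \<bullet> b)) = 1"
    using orthonormal_basis_inner[OF B(1), of x x] x by (simp add: norm_eq_1)
  have "\<exists>b\<in>B. x \<bullet> (A *v x) \<le> c b"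
  proof (rule ccontr)
    assume "\<not> ?thesis"
    then have lt: "c b < x \<bullet> (A *v x)" if "b \<in> B" for b using that by auto
    obtain b where b: "b \<in> B" "(x \<bullet> b) * (x \<bullet> b) \<noteq> 0"
      using w by (metis (no_types, lifting) sum.neutral zero_neq_one)
    then have b': "0 < (x \<bullet> b) * (x \<bullet> b)" by (metis mult_zero_left not_real_square_gt_zero)
    have "x \<bullet> (A *v x) = (\<Sum>b\<in>B. c b * ((x \<bullet> b) * (x \<bullet> b)))" by (rule diagonal_inner[OF B])
    also have "\<dots> < (\<Sum>b\<in>B. (x \<bullet> (A *v x)) * ((x \<bullet> b) * (x \<bullet> b)))"
    proof (rule sum_strict_mono_ex1[OF orthonormal_basis_finite[OF B(1)]])
      show "\<forall>b\<in>B. c b * ((x \<bullet> b) * (x \<bullet> b)) \<le> (x \<bullet> (A *v x)) * ((x \<bullet> b) * (x \<bullet> b))"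
        using lt by (intro ballI mult_right_mono) (auto intro: less_imp_le)
      show "\<exists>b\<in>B. c b * ((x \<bullet> b) * (x \<bullet> b)) < (x \<bullet> (A *v x)) * ((x \<bullet> b) * (x \<bullet> b))"
        using b b' lt by (intro bexI[of _ b] mult_strict_right_mono) auto
    qed
    also have "\<dots> = x \<bullet> (A *v x)" by (simp only: sum_distrib_left[symmetric] w mult_1_right)
    finally show False by simp
  qed
  then obtain b where b: "b \<in> B" "x \<bullet> (A *v x) \<le> c b" by blast
  then have "exp (x \<bullet> (A *v x)) \<le> exp (c b)" by simp
  also have "\<dots> \<le> (\<Sum>b\<in>B. exp (c b))"
    by (rule member_le_sum[OF b(1)]) (use orthonormal_basis_finite[OF B(1)] in auto)
  also have "\<dots> = 2 * (mat 1 \<bullet> mexp A)"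
    unfolding inner_matrix_orthonormal_basis[OF B(1), symmetric]
    by (intro sum.cong refl) (simp add: mexp_eigenvector[OF B(2)] orthonormal_basis_inner_self[OF B(1)])
  finally show ?thesis .
qed

text \<open>On eigenvalues this is \<open>\<bar>c exp c\<bar> \<le> 1 + (exp c)^2\<close>. It
  dominates the entropy integrand of a square-integrable density by an integrable function.\<close>

lemma inner_mexp_abs_le:
  fixes X :: "complex^'m^'m"
  assumes X: "hermitian X"
  shows "\<bar>mexp X \<bullet> X\<bar> \<le> CARD('m) + (norm (mexp X))\<^sup>2"
proof -
  obtain B c where B: "orthonormal_basis B" "\<And>b. b \<in> B \<Longrightarrow> X *v b = c b *\<^sub>R b"
    using hermitian_eigenbasis[OF X] by blast
  have "2 * \<bar>mexp X \<bullet> X\<bar> = \<bar>\<Sum>b\<in>B. exp (c b) * c b\<bar>"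
  proof -
    have "2 * (mexp X \<bullet> X) = (\<Sum>b\<in>B. exp (c b) * c b)"
      unfolding inner_matrix_orthonormal_basis[OF B(1), symmetric]
      by (intro sum.cong refl) (simp add: mexp_eigenvector[OF B(2)] B(2) orthonormal_basis_inner_self[OF B(1)])
    then show ?thesis by (simp add: abs_mult flip: abs_mult)
  qed
  also have "\<dots> \<le> (\<Sum>b\<in>B. 1 + (exp (c b))\<^sup>2)"
  proof (rule order_trans[OF sum_abs], rule sum_mono)
    fix b
    have "c b \<le> exp (c b)" "- c b \<le> exp (- c b)"
      using exp_ge_add_one_self[of "c b"] exp_ge_add_one_self[of "- c b"] by linarith+
    note le = this
    have "c b * exp (c b) \<le> exp (c b) * exp (c b)"
      using le by (intro mult_right_mono) auto
    moreover have "- c b * exp (c b) \<le> 1"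
    proof -
      have "- c b * exp (c b) \<le> exp (- c b) * exp (c b)"
        using le by (intro mult_right_mono) auto
      then show ?thesis by (simp add: exp_add[symmetric])
    qed
    moreover have "0 \<le> (exp (c b))\<^sup>2" by simp
    ultimately show "\<bar>exp (c b) * c b\<bar> \<le> 1 + (exp (c b))\<^sup>2"
      unfolding abs_le_iff mult.commute[of "exp (c b)" "c b"] power2_eq_square by linarith
  qed
  also have "\<dots> = 2 * (CARD('m) + (norm (mexp X))\<^sup>2)"
  proof -
    have "2 * (norm (mexp X))\<^sup>2 = (\<Sum>b\<in>B. (exp (c b))\<^sup>2)"
      unfolding dot_square_norm[symmetric] inner_matrix_orthonormal_basis[OF B(1), symmetric]
      by (intro sum.cong refl) (simp add: mexp_eigenvector[OF B(2)] orthonormal_basis_inner_self[OF B(1)] power2_eq_square)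
    moreover have "card B = 2 * CARD('m)" using orthonormal_basis_card[OF B(1)] by simp
    ultimately show ?thesis by (simp add: sum.distrib)
  qed
  finally show ?thesis by simp
qed

section \<open>Maps with negative definite derivative\<close>

text \<open>\<open>k\<close> is extended from \<open>V\<close> to the local diffeomorphism \<open>x \<mapsto> x - P x - k (P x)\<close> of the whole
  space, where \<open>P\<close> is the orthogonal projection onto \<open>V\<close>, so that the library's inverse function
  theorem and invariance of domain apply.\<close>

locale negative_definite_derivative =
  fixes V :: "'a::euclidean_space set" and k :: "'a \<Rightarrow> 'a" and k' :: "'a \<Rightarrow> 'a \<Rightarrow> 'a"
  assumes subspace_V: "subspace V"
    and k_in: "x \<in> V \<Longrightarrow> k x \<in> V"
    and k'_in: "x \<in> V \<Longrightarrow> h \<in> V \<Longrightarrow> k' x h \<in> V"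
    and has_derivative_k: "x \<in> V \<Longrightarrow> (k has_derivative k' x) (at x)"
    and negative: "x \<in> V \<Longrightarrow> h \<in> V \<Longrightarrow> h \<noteq> 0 \<Longrightarrow> h \<bullet> k' x h < 0"
begin

lemma linear_k': "x \<in> V \<Longrightarrow> linear (k' x)"
  using has_derivative_k has_derivative_linear by blast

lemma continuous_on_k: "continuous_on V k"
  using has_derivative_continuous[OF has_derivative_k] by (intro continuous_at_imp_continuous_on ballI)

text \<open>\<open>F\<close> continues \<open>- k\<close>, not \<open>k\<close>, so that its
  derivative is positive definite; this is why the inverse derivative is evaluated at
  \<open>- h\<close>. That \<open>F x \<in> V\<close> forces \<open>x \<in> V\<close> is what brings
  statements about the range of \<open>F\<close> back to \<open>V\<close>.\<close>

lemma inverse_extension: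
  obtains F G g' where "inj F" "open (range F)" "\<And>x. x \<in> V \<Longrightarrow> F x = - k x"
    "\<And>x. F x \<in> V \<Longrightarrow> x \<in> V" "\<And>x. G (F x) = x"
    "\<And>x. (G has_derivative g' x) (at (F x))"
    "\<And>x h. x \<in> V \<Longrightarrow> h \<in> V \<Longrightarrow> g' x (- h) \<in> V \<and> k' x (g' x (- h)) = h"
proof -
  obtain B where B: "B \<subseteq> V" "pairwise orthogonal B" "\<And>b. b \<in> B \<Longrightarrow> norm b = 1"
    "independent B" "span B = V"
    using orthonormal_basis_subspace[OF subspace_V] by metis
  have fB: "finite B" using B(4) independent_imp_finite by blast
  define P where "P x = (\<Sum>b\<in>B. (x \<bullet> b) *\<^sub>R b)" for x
  have linP: "linear P"
    by (rule linearI) (simp_all add: P_def inner_add_left scaleR_left_distrib sum.distrib scaleR_sum_right)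
  have PV: "P x \<in> V" for x
    unfolding P_def using B(1) by (intro subspace_sum[OF subspace_V] subspace_scale[OF subspace_V]) auto
  have Pid: "P x = x" if "x \<in> V" for x
    unfolding P_def by (rule orthonormal_basis_expand) (use B fB that in auto)
  have Psym: "P x \<bullet> y = x \<bullet> P y" for x y
    by (simp add: P_def inner_sum_left inner_sum_right mult.commute inner_commute)
  define F where "F x = x - P x - k (P x)" for x
  define F' where "F' x h = h - P h - k' (P x) (P h)" for x h
  have dP: "(P has_derivative P) (at x)" for x
    using linP by (simp add: linear_imp_has_derivative)
  have dF: "(F has_derivative F' x) (at x)" for x
    unfolding F_def F'_def
    by (intro derivative_intros dP has_derivative_compose[OF dP has_derivative_k[OF PV]])
  \<comment> \<open>The form splits into \<open>(norm (h - P h))^2\<close> and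
    \<open>- (P h \<bullet> k' (P x) (P h))\<close>, both nonnegative and not both zero. Positivity
    makes \<open>F\<close> injective along segments and each \<open>F' x\<close> invertible.\<close>
  have pos: "h \<bullet> F' x h > 0" if "h \<noteq> 0" for x h
  proof -
    have 1: "h \<bullet> k' (P x) (P h) = P h \<bullet> k' (P x) (P h)"
      using Psym[of h "k' (P x) (P h)"] Pid[OF k'_in[OF PV PV]] by simp
    have 2: "h \<bullet> (h - P h) = (norm (h - P h))\<^sup>2"
      using Psym[of h h] Psym[of h "P h"] Pid[OF PV, of h]
      by (simp add: dot_square_norm[symmetric] inner_diff_right inner_diff_left inner_commute)
    show ?thesis
    proof (cases "P h = 0")
      case True
      then show ?thesis
        using that linear_0[OF linear_k'[OF PV]] by (simp add: F'_def)
    next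
      case False
      from negative[OF PV PV False, of x] show ?thesis
        unfolding F'_def inner_diff_right[of h "h - P h"] 1 2
        using zero_le_power2[of "norm (h - P h)"] by linarith
    qed
  qed
  note F = F_def and F' = F'_def and P = linP PV Pid
  have linF': "linear (F' x)" for x using dF has_derivative_linear by blast
  have inj: "inj F"
  proof (rule injI, rule ccontr)
    fix x y assume eq: "F x = F y" and "x \<noteq> y"
    define h where "h = x - y"
    have h: "h \<noteq> 0" using \<open>x \<noteq> y\<close> by (simp add: h_def)
    have "((\<lambda>t. h \<bullet> F (y + t *\<^sub>R h)) has_real_derivative h \<bullet> F' (y + t *\<^sub>R h) h) (at t)" for t
    proof -
      have "((\<lambda>t. y + t *\<^sub>R h) has_derivative (\<lambda>s. s *\<^sub>R h)) (at t)"
        by (auto intro!: derivative_eq_intros)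
      from has_derivative_inner_right[OF has_derivative_compose[OF this dF], of h]
      show ?thesis
        by (simp add: has_field_derivative_def linear_cmul[OF linF'] mult_commute_abs)
    qed
    with pos[OF h] have "h \<bullet> F (y + 0 *\<^sub>R h) < h \<bullet> F (y + 1 *\<^sub>R h)"
      by (intro DERIV_pos_imp_increasing[of 0 1 "\<lambda>t. h \<bullet> F (y + t *\<^sub>R h)"]) (auto intro!: exI)
    then show False using eq by (simp add: h_def)
  qed
  have cont: "continuous_on UNIV F"
    using has_derivative_continuous[OF dF] by (intro continuous_at_imp_continuous_on ballI)
  have op: "open (range F)" by (rule invariance_of_domain[OF cont open_UNIV inj])
  have surj: "surj (F' x)" for x
  proof -
    have "inj (F' x)"
      unfolding linear_injective_0[OF linF'] proof (intro allI impI, rule ccontr)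
      fix h assume "F' x h = 0" "h \<noteq> 0"
      with pos[of h x] show False by simp
    qed
    then show ?thesis using linear_injective_imp_surjective[OF linF'] by blast
  qed
  define g' where "g' x = inv (F' x)" for x
  have Fg': "F' x (g' x h) = h" for x h by (simp add: g'_def surj surj_f_inv_f)
  \<comment> \<open>\<open>P x\<close> always lies in \<open>V\<close>, so only the component
    orthogonal to \<open>V\<close> matters.\<close>
  have VF: "x - P x \<in> V \<Longrightarrow> x \<in> V" for x
    using subspace_add[OF subspace_V _ P(2), of "x - P x" x] by simp
  show thesis
  proof (rule that[of F "inv F" g'])
    show "(inv F has_derivative g' x) (at (F x))" for x
      by (rule has_derivative_inverse_strong[OF open_UNIV UNIV_I cont _ dF])
        (auto simp: inj Fg')
    show "F x = - k x" if "x \<in> V" for x using that by (simp add: F P)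
    show "x \<in> V" if "F x \<in> V" for x
    proof -
      have "F x + k (P x) \<in> V" using that P k_in subspace_add[OF subspace_V] by blast
      then have "x - P x \<in> V" by (simp add: F)
      then show ?thesis by (rule VF)
    qed
    show "g' x (- h) \<in> V \<and> k' x (g' x (- h)) = h" if x: "x \<in> V" and h: "h \<in> V" for x h
    proof -
      define w where "w = g' x (- h)"
      have eq: "w - P w - k' x (P w) = - h" using Fg'[of x "- h"] P(3)[OF x] by (simp add: F' w_def)
      then have "w - P w = k' x (P w) - h" by (simp add: algebra_simps)
      also have "\<dots> \<in> V" using x h P by (intro subspace_diff[OF subspace_V] k'_in)
      finally have w: "w \<in> V" by (rule VF)
      with eq P(3)[OF w] show ?thesis unfolding w_def[symmetric] by simp
    qed
  qed (simp_all add: inj op)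
qed

lemma inj_on_k: "inj_on k V"
proof (rule inverse_extension)
  fix F :: "'a \<Rightarrow> 'a" assume F: "inj F" "\<And>x. x \<in> V \<Longrightarrow> F x = - k x"
  show ?thesis
  proof (rule inj_onI)
    fix x y assume "x \<in> V" "y \<in> V" "k x = k y"
    then have "F x = F y" using F(2) by simp
    then show "x = y" by (rule injD[OF F(1)])
  qed
qed

lemma openin_k_image: "openin (top_of_set V) (k ` V)"
proof (rule inverse_extension)
  fix F :: "'a \<Rightarrow> 'a"
  assume F: "open (range F)" "\<And>x. x \<in> V \<Longrightarrow> F x = - k x" "\<And>x. F x \<in> V \<Longrightarrow> x \<in> V"
  have "k ` V = V \<inter> uminus -` range F"
  proof
    show "k ` V \<subseteq> V \<inter> uminus -` range F" 
    proof (rule image_subsetI)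
      fix x assume "x \<in> V"
      then show "k x \<in> V \<inter> uminus -` range F" using k_in[of x] F(2)[of x] rangeI[of F x] by simp
    qed
    show "V \<inter> uminus -` range F \<subseteq> k ` V"
    proof
      fix y assume "y \<in> V \<inter> uminus -` range F"
      then obtain x where y: "y \<in> V" "- y = F x" by auto
      then have "x \<in> V" using F(3)[of x] subspace_neg[OF subspace_V, of y] by simp
      with y F(2) show "y \<in> k ` V" by (metis image_eqI minus_equation_iff)
    qed
  qed
  moreover have "open (uminus -` range F)"
    by (rule open_vimage[OF F(1)]) (intro continuous_intros)
  ultimately show ?thesis by (auto simp: openin_open)
qed

lemma bij_betw_k':
  assumes "x \<in> V" shows "bij_betw (k' x) V V"
  unfolding bij_betw_def
proof
  show "inj_on (k' x) V"
  proof (rule inj_onI, rule ccontr)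
    fix u v assume uv: "u \<in> V" "v \<in> V" "k' x u = k' x v" "u \<noteq> v"
    then have "k' x (u - v) = 0" by (simp add: linear_diff[OF linear_k'[OF assms]])
    with negative[OF assms subspace_diff[OF subspace_V uv(1,2)]] uv(4) show False by simp
  qed
  show "k' x ` V = V"
  proof
    show "k' x ` V \<subseteq> V" using k'_in[OF assms] by blast
    show "V \<subseteq> k' x ` V"
    proof (rule inverse_extension)
      fix g' assume "\<And>x h. x \<in> V \<Longrightarrow> h \<in> V \<Longrightarrow> g' x (- h) \<in> V \<and> k' x (g' x (- h)) = h"
      then have "g' x (- h) \<in> V" "h = k' x (g' x (- h))" if "h \<in> V" for h
        using assms that by auto
      then show ?thesis by blast
    qed
  qed
qed

abbreviation "k_inv \<equiv> inv_into V k"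

lemma k_inv_in: "y \<in> k ` V \<Longrightarrow> k_inv y \<in> V"
  by (rule inv_into_into)

lemma k_k_inv: "y \<in> k ` V \<Longrightarrow> k (k_inv y) = y"
  by (rule f_inv_into_f)

text \<open>\<open>k_inv\<close> is meaningful only on a subset of the subspace \<open>V\<close>, so
  the chain rule is applied to \<open>G\<close>, which is differentiable in the full space and
  agrees with \<open>k_inv\<close> along the path up to the sign of the argument.\<close>

lemma k_inv_path:
  assumes p: "\<And>s. s \<in> J \<Longrightarrow> p s \<in> k ` V" and t: "t \<in> J" and v: "v \<in> V"
    and dp: "(p has_vector_derivative v) (at t within J)"
  shows "((\<lambda>s. k_inv (p s)) has_vector_derivative inv_into V (k' (k_inv (p t))) v) (at t within J)"
proof (rule inverse_extension)
  fix F G :: "'a \<Rightarrow> 'a" and g'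
  assume F: "\<And>x. x \<in> V \<Longrightarrow> F x = - k x" and G: "\<And>x. G (F x) = x"
    and dG: "\<And>x. (G has_derivative g' x) (at (F x))"
    and g': "\<And>x h. x \<in> V \<Longrightarrow> h \<in> V \<Longrightarrow> g' x (- h) \<in> V \<and> k' x (g' x (- h)) = h"
  let ?x = "k_inv (p t)"
  have Gp: "G (- p s) = k_inv (p s)" if "s \<in> J" for s
    using F[OF k_inv_in[OF p[OF that]]] k_k_inv[OF p[OF that]] G[of "k_inv (p s)"] by simp
  have x: "?x \<in> V" using k_inv_in p t by blast
  have Fx: "F ?x = - p t" using F[OF x] k_k_inv[OF p[OF t]] by simp
  have lin: "linear (g' ?x)" using dG has_derivative_linear by blast
  have "((\<lambda>s. - p s) has_derivative (\<lambda>s. s *\<^sub>R - v)) (at t within J)"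
    using has_vector_derivative_minus[OF dp] by (simp add: has_vector_derivative_def)
  from has_derivative_compose[OF this dG[of ?x, unfolded Fx]]
  have "((\<lambda>s. G (- p s)) has_vector_derivative g' ?x (- v)) (at t within J)"
    by (simp add: has_vector_derivative_def linear_cmul[OF lin] linear_neg[OF lin])
  moreover have "g' ?x (- v) = inv_into V (k' ?x) v"
    using g'[OF x v] bij_betw_k'[OF x] by (metis bij_betw_def inv_into_f_f)
  ultimately have "((\<lambda>s. G (- p s)) has_vector_derivative inv_into V (k' ?x) v) (at t within J)" by simp
  from has_vector_derivative_transform[OF t Gp[symmetric] this] show ?thesis .
qed

text \<open>Differentiability of \<open>G\<close> at \<open>- y\<close> with error tolerance
  \<open>1\<close> gives the constant \<open>1 + K\<close>. This transfers the decay rate of the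
  moments to the parameters.\<close>

lemma k_inv_locally_lipschitz:
  assumes "y \<in> k ` V"
  shows "\<exists>C. \<exists>d>0. \<forall>z\<in>k ` V. norm (z - y) < d \<longrightarrow> norm (k_inv z - k_inv y) \<le> C * norm (z - y)"
proof (rule inverse_extension)
  fix F G :: "'a \<Rightarrow> 'a" and g'
  assume F: "\<And>x. x \<in> V \<Longrightarrow> F x = - k x" and G: "\<And>x. G (F x) = x"
    and dG: "\<And>x. (G has_derivative g' x) (at (F x))"
  let ?x = "k_inv y"
  have Gk: "G (- z) = k_inv z" if "z \<in> k ` V" for z
    using F[OF k_inv_in[OF that]] k_k_inv[OF that] G[of "k_inv z"] by simp
  have Fx: "F ?x = - y" using F[OF k_inv_in[OF assms]] k_k_inv[OF assms] by simp
  have dG': "(G has_derivative g' ?x) (at (- y))" using dG[of ?x] Fx by simp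
  obtain K where K: "\<And>h. norm (g' ?x h) \<le> norm h * K"
    using bounded_linear.bounded[OF has_derivative_bounded_linear[OF dG']] by blast
  obtain d where d: "d > 0" "\<And>z. norm (z - (- y)) < d \<Longrightarrow> norm (G z - G (- y) - g' ?x (z - (- y))) \<le> 1 * norm (z - (- y))"
    using dG'[unfolded has_derivative_at_alt, THEN conjunct2, rule_format, OF zero_less_one] by blast
  show ?thesis
  proof (rule exI[of _ "1 + K"], rule exI[of _ d], intro conjI ballI impI)
    show "d > 0" by (rule d(1))
    fix z assume z: "z \<in> k ` V" "norm (z - y) < d"
    have "norm (G (- z) - G (- y) - g' ?x (- z - (- y))) \<le> norm (z - y)"
      using d(2)[of "- z"] z(2) by (simp add: norm_minus_commute)
    moreover have "norm (g' ?x (- z - (- y))) \<le> K * norm (z - y)"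
      using K[of "- z - (- y)"] by (simp add: norm_minus_commute mult.commute)
    ultimately have "norm (G (- z) - G (- y)) \<le> (1 + K) * norm (z - y)"
      using norm_triangle_sub[of "G (- z) - G (- y)" "g' ?x (- z - (- y))"] by (simp add: algebra_simps)
    then show "norm (k_inv z - k_inv y) \<le> (1 + K) * norm (z - y)"
      using Gk[OF z(1)] Gk[OF assms] by simp
  qed
qed

end

section \<open>The moment problem\<close>

lemma nc_mult_add:
  assumes "hermitian A"
  shows "nc_mult (mexp A) (C + D) = nc_mult (mexp A) C + nc_mult (mexp A) D"
  using has_integral_add[OF nc_mult_has_integral[OF assms, of C] nc_mult_has_integral[OF assms, of D]]
  by (intro has_integral_unique[OF nc_mult_has_integral[OF assms]])
    (simp add: bounded_bilinear.add_left[OF bounded_bilinear_mm] bounded_bilinear.add_right[OF bounded_bilinear_mm])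

lemma nc_mult_scaleR:
  assumes "hermitian A"
  shows "nc_mult (mexp A) (r *\<^sub>R D) = r *\<^sub>R nc_mult (mexp A) D"
  using has_integral_cmul[OF nc_mult_has_integral[OF assms, of D], of r]
  by (intro has_integral_unique[OF nc_mult_has_integral[OF assms]])
    (simp add: bounded_bilinear.scaleR_left[OF bounded_bilinear_mm] bounded_bilinear.scaleR_right[OF bounded_bilinear_mm])

lemma hermitian_herm_part: "hermitian (herm_part A)"
  by (simp add: hermitian_def herm_part_def ctranspose_def vec_eq_iff add.commute)

lemma linear_herm_part: "linear herm_part"
  unfolding herm_part_def
  by (rule linearI) (simp_all add: linear_add[OF linear_ctranspose] linear_cmul[OF linear_ctranspose] algebra_simps)

lemma inner_herm_part:
  assumes "hermitian P" shows "herm_part A \<bullet> P = A \<bullet> P"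
proof -
  have "ctranspose A \<bullet> P = A \<bullet> P"
    using inner_ctranspose[of A P] assms by (simp add: hermitian_def)
  then show ?thesis by (simp add: herm_part_def inner_add_left)
qed

lemma hermitian_moment_adj: "hermitian (moment_adj Gl Gr x \<theta>)"
  by (simp add: moment_adj_def hermitian_herm_part)

lemma linear_moment_adj: "linear (\<lambda>x. moment_adj Gl Gr x \<theta>)"
proof -
  have "linear (\<lambda>x. ctranspose (Gl \<theta>) ** x ** ctranspose (Gr \<theta>))"
    by (rule linearI) (simp_all add: bounded_bilinear.add_left[OF bounded_bilinear_mm] bounded_bilinear.add_right[OF bounded_bilinear_mm]
      bounded_bilinear.scaleR_left[OF bounded_bilinear_mm] bounded_bilinear.scaleR_right[OF bounded_bilinear_mm])
  from linear_compose[OF this linear_herm_part] show ?thesis by (simp add: moment_adj_def o_def)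
qed

lemmas moment_adj_add = linear_add[OF linear_moment_adj]
  and moment_adj_diff = linear_diff[OF linear_moment_adj]
  and moment_adj_scaleR = linear_cmul[OF linear_moment_adj]

text \<open>The adjoint relation before integration. The part removed by \<open>herm_part\<close> is
  orthogonal to the Hermitian \<open>P\<close>.\<close>

lemma inner_moment_adj:
  assumes "hermitian P" shows "moment_adj Gl Gr x \<theta> \<bullet> P = x \<bullet> (Gl \<theta> ** P ** Gr \<theta>)"
  unfolding moment_adj_def inner_herm_part[OF assms] inner_mm_right[of x "Gl \<theta> ** P" "Gr \<theta>"]
    inner_mm_left[of "x ** ctranspose (Gr \<theta>)"] matrix_mul_assoc ..

lemma norm_add_power2_le: "(norm (x + y :: 'a::real_normed_vector))\<^sup>2 \<le> 2 * (norm x)\<^sup>2 + 2 * (norm y)\<^sup>2"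
proof -
  have "(norm (x + y))\<^sup>2 \<le> (norm x + norm y)\<^sup>2"
    by (intro power_mono norm_triangle_ineq) simp
  also have "\<dots> \<le> 2 * (norm x)\<^sup>2 + 2 * (norm y)\<^sup>2"
    using zero_le_power2[of "norm x - norm y"] by (simp add: power2_eq_square algebra_simps)
  finally show ?thesis .
qed

locale moment_problem =
  fixes a b :: "'s::euclidean_space" and S :: "'s set"
    and Gl :: "'s \<Rightarrow> complex^'m^'nl" and Gr :: "'s \<Rightarrow> complex^'nr^'m"
  assumes S: "S = cbox a b" and int_S: "interior S \<noteq> {}"
    and Gl: "continuous_on S Gl" and Gr: "continuous_on S Gr"
begin

abbreviation "L \<equiv> moment_map S Gl Gr"
abbreviation "L_adj \<equiv> moment_adj Gl Gr"
abbreviation "V \<equiv> moment_range S Gl Gr"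
abbreviation "M \<equiv> lebesgue_on S"

lemma S_lebesgue: "S \<in> sets lebesgue" and compact_S: "compact S"
  by (simp_all add: S)

lemma finite_measure_M: "finite_measure M"
  using compact_S by (intro finite_measure_lebesgue_on) (simp add: S)

lemma integrable_const_M: "integrable M (\<lambda>_. c :: 'b::euclidean_space)"
  using finite_measure.integrable_const[OF finite_measure_M] .

lemma integrable_continuous_M:
  "continuous_on S f \<Longrightarrow> integrable M (f :: 's \<Rightarrow> 'b::euclidean_space)"
  unfolding S by (rule continuous_imp_integrable)

lemma measurable_continuous_M: "continuous_on S f \<Longrightarrow> f \<in> borel_measurable M"
  by (rule continuous_imp_measurable_on_sets_lebesgue[OF _ S_lebesgue])

lemma norm_integral_le:
  fixes f :: "'s \<Rightarrow> 'b::euclidean_space"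
  assumes f: "integrable M f" and c: "\<And>\<theta>. \<theta> \<in> S \<Longrightarrow> norm (f \<theta>) \<le> c"
  shows "norm (integral\<^sup>L M f) \<le> c * measure lebesgue S"
proof -
  have "norm (integral\<^sup>L M f) \<le> (LINT \<theta>|M. norm (f \<theta>))" by (rule integral_norm_bound)
  also have "\<dots> \<le> (LINT \<theta>|M. c)"
    by (rule integral_mono) (use f c integrable_const_M in auto)
  also have "\<dots> = c * measure lebesgue S"
    by (simp add: measure_restrict_space S_lebesgue mult.commute)
  finally show ?thesis .
qed

text \<open>The nonempty interior of \<open>S\<close> enters here: over a degenerate box every
  integral vanishes.\<close>

lemma continuous_nonneg_integral_0:
  fixes f :: "'s \<Rightarrow> real"
  assumes f: "continuous_on S f" and nn: "\<And>\<theta>. \<theta> \<in> S \<Longrightarrow> 0 \<le> f \<theta>"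
    and int: "integral\<^sup>L M f = 0" and th: "\<theta> \<in> S"
  shows "f \<theta> = 0"
proof -
  have "integral S f = 0"
    using lebesgue_integral_eq_integral[OF integrable_continuous_M[OF f] S_lebesgue] int by simp
  then show ?thesis
    using integral_cbox_eq_0_iff[of a b f] f nn th int_S unfolding S interior_cbox by blast
qed

lemma continuous_AE_0:
  fixes f :: "'s \<Rightarrow> 'b::euclidean_space"
  assumes f: "continuous_on S f" and ae: "AE \<theta> in M. f \<theta> = 0" and th: "\<theta> \<in> S"
  shows "f \<theta> = 0"
proof -
  have "integral\<^sup>L M (\<lambda>\<theta>. norm (f \<theta>)) = 0"
    using ae by (intro integral_eq_zero_AE) (auto elim: eventually_mono)
  with continuous_nonneg_integral_0[of "\<lambda>\<theta>. norm (f \<theta>)" \<theta>] f th show ?thesis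
    by (simp add: continuous_on_norm)
qed

section \<open>The moment map on square-integrable Hermitian functions, and its adjoint\<close>

lemma herm_L2_continuous:
  assumes "continuous_on S \<rho>" "\<And>\<theta>. \<theta> \<in> S \<Longrightarrow> hermitian (\<rho> \<theta>)" shows "\<rho> \<in> herm_L2 S"
  using assms unfolding herm_L2_def
  by (auto intro!: measurable_continuous_M integrable_continuous_M continuous_intros)

lemma herm_L2_add:
  assumes "\<rho> \<in> herm_L2 S" "\<sigma> \<in> herm_L2 S" shows "(\<lambda>\<theta>. \<rho> \<theta> + \<sigma> \<theta>) \<in> herm_L2 S"
proof -
  have [measurable]: "\<rho> \<in> borel_measurable M" "\<sigma> \<in> borel_measurable M"
    and i: "integrable M (\<lambda>\<theta>. 2 * (norm (\<rho> \<theta>))\<^sup>2 + 2 * (norm (\<sigma> \<theta>))\<^sup>2)"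
    and h: "\<And>\<theta>. \<theta> \<in> S \<Longrightarrow> hermitian (\<rho> \<theta> + \<sigma> \<theta>)"
    using assms by (auto simp: herm_L2_def hermitian_add)
  have "integrable M (\<lambda>\<theta>. (norm (\<rho> \<theta> + \<sigma> \<theta>))\<^sup>2)"
    by (rule Bochner_Integration.integrable_bound[OF i]) (auto simp: norm_add_power2_le)
  with h show ?thesis by (auto simp: herm_L2_def)
qed

lemma herm_L2_scaleR: "\<rho> \<in> herm_L2 S \<Longrightarrow> (\<lambda>\<theta>. r *\<^sub>R \<rho> \<theta>) \<in> herm_L2 S"
  by (auto simp: herm_L2_def hermitian_scaleR power_mult_distrib)

lemma integrable_herm_L2:
  assumes "\<rho> \<in> herm_L2 S" shows "integrable M \<rho>"
proof -
  have [measurable]: "\<rho> \<in> borel_measurable M" and i: "integrable M (\<lambda>\<theta>. 1 + (norm (\<rho> \<theta>))\<^sup>2)"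
    using assms integrable_const_M[of "1::real"] by (auto simp: herm_L2_def)
  have "x \<le> 1 + x\<^sup>2" for x :: real
    using zero_le_power2[of "x - 1/2"] by (simp add: power2_eq_square algebra_simps)
  then show ?thesis
    by (intro Bochner_Integration.integrable_bound[OF i]) auto
qed

lemma moment_integrand_bound:
  obtains C where "C > 0" "\<And>\<theta> P. \<theta> \<in> S \<Longrightarrow> norm (Gl \<theta> ** P ** Gr \<theta>) \<le> C * norm P"
proof -
  obtain K1 where K1: "K1 > 0" "\<And>(X :: complex^'m^'nl) (Y :: complex^'m^'m). norm (X ** Y) \<le> norm X * norm Y * K1"
    using bounded_bilinear.pos_bounded[OF bounded_bilinear_mm] by blast
  obtain K2 where K2: "K2 > 0" "\<And>(X :: complex^'m^'nl) (Y :: complex^'nr^'m). norm (X ** Y) \<le> norm X * norm Y * K2"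
    using bounded_bilinear.pos_bounded[OF bounded_bilinear_mm] by blast
  obtain B1 where B1: "B1 > 0" "\<And>\<theta>. \<theta> \<in> S \<Longrightarrow> norm (Gl \<theta>) \<le> B1"
    using compact_imp_bounded[OF compact_continuous_image[OF Gl compact_S]] by (auto simp: bounded_pos)
  obtain B2 where B2: "B2 > 0" "\<And>\<theta>. \<theta> \<in> S \<Longrightarrow> norm (Gr \<theta>) \<le> B2"
    using compact_imp_bounded[OF compact_continuous_image[OF Gr compact_S]] by (auto simp: bounded_pos)
  show thesis
  proof (rule that[of "B1 * K1 * B2 * K2"])
    fix \<theta> and P :: "complex^'m^'m" assume th: "\<theta> \<in> S"
    have "norm (Gl \<theta> ** P ** Gr \<theta>) \<le> norm (Gl \<theta> ** P) * norm (Gr \<theta>) * K2" by (rule K2)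
    also have "\<dots> \<le> (norm (Gl \<theta>) * norm P * K1) * norm (Gr \<theta>) * K2"
      using K2(1) K1(2) by (intro mult_right_mono) auto
    also have "\<dots> \<le> (B1 * norm P * K1) * B2 * K2"
      using B1 B2 K1(1) K2(1) th by (intro mult_mono mult_nonneg_nonneg) (auto intro: less_imp_le)
    finally show "norm (Gl \<theta> ** P ** Gr \<theta>) \<le> B1 * K1 * B2 * K2 * norm P" by (simp add: algebra_simps)
  qed (use B1 B2 K1 K2 in simp)
qed

lemma integrable_moment:
  assumes "\<rho> \<in> herm_L2 S" shows "integrable M (\<lambda>\<theta>. Gl \<theta> ** \<rho> \<theta> ** Gr \<theta>)"
proof -
  obtain C where C: "C > 0" "\<And>\<theta> P. \<theta> \<in> S \<Longrightarrow> norm (Gl \<theta> ** P ** Gr \<theta>) \<le> C * norm P"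
    using moment_integrand_bound by blast
  have [measurable]: "\<rho> \<in> borel_measurable M" "Gl \<in> borel_measurable M" "Gr \<in> borel_measurable M"
    using assms Gl Gr by (auto simp: herm_L2_def measurable_continuous_M)
  have "continuous_on UNIV (\<lambda>(A :: complex^'m^'nl, P :: complex^'m^'m, B :: complex^'nr^'m). A ** P ** B)"
    unfolding case_prod_unfold by (intro continuous_intros)
  from borel_measurable_continuous_on[OF this, of "\<lambda>\<theta>. (Gl \<theta>, \<rho> \<theta>, Gr \<theta>)" M]
  have [measurable]: "(\<lambda>\<theta>. Gl \<theta> ** \<rho> \<theta> ** Gr \<theta>) \<in> borel_measurable M" by simp
  have i: "integrable M (\<lambda>\<theta>. C * norm (\<rho> \<theta>))" using integrable_herm_L2[OF assms] by simp
  show ?thesis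
    by (rule Bochner_Integration.integrable_bound[OF i]) (use C in \<open>auto simp: abs_of_pos\<close>)
qed

lemma L_add: "\<rho> \<in> herm_L2 S \<Longrightarrow> \<sigma> \<in> herm_L2 S \<Longrightarrow> L (\<lambda>\<theta>. \<rho> \<theta> + \<sigma> \<theta>) = L \<rho> + L \<sigma>"
  unfolding moment_map_def
  by (subst Bochner_Integration.integral_add[symmetric])
    (auto simp: integrable_moment bounded_bilinear.add_left[OF bounded_bilinear_mm] bounded_bilinear.add_right[OF bounded_bilinear_mm])

lemma L_scaleR: "L (\<lambda>\<theta>. r *\<^sub>R \<rho> \<theta>) = r *\<^sub>R L \<rho>"
  by (simp add: moment_map_def bounded_bilinear.scaleR_left[OF bounded_bilinear_mm] bounded_bilinear.scaleR_right[OF bounded_bilinear_mm])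

lemma integrable_inner_moment_adj:
  assumes "\<rho> \<in> herm_L2 S"
  shows "integrable M (\<lambda>\<theta>. L_adj x \<theta> \<bullet> \<rho> \<theta>)" and "x \<bullet> L \<rho> = (LINT \<theta>|M. L_adj x \<theta> \<bullet> \<rho> \<theta>)"
proof -
  have eq: "L_adj x \<theta> \<bullet> \<rho> \<theta> = x \<bullet> (Gl \<theta> ** \<rho> \<theta> ** Gr \<theta>)" if "\<theta> \<in> S" for \<theta>
    using assms that by (intro inner_moment_adj) (simp add: herm_L2_def)
  have "integrable M (\<lambda>\<theta>. x \<bullet> (Gl \<theta> ** \<rho> \<theta> ** Gr \<theta>))"
    using integrable_moment[OF assms] by simp
  then show "integrable M (\<lambda>\<theta>. L_adj x \<theta> \<bullet> \<rho> \<theta>)"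
    by (rule Bochner_Integration.integrable_cong[THEN iffD1, rotated -1]) (simp_all add: eq)
  have "x \<bullet> L \<rho> = (LINT \<theta>|M. x \<bullet> (Gl \<theta> ** \<rho> \<theta> ** Gr \<theta>))"
    unfolding moment_map_def using integrable_moment[OF assms] by simp
  also have "\<dots> = (LINT \<theta>|M. L_adj x \<theta> \<bullet> \<rho> \<theta>)"
    by (rule Bochner_Integration.integral_cong) (simp_all add: eq)
  finally show "x \<bullet> L \<rho> = (LINT \<theta>|M. L_adj x \<theta> \<bullet> \<rho> \<theta>)" .
qed

lemma continuous_on_ctranspose [continuous_intros]:
  "continuous_on T f \<Longrightarrow> continuous_on T (\<lambda>x. ctranspose (f x :: complex^'q^'p))"
  by (rule bounded_linear.continuous_on[OF linear_ctranspose[unfolded linear_conv_bounded_linear]])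

lemma continuous_on_L_adj [continuous_intros]: "continuous_on S (L_adj x)"
  unfolding moment_adj_def[abs_def] herm_part_def by (intro continuous_intros Gl Gr)

text \<open>A bound for the moment integrand is also one for its adjoint: pair
  \<open>L_adj x \<theta>\<close> with itself, move one copy to the other side, and cancel a factor
  of its norm.\<close>

lemma L_adj_bound:
  obtains C where "C > 0" "\<And>\<theta> x. \<theta> \<in> S \<Longrightarrow> norm (L_adj x \<theta>) \<le> C * norm x"
proof -
  obtain C where C: "C > 0" "\<And>\<theta> P. \<theta> \<in> S \<Longrightarrow> norm (Gl \<theta> ** P ** Gr \<theta>) \<le> C * norm P"
    using moment_integrand_bound by blast
  have "norm (L_adj x \<theta>) \<le> C * norm x" if th: "\<theta> \<in> S" for \<theta> x
  proof (cases "L_adj x \<theta> = 0")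
    case False
    have "(norm (L_adj x \<theta>))\<^sup>2 = x \<bullet> (Gl \<theta> ** L_adj x \<theta> ** Gr \<theta>)"
      using inner_moment_adj[OF hermitian_moment_adj[of Gl Gr x \<theta>], of Gl Gr x \<theta>] by (simp add: dot_square_norm)
    also have "\<dots> \<le> norm x * norm (Gl \<theta> ** L_adj x \<theta> ** Gr \<theta>)" by (rule norm_cauchy_schwarz)
    also have "\<dots> \<le> norm x * (C * norm (L_adj x \<theta>))" using C(2)[OF th] by (intro mult_left_mono) auto
    finally show ?thesis using False by (simp add: power2_eq_square algebra_simps)
  qed (use C(1) in simp)
  with C(1) show thesis by (rule that)
qed

lemma V_I: "\<rho> \<in> herm_L2 S \<Longrightarrow> L \<rho> \<in> V"
  by (simp add: moment_range_def)

lemma V_E: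
  assumes "x \<in> V" obtains \<rho> where "\<rho> \<in> herm_L2 S" "x = L \<rho>"
  using assms unfolding moment_range_def by (elim imageE)

lemma subspace_V: "subspace V"
proof (rule subspaceI)
  have "(\<lambda>_. 0) \<in> herm_L2 S" by (intro herm_L2_continuous continuous_intros hermitian_0)
  then have "L (\<lambda>\<theta>. 0 *\<^sub>R 0) \<in> V" using V_I by simp
  then show "0 \<in> V" unfolding L_scaleR by simp
  fix x y assume "x \<in> V" "y \<in> V"
  then show "x + y \<in> V"
    by (elim V_E) (simp add: L_add[symmetric] V_I herm_L2_add)
next
  fix r x assume "x \<in> V"
  then show "r *\<^sub>R x \<in> V"
    by (elim V_E) (simp add: L_scaleR[symmetric] V_I herm_L2_scaleR)
qed

text \<open>The kernel of the adjoint is orthogonal to the range of \<open>L\<close>. This is why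
  parameters are taken from \<open>V\<close>: there they are determined by
  \<open>L_adj\<close>.\<close>

lemma L_adj_eq_0:
  assumes x: "x \<in> V" and 0: "\<And>\<theta>. \<theta> \<in> S \<Longrightarrow> L_adj x \<theta> = 0"
  shows "x = 0"
proof -
  obtain \<rho> where \<rho>: "\<rho> \<in> herm_L2 S" "x = L \<rho>" using x by (rule V_E)
  have "x \<bullet> x = (LINT \<theta>|M. L_adj x \<theta> \<bullet> \<rho> \<theta>)"
    using integrable_inner_moment_adj(2)[OF \<rho>(1), of x] \<rho>(2) by simp
  also have "\<dots> = 0"
    using 0 by (intro integral_eq_zero_AE) (auto intro!: AE_I2)
  finally show ?thesis by simp
qed

section \<open>The moments of the exponential family and their derivative\<close>

definition kappa where
  "kappa x = (1 / exp 1) *\<^sub>R L (\<lambda>\<theta>. mexp (- L_adj x \<theta>))"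

abbreviation "kappa' \<equiv> grad_kappa S Gl Gr"

lemma continuous_mexp_L_adj: "continuous_on S (\<lambda>\<theta>. mexp (- L_adj x \<theta>))"
  by (intro continuous_intros hermitian_minus hermitian_moment_adj)

lemma mexp_L_adj_herm_L2: "(\<lambda>\<theta>. mexp (- L_adj x \<theta>)) \<in> herm_L2 S"
  by (intro herm_L2_continuous continuous_mexp_L_adj hermitian_mexp hermitian_minus hermitian_moment_adj)

lemma continuous_nc_mult_L_adj: "continuous_on S (\<lambda>\<theta>. nc_mult (mexp (- L_adj x \<theta>)) (L_adj h \<theta>))"
  by (intro continuous_on_nc_mult continuous_intros hermitian_minus hermitian_moment_adj)

lemma nc_mult_L_adj_herm_L2: "(\<lambda>\<theta>. nc_mult (mexp (- L_adj x \<theta>)) (L_adj h \<theta>)) \<in> herm_L2 S"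
  by (intro herm_L2_continuous continuous_nc_mult_L_adj hermitian_nc_mult hermitian_minus hermitian_moment_adj)

lemma kappa_in: "kappa x \<in> V"
  unfolding kappa_def using mexp_L_adj_herm_L2
  by (intro subspace_scale[OF subspace_V]) (simp add: moment_range_def)

lemma kappa'_in: "kappa' x h \<in> V"
  unfolding grad_kappa_def using nc_mult_L_adj_herm_L2
  by (intro subspace_neg[OF subspace_V] subspace_scale[OF subspace_V]) (simp add: moment_range_def)

lemma linear_kappa': "linear (kappa' x)"
proof (rule linearI)
  show "kappa' x (h + g) = kappa' x h + kappa' x g" for h g
    unfolding grad_kappa_def moment_adj_add nc_mult_add[OF hermitian_minus[OF hermitian_moment_adj]]
    by (simp add: L_add[OF nc_mult_L_adj_herm_L2 nc_mult_L_adj_herm_L2] algebra_simps)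
  show "kappa' x (r *\<^sub>R h) = r *\<^sub>R kappa' x h" for r h
    unfolding grad_kappa_def moment_adj_scaleR nc_mult_scaleR[OF hermitian_minus[OF hermitian_moment_adj]]
    by (simp add: L_scaleR)
qed

text \<open>By adjointness the form is \<open>-1/e\<close> times the integral of
  \<open>L_adj h\<close> paired with its image under \<open>nc_mult\<close>. The integrand is
  continuous and nonnegative, so a vanishing integral makes \<open>L_adj h\<close> vanish on all of
  \<open>S\<close>, against \<open>h \<noteq> 0\<close> in \<open>V\<close>.\<close>

lemma kappa'_negative:
  assumes "h \<in> V" "h \<noteq> 0" shows "h \<bullet> kappa' x h < 0"
proof -
  let ?D = "\<lambda>\<theta>. nc_mult (mexp (- L_adj x \<theta>)) (L_adj h \<theta>)"
  let ?f = "\<lambda>\<theta>. L_adj h \<theta> \<bullet> ?D \<theta>"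
  have pos: "?f \<theta> \<ge> exp (- 4 * norm (- L_adj x \<theta>)) * (norm (L_adj h \<theta>))\<^sup>2" for \<theta>
    by (rule nc_mult_positive[OF hermitian_minus[OF hermitian_moment_adj]])
  then have nn: "?f \<theta> \<ge> 0" for \<theta> by (rule order_trans[rotated]) simp
  have cont: "continuous_on S ?f"
    by (intro continuous_intros continuous_nc_mult_L_adj)
  have "integral\<^sup>L M ?f \<noteq> 0"
  proof
    assume 0: "integral\<^sup>L M ?f = 0"
    have "L_adj h \<theta> = 0" if "\<theta> \<in> S" for \<theta>
    proof -
      have "?f \<theta> = 0" by (rule continuous_nonneg_integral_0[OF cont nn 0 that])
      with pos[of \<theta>] show ?thesis by (simp add: mult_le_0_iff)
    qed
    then show False using L_adj_eq_0[OF assms(1)] assms(2) by simp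
  qed
  moreover have "integral\<^sup>L M ?f \<ge> 0" using nn by simp
  ultimately have "integral\<^sup>L M ?f > 0" by simp
  moreover have "h \<bullet> kappa' x h = - (1 / exp 1) * integral\<^sup>L M ?f"
    unfolding grad_kappa_def
    using integrable_inner_moment_adj(2)[OF nc_mult_L_adj_herm_L2, of h x h] by simp
  ultimately show ?thesis by (simp add: divide_neg_pos)
qed


text \<open>For \<open>y\<close> within distance \<open>1\<close> of \<open>x\<close> all matrices
  \<open>L_adj y \<theta>\<close> lie in one ball of radius \<open>r\<close>, so the quadratic
  Taylor remainder is uniform in \<open>\<theta>\<close> and survives integration.\<close>

lemma has_derivative_kappa: "(kappa has_derivative kappa' x) (at x)"
  unfolding has_derivative_at_alt
proof (intro conjI allI impI)
  show "bounded_linear (kappa' x)" using linear_kappa' by (simp add: linear_conv_bounded_linear)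
  fix e :: real assume e: "e > 0"
  obtain C where C: "C > 0" "\<And>\<theta> P. \<theta> \<in> S \<Longrightarrow> norm (Gl \<theta> ** P ** Gr \<theta>) \<le> C * norm P"
    using moment_integrand_bound by blast
  obtain D where D: "D > 0" "\<And>\<theta> x. \<theta> \<in> S \<Longrightarrow> norm (L_adj x \<theta>) \<le> D * norm x"
    using L_adj_bound by blast
  define r where "r = D * (norm x + 1)"
  obtain K where K: "K > 0" "\<And>A C :: complex^'m^'m. hermitian A \<Longrightarrow> hermitian C \<Longrightarrow> norm A \<le> r \<Longrightarrow>
    norm C \<le> r \<Longrightarrow> norm (mexp C - mexp A - nc_mult (mexp A) (C - A)) \<le> K * (norm (C - A))\<^sup>2"
    using mexp_taylor[of r] by blast
  define Q where "Q = C * K * D\<^sup>2 * measure lebesgue S"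
  have Q: "Q \<ge> 0" using C(1) K(1) by (simp add: Q_def)
  have quad: "norm (kappa y - kappa x - kappa' x (y - x)) \<le> Q * (norm (y - x))\<^sup>2" if y: "norm (y - x) < 1" for y
  proof -
    let ?E = "\<lambda>\<theta>. mexp (- L_adj y \<theta>) - mexp (- L_adj x \<theta>) + nc_mult (mexp (- L_adj x \<theta>)) (L_adj (y - x) \<theta>)"
    have ny: "norm y \<le> norm x + 1" using y norm_triangle_sub[of y x] by linarith
    have bE: "norm (?E \<theta>) \<le> K * (D * norm (y - x))\<^sup>2" if th: "\<theta> \<in> S" for \<theta>
    proof -
      have "nc_mult (mexp (- L_adj x \<theta>)) (L_adj (y - x) \<theta>) =
          - nc_mult (mexp (- L_adj x \<theta>)) (- L_adj y \<theta> - (- L_adj x \<theta>))"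
        using nc_mult_scaleR[OF hermitian_minus[OF hermitian_moment_adj], of Gl Gr x \<theta> "-1"
            "- L_adj y \<theta> - (- L_adj x \<theta>)"] by (simp add: moment_adj_diff)
      then have "?E \<theta> = mexp (- L_adj y \<theta>) - mexp (- L_adj x \<theta>) - nc_mult (mexp (- L_adj x \<theta>)) (- L_adj y \<theta> - (- L_adj x \<theta>))"
        by simp
      also have "norm \<dots> \<le> K * (norm (- L_adj y \<theta> - (- L_adj x \<theta>)))\<^sup>2"
      proof (rule K(2))
        show "norm (- L_adj x \<theta>) \<le> r" "norm (- L_adj y \<theta>) \<le> r"
          unfolding norm_minus_cancel r_def using D(1) ny
          by (auto intro!: order_trans[OF D(2)[OF th]] mult_left_mono)
      qed (intro hermitian_minus hermitian_moment_adj)+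
      also have "norm (- L_adj y \<theta> - (- L_adj x \<theta>)) = norm (L_adj (y - x) \<theta>)"
        by (simp add: moment_adj_diff norm_minus_commute)
      also have "K * (norm (L_adj (y - x) \<theta>))\<^sup>2 \<le> K * (D * norm (y - x))\<^sup>2"
        using K(1) D(2)[OF th] by (intro mult_left_mono power_mono) auto
      finally show ?thesis .
    qed
    have EL2: "?E \<in> herm_L2 S"
      using herm_L2_add[OF herm_L2_add[OF mexp_L_adj_herm_L2[of y] herm_L2_scaleR[OF mexp_L_adj_herm_L2[of x], of "-1"]]
          nc_mult_L_adj_herm_L2[of x "y - x"]] by simp
    have LE: "L ?E = L (\<lambda>\<theta>. mexp (- L_adj y \<theta>)) - L (\<lambda>\<theta>. mexp (- L_adj x \<theta>)) +
        L (\<lambda>\<theta>. nc_mult (mexp (- L_adj x \<theta>)) (L_adj (y - x) \<theta>))"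
      using L_add[OF herm_L2_add[OF mexp_L_adj_herm_L2[of y] herm_L2_scaleR[OF mexp_L_adj_herm_L2[of x], of "-1"]]
          nc_mult_L_adj_herm_L2[of x "y - x"]]
        L_add[OF mexp_L_adj_herm_L2[of y] herm_L2_scaleR[OF mexp_L_adj_herm_L2[of x], of "-1"]]
        L_scaleR[of "-1" "\<lambda>\<theta>. mexp (- L_adj x \<theta>)"] by simp
    have "kappa y - kappa x - kappa' x (y - x) = (1 / exp 1) *\<^sub>R L ?E"
      unfolding kappa_def grad_kappa_def LE by (simp add: scaleR_diff_right scaleR_add_right)
    also have "norm \<dots> \<le> norm (L ?E)"
    proof -
      have "1 / exp (1::real) \<le> 1" by simp
      then show ?thesis using mult_right_mono[of "1 / exp 1" 1 "norm (L ?E)"] by simp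
    qed
    also have "\<dots> \<le> (C * (K * (D * norm (y - x))\<^sup>2)) * measure lebesgue S"
      unfolding moment_map_def
    proof (rule norm_integral_le[OF integrable_moment[OF EL2]])
      fix \<theta> assume th: "\<theta> \<in> S"
      show "norm (Gl \<theta> ** ?E \<theta> ** Gr \<theta>) \<le> C * (K * (D * norm (y - x))\<^sup>2)"
        using C(2)[OF th, of "?E \<theta>"] mult_left_mono[OF bE[OF th], of C] C(1) by linarith
    qed
    also have "\<dots> = Q * (norm (y - x))\<^sup>2" by (simp add: Q_def power_mult_distrib algebra_simps)
    finally show ?thesis .
  qed
  show "\<exists>d>0. \<forall>y. norm (y - x) < d \<longrightarrow> norm (kappa y - kappa x - kappa' x (y - x)) \<le> e * norm (y - x)"
  \<comment> \<open>The \<open>1\<close> keeps \<open>y\<close> where \<open>quad\<close> applies;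
    \<open>Q + 1\<close> avoids division by zero when \<open>Q = 0\<close>.\<close>
  proof (intro exI[of _ "min 1 (e / (Q + 1))"] conjI allI impI)
    show "min 1 (e / (Q + 1)) > 0" using e Q by simp
    fix y assume y: "norm (y - x) < min 1 (e / (Q + 1))"
    then have "(Q + 1) * norm (y - x) \<le> e" using Q by (simp add: pos_less_divide_eq mult.commute)
    then have "norm (y - x) + Q * norm (y - x) \<le> e" by (simp add: algebra_simps)
    then have "Q * norm (y - x) \<le> e" using norm_ge_zero[of "y - x"] by linarith
    then have "Q * norm (y - x) * norm (y - x) \<le> e * norm (y - x)" by (intro mult_right_mono) auto
    with quad[of y] y show "norm (kappa y - kappa x - kappa' x (y - x)) \<le> e * norm (y - x)"
      by (simp add: power2_eq_square mult.assoc)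
  qed
qed

sublocale negative_definite_derivative V kappa kappa'
  by unfold_locales (simp_all add: subspace_V kappa_in kappa'_in has_derivative_kappa kappa'_negative)

end

section \<open>The image of the gradient map\<close>

lemma compact_hermitian: "compact ({A :: complex^'m^'m. hermitian A} \<inter> cball 0 r)"
  by (rule closed_Int_compact[OF closed_subspace[OF subspace_hermitian] compact_cball])

lemmas continuous_on_mv [continuous_intros] = bounded_bilinear.continuous_on[OF bounded_bilinear_mv]

lemma pos_definite_convex:
  fixes A B :: "complex^'m^'m"
  assumes "pos_definite A" "pos_definite B" "0 \<le> u" "0 \<le> v" "u + v = 1"
  shows "pos_definite (u *\<^sub>R A + v *\<^sub>R B)"
  unfolding pos_definite_def
proof (intro conjI allI impI)
  show "hermitian (u *\<^sub>R A + v *\<^sub>R B)"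
    using assms by (intro hermitian_add hermitian_scaleR) (simp_all add: pos_definite_def)
  fix x :: "complex^'m" assume "x \<noteq> 0"
  then have *: "0 < x \<bullet> (A *v x)" "0 < x \<bullet> (B *v x)" using assms by (simp_all add: pos_definite_def)
  have eq: "x \<bullet> ((u *\<^sub>R A + v *\<^sub>R B) *v x) = u * (x \<bullet> (A *v x)) + v * (x \<bullet> (B *v x))"
    by (simp add: bounded_bilinear.add_left[OF bounded_bilinear_mv] scaleR_mv inner_add_right)
  have "u > 0 \<or> v > 0" using assms by linarith
  then show "0 < x \<bullet> ((u *\<^sub>R A + v *\<^sub>R B) *v x)"
  proof
    assume "u > 0"
    with * assms(4) show ?thesis unfolding eq by (intro add_pos_nonneg mult_pos_pos mult_nonneg_nonneg) auto
  next
    assume "v > 0"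
    with * assms(3) show ?thesis unfolding eq by (intro add_nonneg_pos mult_pos_pos mult_nonneg_nonneg) auto
  qed
qed

text \<open>For \<open>y \<ge> 0\<close> the exponential is at least \<open>(s * y)^2 / 2\<close>, a
  parabola lying above each of its tangents, here the one of slope \<open>k\<close>. The free
  \<open>k\<close> expresses superlinear growth by bounds that are linear in \<open>s\<close>, hence
  easy to integrate.\<close>

lemma exp_ge_linear:
  fixes s y k :: real
  assumes "s \<ge> 0"
  shows "k * s * max 0 y - k\<^sup>2 / 2 \<le> exp (s * y)"
proof (cases "y \<ge> 0")
  case True
  then have "1 + s * y + (s * y)\<^sup>2 / 2 \<le> exp (s * y)" using assms by (intro exp_lower_Taylor_quadratic) simp
  moreover have "0 \<le> s * y" using True assms by simp
  moreover have "0 \<le> (s * y - k)\<^sup>2" by simp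
  then have "k * (s * y) - k\<^sup>2 / 2 \<le> (s * y)\<^sup>2 / 2" by (simp add: power2_eq_square algebra_simps)
  ultimately show ?thesis using True by (simp add: max_def mult.assoc)
next
  case False
  then have "max 0 y = 0" by simp
  moreover have "- (k\<^sup>2 / 2) \<le> 0" by simp
  then have "- (k\<^sup>2 / 2) \<le> exp (s * y)" by (rule order_trans) simp
  ultimately show ?thesis by simp
qed

context moment_problem
begin

abbreviation "W \<equiv> int_moment_cone S Gl Gr"
abbreviation "rho_exp \<equiv> exp_density Gl Gr"

lemma rho_exp_eq: "rho_exp x \<theta> = mexp (- L_adj x \<theta> - mat 1)"
  by (simp add: exp_density_def mexp_diff_mat_1 hermitian_minus hermitian_moment_adj)

lemma hermitian_log_rho_exp: "hermitian (- L_adj x \<theta> - mat 1)"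
  by (intro hermitian_diff hermitian_minus hermitian_moment_adj hermitian_mat_1)

lemma continuous_on_rho_exp: "continuous_on S (rho_exp x)"
  unfolding rho_exp_eq[abs_def] by (intro continuous_intros hermitian_log_rho_exp)

lemma kappa_eq_moment_map: "kappa x = L (rho_exp x)"
  by (simp add: kappa_def exp_density_def[abs_def] L_scaleR)

lemma rho_exp_pos_L2: "rho_exp x \<in> pos_L2 S"
proof -
  have "pos_definite (rho_exp x \<theta>)" for \<theta>
    unfolding rho_exp_eq by (rule pos_definite_mexp[OF hermitian_log_rho_exp])
  then show ?thesis
    using herm_L2_continuous[OF continuous_on_rho_exp] by (auto simp: pos_L2_def pos_definite_def)
qed

lemma pos_L2_herm_L2: "\<rho> \<in> pos_L2 S \<Longrightarrow> \<rho> \<in> herm_L2 S"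
  by (simp add: pos_L2_def)

lemma W_subset: "W \<subseteq> V"
  unfolding int_moment_cone_def using pos_L2_herm_L2 by (intro image_subsetI V_I)

lemma kappa_image_subset: "kappa ` V \<subseteq> W"
  unfolding int_moment_cone_def kappa_eq_moment_map using rho_exp_pos_L2 by auto

lemma convex_W: "convex W"
proof (rule convexI)
  fix x y u v assume "x \<in> W" "y \<in> W" and uv: "0 \<le> u" "0 \<le> v" "u + v = (1::real)"
  then obtain \<rho> \<sigma> where \<rho>: "\<rho> \<in> pos_L2 S" "x = L \<rho>" and \<sigma>: "\<sigma> \<in> pos_L2 S" "y = L \<sigma>"
    unfolding int_moment_cone_def by (elim imageE)
  have "u *\<^sub>R x + v *\<^sub>R y = L (\<lambda>\<theta>. u *\<^sub>R \<rho> \<theta> + v *\<^sub>R \<sigma> \<theta>)"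
    using L_add[OF herm_L2_scaleR herm_L2_scaleR, of \<rho> \<sigma> u v] \<rho> \<sigma> by (simp add: L_scaleR pos_L2_herm_L2)
  moreover have "(\<lambda>\<theta>. u *\<^sub>R \<rho> \<theta> + v *\<^sub>R \<sigma> \<theta>) \<in> pos_L2 S"
    using herm_L2_add[OF herm_L2_scaleR herm_L2_scaleR, of \<rho> \<sigma> u v] \<rho> \<sigma> uv
    by (simp add: pos_L2_def pos_definite_convex)
  ultimately show "u *\<^sub>R x + v *\<^sub>R y \<in> W" unfolding int_moment_cone_def by simp
qed

section \<open>Properness of \<open>kappa\<close> over the cone \<open>W\<close>\<close>

definition trace_integral where
  "trace_integral x = (LINT \<theta>|M. mat 1 \<bullet> mexp (- L_adj x \<theta>))"

lemma trace_integral_nonneg: "trace_integral x \<ge> 0"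
  unfolding trace_integral_def
  by (intro Bochner_Integration.integral_nonneg trace_nonneg_pos_definite pos_definite_mexp hermitian_minus hermitian_moment_adj)

lemma integrable_trace: "integrable M (\<lambda>\<theta>. mat 1 \<bullet> mexp (- L_adj x \<theta>))"
  by (intro integrable_continuous_M continuous_intros continuous_mexp_L_adj)

lemma integral_const_M: "(LINT \<theta>|M. c) = c * measure lebesgue S" for c :: real
  by (simp add: measure_restrict_space S_lebesgue)

text \<open>\<open>inner_mexp_minus_le\<close>, integrated. It serves twice: without the trace term
  it bounds \<open>x \<bullet> kappa x\<close> from above by a constant, with it it makes the trace
  term grow at most linearly in \<open>norm x\<close> while \<open>kappa x\<close> stays
  bounded.\<close>

lemma inner_kappa_le:
  "exp 1 * (x \<bullet> kappa x) + trace_integral x \<le> CARD('m) * measure lebesgue S"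
proof -
  have "exp 1 * (x \<bullet> kappa x) = (LINT \<theta>|M. L_adj x \<theta> \<bullet> mexp (- L_adj x \<theta>))"
    using integrable_inner_moment_adj(2)[OF mexp_L_adj_herm_L2, of x x] by (simp add: kappa_def)
  also have "\<dots> \<le> (LINT \<theta>|M. CARD('m) - mat 1 \<bullet> mexp (- L_adj x \<theta>))"
    by (intro integral_mono integrable_inner_moment_adj mexp_L_adj_herm_L2 Bochner_Integration.integrable_diff
        integrable_trace integrable_const_M inner_mexp_minus_le hermitian_moment_adj)
  also have "\<dots> = CARD('m) * measure lebesgue S - trace_integral x"
    unfolding trace_integral_def integral_const_M[symmetric]
    by (rule Bochner_Integration.integral_diff[OF integrable_const_M integrable_trace])
  finally show ?thesis by simp
qed

text \<open>The negative part of the quadratic form of \<open>L_adj u\<close> in direction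
  \<open>v\<close>: where it is positive, \<open>exp (- L_adj (s u))\<close> blows up as
  \<open>s\<close> grows.\<close>

definition neg_form where
  "neg_form v u \<theta> = max 0 (- (v \<bullet> (L_adj u \<theta> *v v)))"

lemma continuous_on_neg_form: "continuous_on S (neg_form v u)"
  unfolding neg_form_def[abs_def] by (intro continuous_intros)

text \<open>\<open>trace_mexp_ge\<close> and \<open>exp_ge_linear\<close> combined under the
  integral. The slope \<open>k\<close> stays free, to be chosen beyond any given linear
  bound.\<close>

lemma trace_integral_ge:
  assumes v: "norm v = 1" and s: "s \<ge> 0"
  shows "k * s * integral\<^sup>L M (neg_form v u) - k\<^sup>2 / 2 * measure lebesgue S \<le> 2 * trace_integral (s *\<^sub>R u)"
proof -
  have i: "integrable M (neg_form v u)" by (rule integrable_continuous_M[OF continuous_on_neg_form])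
  have "k * s * integral\<^sup>L M (neg_form v u) - k\<^sup>2 / 2 * measure lebesgue S =
      (LINT \<theta>|M. k * s * neg_form v u \<theta> - k\<^sup>2 / 2)"
    using i integrable_const_M[of "k\<^sup>2 / 2"]
    by (simp only: integral_const_M[symmetric] Bochner_Integration.integral_diff
        Bochner_Integration.integral_mult_right_zero Bochner_Integration.integrable_mult_right)
  also have "\<dots> \<le> (LINT \<theta>|M. 2 * (mat 1 \<bullet> mexp (- L_adj (s *\<^sub>R u) \<theta>)))"
  proof (rule integral_mono)
    show "integrable M (\<lambda>\<theta>. k * s * neg_form v u \<theta> - k\<^sup>2 / 2)"
      using i integrable_const_M[of "k\<^sup>2 / 2"] by simp
    show "integrable M (\<lambda>\<theta>. 2 * (mat 1 \<bullet> mexp (- L_adj (s *\<^sub>R u) \<theta>)))"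
      using integrable_trace by simp
    fix \<theta>
    have "v \<bullet> (- L_adj (s *\<^sub>R u) \<theta> *v v) = s * - (v \<bullet> (L_adj u \<theta> *v v))"
      by (simp add: moment_adj_scaleR bounded_bilinear.minus_left[OF bounded_bilinear_mv] scaleR_mv)
    then show "k * s * neg_form v u \<theta> - k\<^sup>2 / 2 \<le> 2 * (mat 1 \<bullet> mexp (- L_adj (s *\<^sub>R u) \<theta>))"
      using exp_ge_linear[OF s, of k "- (v \<bullet> (L_adj u \<theta> *v v))"]
        trace_mexp_ge[OF hermitian_minus[OF hermitian_moment_adj] v, of Gl Gr "s *\<^sub>R u" \<theta>]
      by (simp add: neg_form_def)
  qed
  also have "\<dots> = 2 * trace_integral (s *\<^sub>R u)" by (simp add: trace_integral_def)
  finally show ?thesis .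
qed

text \<open>Carries growth estimates over from a limit direction to the nearby directions of an
  actual sequence.\<close>

lemma neg_form_lipschitz:
  assumes v: "norm v = 1"
  obtains C where "C > 0" "\<And>u w. integral\<^sup>L M (neg_form v w) - C * norm (u - w) \<le> integral\<^sup>L M (neg_form v u)"
proof -
  obtain K where K: "K > 0" "\<And>(A :: complex^'m^'m) x. norm (A *v x) \<le> norm A * norm x * K"
    using bounded_bilinear.pos_bounded[OF bounded_bilinear_mv] by blast
  obtain D where D: "D > 0" "\<And>\<theta> x. \<theta> \<in> S \<Longrightarrow> norm (L_adj x \<theta>) \<le> D * norm x"
    using L_adj_bound by blast
  have pt: "neg_form v w \<theta> - D * K * norm (u - w) \<le> neg_form v u \<theta>" if th: "\<theta> \<in> S" for \<theta> u w
  proof -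
    have "v \<bullet> (L_adj u \<theta> *v v) - v \<bullet> (L_adj w \<theta> *v v) = v \<bullet> (L_adj (u - w) \<theta> *v v)"
      by (simp add: moment_adj_diff bounded_bilinear.diff_left[OF bounded_bilinear_mv] inner_diff_right)
    also have "\<dots> \<le> norm v * norm (L_adj (u - w) \<theta> *v v)" by (rule norm_cauchy_schwarz)
    also have "\<dots> \<le> norm (L_adj (u - w) \<theta>) * K" using K(2)[of "L_adj (u - w) \<theta>" v] v by simp
    also have "\<dots> \<le> D * norm (u - w) * K" using K(1) D(2)[OF th] by (intro mult_right_mono) auto
    finally show ?thesis
      using D(1) K(1) by (simp add: neg_form_def max_def algebra_simps)
  qed
  show thesis
  proof (rule that[of "D * K * (measure lebesgue S + 1)"])
    show "D * K * (measure lebesgue S + 1) > 0" using D(1) K(1) by (simp add: add_nonneg_pos)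
    fix u w
    have i: "integrable M (neg_form v u)" for u by (rule integrable_continuous_M[OF continuous_on_neg_form])
    have "integral\<^sup>L M (neg_form v w) - D * K * norm (u - w) * measure lebesgue S =
        (LINT \<theta>|M. neg_form v w \<theta> - D * K * norm (u - w))"
      unfolding integral_const_M[symmetric]
      by (rule Bochner_Integration.integral_diff[symmetric, OF i integrable_const_M])
    also have "\<dots> \<le> integral\<^sup>L M (neg_form v u)"
      by (rule integral_mono[OF Bochner_Integration.integrable_diff[OF i integrable_const_M] i]) (simp add: pt)
    finally have "integral\<^sup>L M (neg_form v w) - D * K * norm (u - w) * measure lebesgue S \<le> integral\<^sup>L M (neg_form v u)" .
    moreover have "0 \<le> D * K * norm (u - w)" using D(1) K(1) by simp
    ultimately show "integral\<^sup>L M (neg_form v w) - D * K * (measure lebesgue S + 1) * norm (u - w) \<le> integral\<^sup>L M (neg_form v u)"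
      by (simp add: algebra_simps)
  qed
qed

text \<open>Write \<open>R = L \<rho>\<close> with \<open>\<rho>\<close> positive definite. If
  \<open>L_adj u\<close> were nonnegative definite throughout, then \<open>u \<bullet> R\<close>,
  the integral of its pairing with \<open>\<rho>\<close>, would be nonnegative, hence
  \<open>0\<close>; this forces \<open>L_adj u = 0\<close>, first almost everywhere, then everywhere
  by continuity, against \<open>u \<noteq> 0\<close>.\<close>

lemma neg_form_pos:
  assumes u: "u \<in> V" "u \<noteq> 0" and R: "R \<in> W" and le: "u \<bullet> R \<le> 0"
  obtains v where "norm v = 1" "integral\<^sup>L M (neg_form v u) > 0"
proof -
  obtain \<rho> where \<rho>: "\<rho> \<in> pos_L2 S" "R = L \<rho>" using R unfolding int_moment_cone_def by (elim imageE)
  have pd: "pos_definite (\<rho> \<theta>)" if "\<theta> \<in> S" for \<theta> using \<rho>(1) that by (simp add: pos_L2_def)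
  have "\<exists>\<theta>\<in>S. \<exists>v. v \<bullet> (L_adj u \<theta> *v v) < 0"
  proof (rule ccontr)
    assume "\<not> ?thesis"
    then have nn: "0 \<le> v \<bullet> (L_adj u \<theta> *v v)" if "\<theta> \<in> S" for \<theta> v using that by (auto simp: not_less)
    have pos: "0 \<le> L_adj u \<theta> \<bullet> \<rho> \<theta>" if "\<theta> \<in> S" for \<theta>
      by (rule inner_pos_definite(1)[OF hermitian_moment_adj nn[OF that] pd[OF that]])
    have i: "integrable M (\<lambda>\<theta>. L_adj u \<theta> \<bullet> \<rho> \<theta>)"
      by (rule integrable_inner_moment_adj(1)[OF pos_L2_herm_L2[OF \<rho>(1)]])
    have "(LINT \<theta>|M. L_adj u \<theta> \<bullet> \<rho> \<theta>) \<le> 0"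
      using le unfolding \<rho>(2) integrable_inner_moment_adj(2)[OF pos_L2_herm_L2[OF \<rho>(1)]] .
    moreover have "(LINT \<theta>|M. L_adj u \<theta> \<bullet> \<rho> \<theta>) \<ge> 0"
      by (rule integral_nonneg_AE) (use pos in \<open>auto intro!: AE_I2\<close>)
    ultimately have "(LINT \<theta>|M. L_adj u \<theta> \<bullet> \<rho> \<theta>) = 0" by simp
    moreover have "AE \<theta> in M. 0 \<le> L_adj u \<theta> \<bullet> \<rho> \<theta>" using pos by (auto intro!: AE_I2)
    ultimately have "AE \<theta> in M. L_adj u \<theta> \<bullet> \<rho> \<theta> = 0"
      using integral_nonneg_eq_0_iff_AE[OF i] by blast
    then have "AE \<theta> in M. L_adj u \<theta> = 0"
    proof (rule AE_mp, intro AE_I2 impI)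
      fix \<theta> assume "\<theta> \<in> space M" and 0: "L_adj u \<theta> \<bullet> \<rho> \<theta> = 0"
      then have "\<theta> \<in> S" by simp
      from inner_pos_definite(2)[OF hermitian_moment_adj nn[OF this] pd[OF this] 0] show "L_adj u \<theta> = 0" .
    qed
    then have "L_adj u \<theta> = 0" if "\<theta> \<in> S" for \<theta>
      by (rule continuous_AE_0[OF continuous_on_L_adj _ that])
    then show False using L_adj_eq_0[OF u(1)] u(2) by blast
  qed
  then obtain \<theta> w where w: "\<theta> \<in> S" "w \<bullet> (L_adj u \<theta> *v w) < 0" by blast
  then have w0: "w \<noteq> 0" by auto
  define v where "v = w /\<^sub>R norm w"
  have "v \<bullet> (L_adj u \<theta> *v v) = (w \<bullet> (L_adj u \<theta> *v w)) / (norm w)\<^sup>2"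
    by (simp add: v_def mv_scaleR power2_eq_square divide_inverse algebra_simps)
  also have "\<dots> < 0" using w w0 by (simp add: divide_neg_pos)
  finally have "neg_form v u \<theta> > 0" by (simp add: neg_form_def)
  moreover have nn: "neg_form v u \<theta> \<ge> 0" for \<theta> by (simp add: neg_form_def)
  ultimately have "integral\<^sup>L M (neg_form v u) \<noteq> 0"
    using continuous_nonneg_integral_0[OF continuous_on_neg_form nn _ w(1)] by fastforce
  moreover have "integral\<^sup>L M (neg_form v u) \<ge> 0" using nn by simp
  ultimately show thesis using w0 by (intro that[of v]) (simp_all add: v_def)
qed

text \<open>Along a sequence \<open>X\<close> in \<open>V\<close> with \<open>norm (X n)\<close> unbounded, a limit direction \<open>u\<close> would satisfy
  \<open>u \<bullet> R \<le> 0\<close>, so \<open>L_adj u\<close> is somewhere not nonnegative definite and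
  \<open>trace_integral\<close> grows faster than linearly, against \<open>inner_kappa_le\<close>.\<close>

lemma kappa_proper:
  assumes R: "R \<in> W"
  shows "\<exists>e>0. \<exists>K. \<forall>x\<in>V. norm (kappa x - R) < e \<longrightarrow> norm x \<le> K"
proof (rule ccontr)
  assume contra: "\<not> ?thesis"
  have "\<exists>x\<in>V. norm (kappa x - R) < inverse (real (Suc n)) \<and> real (Suc n) < norm x" for n
  proof (rule ccontr)
    assume "\<not> ?thesis"
    then have "\<forall>x\<in>V. norm (kappa x - R) < inverse (real (Suc n)) \<longrightarrow> norm x \<le> real (Suc n)" by force
    moreover have "inverse (real (Suc n)) > 0" by simp
    ultimately show False using contra by blast
  qed
  then obtain x where x: "\<And>n. x n \<in> V" "\<And>n. norm (kappa (x n) - R) < inverse (real (Suc n))"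
    "\<And>n. real (Suc n) < norm (x n)" by metis
  define y where "y n = x n /\<^sub>R norm (x n)" for n
  have x0: "norm (x n) > 0" for n using x(3)[of n] by linarith
  have "compact (sphere 0 1 \<inter> V)" by (simp add: compact_Int_closed closed_subspace subspace_V)
  moreover have "\<forall>n. y n \<in> sphere 0 1 \<inter> V"
    using x0 x(1) by (auto simp: y_def intro!: subspace_scale[OF subspace_V])
  ultimately obtain u r where u: "u \<in> sphere 0 1 \<inter> V" and r: "strict_mono r" and lim: "(y \<circ> r) \<longlonglongrightarrow> u"
    unfolding compact_def by blast
  define X where "X n = x (r n)" for n
  define U where "U n = y (r n)" for n
  have U: "U \<longlonglongrightarrow> u" using lim by (simp add: U_def[abs_def] o_def)
  have XU: "X n = norm (X n) *\<^sub>R U n" and nX: "norm (X n) > 0" for n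
    using x0[of "r n"] by (simp_all add: X_def U_def y_def)
  have Xn: "real (Suc n) < norm (X n)" for n
    using x(3)[of "r n"] seq_suble[OF r, of n] by (simp add: X_def)
  have inv: "(\<lambda>n. inverse (norm (X n))) \<longlonglongrightarrow> 0"
  proof (rule tendsto_sandwich[OF _ _ tendsto_const LIMSEQ_inverse_real_of_nat])
    show "\<forall>\<^sub>F n in sequentially. inverse (norm (X n)) \<le> inverse (real (Suc n))"
      using Xn by (intro always_eventually allI le_imp_inverse_le) (auto intro: less_imp_le)
  qed simp
  have kX: "(\<lambda>n. kappa (X n)) \<longlonglongrightarrow> R"
  proof -
    have "(\<lambda>n. norm (kappa (x n) - R)) \<longlonglongrightarrow> 0"
      by (rule tendsto_sandwich[OF _ _ tendsto_const LIMSEQ_inverse_real_of_nat])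
        (use x(2) in \<open>auto intro!: always_eventually less_imp_le\<close>)
    then have "(\<lambda>n. kappa (x n)) \<longlonglongrightarrow> R" by (simp add: tendsto_norm_zero_iff LIM_zero_iff)
    from LIMSEQ_subseq_LIMSEQ[OF this r] show ?thesis by (simp add: X_def[abs_def] o_def)
  qed
  define c where "c = CARD('m) * measure lebesgue S"
  have main: "exp 1 * (U n \<bullet> kappa (X n)) + trace_integral (X n) * inverse (norm (X n)) \<le> c * inverse (norm (X n))" for n
  proof -
    have "norm (X n) * (U n \<bullet> kappa (X n)) = X n \<bullet> kappa (X n)"
      by (subst (3) XU) simp
    with inner_kappa_le[of "X n"]
    have "norm (X n) * (exp 1 * (U n \<bullet> kappa (X n))) + trace_integral (X n) \<le> c"
      by (simp add: c_def mult.left_commute)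
    from mult_right_mono[OF this, of "inverse (norm (X n))"] nX[of n] show ?thesis
      by (simp add: field_simps)
  qed
  have clim: "(\<lambda>n. c * inverse (norm (X n))) \<longlonglongrightarrow> 0" using tendsto_mult_right_zero[OF inv] .
  have Ulim: "(\<lambda>n. exp 1 * (U n \<bullet> kappa (X n))) \<longlonglongrightarrow> exp 1 * (u \<bullet> R)"
    by (intro tendsto_intros U kX)
  have "exp 1 * (u \<bullet> R) \<le> 0"
  proof (rule LIMSEQ_le[OF Ulim clim], intro exI allI impI)
    fix n
    have "0 \<le> trace_integral (X n) * inverse (norm (X n))" using trace_integral_nonneg by simp
    then show "exp 1 * (U n \<bullet> kappa (X n)) \<le> c * inverse (norm (X n))" using main[of n] by linarith
  qed
  then have "u \<bullet> R \<le> 0" by (simp add: mult_le_0_iff)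
  moreover have "u \<in> V" "u \<noteq> 0" using u by auto
  ultimately obtain v where v: "norm v = 1" "integral\<^sup>L M (neg_form v u) > 0"
    using neg_form_pos[OF _ _ R] by blast
  define H where "H = integral\<^sup>L M (neg_form v u)"
  have H: "H > 0" using v(2) by (simp add: H_def)
  obtain C where C: "C > 0" "\<And>u w. integral\<^sup>L M (neg_form v w) - C * norm (u - w) \<le> integral\<^sup>L M (neg_form v u)"
    using neg_form_lipschitz[OF v(1)] by blast
  \<comment> \<open>After division by \<open>norm (X n)\<close> the constant with \<open>k^2\<close>
    disappears in the limit, while \<open>k\<close> still multiplies the fixed number
    \<open>H > 0\<close>.\<close>
  have grow: "k * H \<le> - 2 * exp 1 * (u \<bullet> R)" if k: "k > 0" for k
  proof -
    define m where "m = measure lebesgue S"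
    have "k * (H - C * norm (U n - u)) \<le> 2 * (c * inverse (norm (X n))) - 2 * (exp 1 * (U n \<bullet> kappa (X n)))
        + k\<^sup>2 / 2 * m * inverse (norm (X n))" for n
    proof -
      have "k * norm (X n) * integral\<^sup>L M (neg_form v (U n)) - k\<^sup>2 / 2 * m \<le> 2 * trace_integral (X n)"
        using trace_integral_ge[OF v(1), of "norm (X n)" k "U n"] XU[of n] by (simp add: m_def)
      from mult_right_mono[OF this, of "inverse (norm (X n))"] nX[of n]
      have "k * integral\<^sup>L M (neg_form v (U n)) - k\<^sup>2 / 2 * m * inverse (norm (X n))
          \<le> 2 * (trace_integral (X n) * inverse (norm (X n)))"
        by (simp add: field_simps)
      moreover have "k * (H - C * norm (U n - u)) \<le> k * integral\<^sup>L M (neg_form v (U n))"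
        using C(2)[of u "U n"] k by (intro mult_left_mono) (auto simp: H_def)
      ultimately show ?thesis using main[of n] by linarith
    qed
    moreover have "(\<lambda>n. k * (H - C * norm (U n - u))) \<longlonglongrightarrow> k * (H - C * norm (u - u))"
      by (intro tendsto_intros U)
    moreover have "(\<lambda>n. 2 * (c * inverse (norm (X n))) - 2 * (exp 1 * (U n \<bullet> kappa (X n)))
        + k\<^sup>2 / 2 * m * inverse (norm (X n))) \<longlonglongrightarrow> 2 * 0 - 2 * (exp 1 * (u \<bullet> R)) + k\<^sup>2 / 2 * m * 0"
      by (intro tendsto_intros clim Ulim inv)
    ultimately have "k * (H - C * norm (u - u)) \<le> 2 * 0 - 2 * (exp 1 * (u \<bullet> R)) + k\<^sup>2 / 2 * m * 0"
      by (intro LIMSEQ_le) auto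
    then show ?thesis by simp
  qed
  define k where "k = (\<bar>2 * exp 1 * (u \<bullet> R)\<bar> + 1) / H"
  have "k > 0" using H by (simp add: k_def)
  from grow[OF this] have "\<bar>2 * exp 1 * (u \<bullet> R)\<bar> + 1 \<le> - 2 * exp 1 * (u \<bullet> R)"
    using H by (simp add: k_def)
  then show False by linarith
qed

theorem kappa_image: "kappa ` V = W"
proof -
  have "openin (top_of_set W) (kappa ` V)"
    using openin_subset_trans[OF openin_k_image kappa_image_subset W_subset] .
  moreover have "closedin (top_of_set W) (kappa ` V)"
    unfolding closedin_def
  proof (intro conjI)
    show "openin (top_of_set W) (topspace (top_of_set W) - kappa ` V)"
      unfolding openin_contains_ball
    proof (intro conjI ballI)
      fix R assume R: "R \<in> topspace (top_of_set W) - kappa ` V"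
      then obtain e K where e: "e > 0" "\<And>x. x \<in> V \<Longrightarrow> norm (kappa x - R) < e \<Longrightarrow> norm x \<le> K"
        using kappa_proper[of R] by auto
      \<comment> \<open>Within distance \<open>e\<close> of \<open>R\<close> every image point comes
        from the compact set \<open>cball 0 K \<inter> V\<close>. Its image is closed and misses
        \<open>R\<close>, so a smaller ball is free of image points.\<close>
      have "compact (kappa ` (cball 0 K \<inter> V))"
        by (intro compact_continuous_image continuous_on_subset[OF continuous_on_k] compact_Int_closed
            closed_subspace subspace_V compact_cball) auto
      then have "open (ball R e - kappa ` (cball 0 K \<inter> V))"
        by (intro open_Diff open_ball compact_imp_closed)
      moreover have "R \<in> ball R e - kappa ` (cball 0 K \<inter> V)" using R e(1) by auto
      ultimately obtain d where d: "d > 0" "ball R d \<subseteq> ball R e - kappa ` (cball 0 K \<inter> V)"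
        unfolding open_contains_ball by blast
      have "ball R d \<inter> W \<subseteq> topspace (top_of_set W) - kappa ` V"
      proof
        fix z assume z: "z \<in> ball R d \<inter> W"
        have "z \<notin> kappa ` V"
        proof
          assume "z \<in> kappa ` V"
          then obtain x where x: "x \<in> V" "z = kappa x" by blast
          have "norm (kappa x - R) < e" using z d(2) x by (auto simp: dist_norm norm_minus_commute)
          then have "x \<in> cball 0 K \<inter> V" using e(2) x by simp
          then show False using z d(2) x by blast
        qed
        then show "z \<in> topspace (top_of_set W) - kappa ` V" using z by simp
      qed
      then show "\<exists>e>0. ball R e \<inter> W \<subseteq> topspace (top_of_set W) - kappa ` V" using d(1) by blast
    qed auto
  qed (simp add: kappa_image_subset)
  moreover have "kappa ` V \<noteq> {}" using subspace_0[OF subspace_V] by blast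
  ultimately show ?thesis
    using convex_connected[OF convex_W] unfolding connected_clopen by blast
qed

end

section \<open>Entropy and the flow\<close>

text \<open>\<open>mlog\<close> is the inverse of a continuous injection on each compact set of
  Hermitian matrices of bounded norm, hence continuous on the image \<open>K n\<close>. These images
  exhaust the positive definite matrices, and the function is a pointwise limit of its cut-offs to
  them.\<close>

lemma inner_mlog_measurable_pos_definite:
  fixes f :: "'a \<Rightarrow> complex^'m^'m"
  assumes f: "f \<in> borel_measurable N" and pd: "\<And>x. x \<in> space N \<Longrightarrow> pos_definite (f x)"
  shows "(\<lambda>x. f x \<bullet> mlog (f x)) \<in> borel_measurable N"
proof -
  define K :: "nat \<Rightarrow> (complex^'m^'m) set" where "K n = mexp ` ({A. hermitian A} \<inter> cball 0 (real n))" for n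
  have cont: "continuous_on ({A :: complex^'m^'m. hermitian A} \<inter> cball 0 (real n)) mexp" for n
    by (rule continuous_on_subset[OF continuous_on_mexp_hermitian]) blast
  have cK: "compact (K n)" for n
    unfolding K_def by (rule compact_continuous_image[OF cont compact_hermitian])
  have cont_mlog: "continuous_on (K n) mlog" for n
    unfolding K_def by (rule continuous_on_inv[OF cont compact_hermitian]) (simp add: mlog_mexp)
  define g where "g n C = indicator (K n) C *\<^sub>R (C \<bullet> mlog C)" for n and C :: "complex^'m^'m"
  have g: "g n \<in> borel_measurable borel" for n
    unfolding g_def[abs_def]
    by (intro borel_measurable_continuous_on_indicator continuous_intros cont_mlog borel_compact cK)
  show ?thesis
  proof (rule borel_measurable_LIMSEQ_real)
    show "(\<lambda>x. g n (f x)) \<in> borel_measurable N" for n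
      by (rule measurable_compose[OF f g])
    fix x assume "x \<in> space N"
    then obtain X where X: "hermitian X" "mexp X = f x" using pos_definite_eq_mexp[OF pd] by blast
    obtain n0 where n0: "norm X \<le> real n0" using real_arch_simple by blast
    have "g n (f x) = f x \<bullet> mlog (f x)" if "n \<ge> n0" for n
    proof -
      have "f x \<in> K n" unfolding K_def X(2)[symmetric] using X(1) n0 that by (intro imageI) simp
      then show ?thesis by (simp add: g_def)
    qed
    then show "(\<lambda>n. g n (f x)) \<longlonglongrightarrow> f x \<bullet> mlog (f x)"
      by (intro tendsto_eventually eventually_sequentiallyI)
  qed
qed

context moment_problem
begin

lemma integrable_entropy:
  fixes \<sigma> :: "'s \<Rightarrow> complex^'m^'m"
  assumes "\<sigma> \<in> pos_L2 S" shows "integrable M (\<lambda>\<theta>. \<sigma> \<theta> \<bullet> mlog (\<sigma> \<theta>))"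
proof -
  have pd: "pos_definite (\<sigma> \<theta>)" if "\<theta> \<in> S" for \<theta> using assms that by (simp add: pos_L2_def)
  have meas: "(\<lambda>\<theta>. \<sigma> \<theta> \<bullet> mlog (\<sigma> \<theta>)) \<in> borel_measurable M"
    using assms pd by (intro inner_mlog_measurable_pos_definite) (auto simp: pos_L2_def herm_L2_def)
  have i: "integrable M (\<lambda>\<theta>. real CARD('m) + (norm (\<sigma> \<theta>))\<^sup>2)"
    using assms by (intro Bochner_Integration.integrable_add integrable_const_M) (simp add: pos_L2_def herm_L2_def)
  show ?thesis
  proof (rule Bochner_Integration.integrable_bound[OF i meas], intro AE_I2)
    fix \<theta> assume "\<theta> \<in> space M"
    then obtain X where X: "hermitian X" "mexp X = \<sigma> \<theta>" using pos_definite_eq_mexp[OF pd] by auto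
    show "norm (\<sigma> \<theta> \<bullet> mlog (\<sigma> \<theta>)) \<le> norm (real CARD('m) + (norm (\<sigma> \<theta>))\<^sup>2)"
      using inner_mexp_abs_le[OF X(1)] unfolding X(2)[symmetric] mlog_mexp[OF X(1)] by simp
  qed
qed

lemma entropy_eq:
  fixes \<sigma> :: "'s \<Rightarrow> complex^'m^'m"
  assumes "\<sigma> \<in> pos_L2 S" shows "entropy S \<sigma> = (LINT \<theta>|M. \<sigma> \<theta> \<bullet> mlog (\<sigma> \<theta>))"
  unfolding entropy_def
proof (rule Bochner_Integration.integral_cong[OF refl])
  fix \<theta> assume "\<theta> \<in> space M"
  then have "ctranspose (\<sigma> \<theta>) = \<sigma> \<theta>" using assms by (simp add: pos_L2_def herm_L2_def hermitian_def)
  then show "Re (trace (\<sigma> \<theta> ** mlog (\<sigma> \<theta>))) = \<sigma> \<theta> \<bullet> mlog (\<sigma> \<theta>)" by (simp add: Re_trace_mult)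
qed

text \<open>Integrating Klein's inequality for \<open>\<sigma> \<theta>\<close> and \<open>rho_exp x \<theta>\<close>: the logarithm of the latter is
  \<open>- L_adj x \<theta> - mat 1\<close>, whose pairing with \<open>\<sigma>\<close> depends on \<open>L \<sigma>\<close> and the trace of \<open>\<sigma>\<close> only.\<close>

lemma entropy_gibbs:
  assumes \<sigma>: "\<sigma> \<in> pos_L2 S" and L: "L \<sigma> = kappa x"
  shows "entropy S (rho_exp x) \<le> entropy S \<sigma>"
    and "entropy S (rho_exp x) = entropy S \<sigma> \<Longrightarrow> AE \<theta> in M. \<sigma> \<theta> = rho_exp x \<theta>"
proof -
  \<comment> \<open>For \<open>\<tau> = \<sigma>\<close> this is the Klein expression: the term
    \<open>- mat 1\<close> in the logarithm of \<open>rho_exp x\<close> cancels the trace of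
    \<open>\<tau>\<close>. Among functions with the same moments its integral differs from the
    entropy by a constant.\<close>
  define g where "g \<tau> \<theta> = \<tau> \<theta> \<bullet> mlog (\<tau> \<theta>) + L_adj x \<theta> \<bullet> \<tau> \<theta> + mat 1 \<bullet> rho_exp x \<theta>" for \<tau> \<theta>
  have it: "integrable M (\<lambda>\<theta>. mat 1 \<bullet> rho_exp x \<theta>)"
    by (intro integrable_continuous_M continuous_intros continuous_on_rho_exp)
  have ig: "integrable M (g \<tau>)" if "\<tau> \<in> pos_L2 S" for \<tau>
    unfolding g_def[abs_def]
    by (intro Bochner_Integration.integrable_add integrable_entropy integrable_inner_moment_adj(1) pos_L2_herm_L2 it that)
  have g_int: "integral\<^sup>L M (g \<tau>) = entropy S \<tau> + x \<bullet> kappa x + (LINT \<theta>|M. mat 1 \<bullet> rho_exp x \<theta>)"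
    if \<tau>: "\<tau> \<in> pos_L2 S" "L \<tau> = kappa x" for \<tau>
    unfolding g_def[abs_def] entropy_eq[OF \<tau>(1)] \<tau>(2)[symmetric] integrable_inner_moment_adj(2)[OF pos_L2_herm_L2[OF \<tau>(1)]]
    by (simp add: integrable_entropy[OF \<tau>(1)] integrable_inner_moment_adj(1)[OF pos_L2_herm_L2[OF \<tau>(1)]] it)
  have g_nonneg: "g \<sigma> \<theta> \<ge> 0" and g_0: "g \<sigma> \<theta> = 0 \<Longrightarrow> \<sigma> \<theta> = rho_exp x \<theta>" if th: "\<theta> \<in> S" for \<theta>
  proof -
    have "pos_definite (\<sigma> \<theta>)" using \<sigma> th by (simp add: pos_L2_def)
    then obtain X where X: "hermitian X" "mexp X = \<sigma> \<theta>" using pos_definite_eq_mexp by blast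
    let ?Y = "- L_adj x \<theta> - mat 1"
    have g: "g \<sigma> \<theta> = mexp X \<bullet> (X - ?Y) - mat 1 \<bullet> mexp X + mat 1 \<bullet> mexp ?Y"
      unfolding g_def rho_exp_eq X(2)[symmetric] mlog_mexp[OF X(1)]
      by (simp add: inner_diff_right inner_add_right inner_commute)
    show "g \<sigma> \<theta> \<ge> 0" unfolding g by (rule Klein(1)[OF X(1) hermitian_log_rho_exp])
    assume "g \<sigma> \<theta> = 0"
    then have "X = ?Y" unfolding g by (rule Klein(2)[OF X(1) hermitian_log_rho_exp])
    then show "\<sigma> \<theta> = rho_exp x \<theta>" using X(2) by (simp add: rho_exp_eq)
  qed
  have "g (rho_exp x) \<theta> = 0" for \<theta>
    unfolding g_def rho_exp_eq mlog_mexp[OF hermitian_log_rho_exp]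
      inner_commute[of "mexp (- L_adj x \<theta> - mat 1)"]
    by (simp add: inner_diff_left)
  then have "g (rho_exp x) = (\<lambda>_. 0)" by (rule ext)
  then have "integral\<^sup>L M (g (rho_exp x)) = 0" by simp
  then have e0: "entropy S (rho_exp x) + x \<bullet> kappa x + (LINT \<theta>|M. mat 1 \<bullet> rho_exp x \<theta>) = 0"
    using g_int[OF rho_exp_pos_L2 kappa_eq_moment_map[symmetric]] by simp
  then have e: "entropy S \<sigma> - entropy S (rho_exp x) = integral\<^sup>L M (g \<sigma>)"
    using g_int[OF \<sigma> L] by simp
  have nn: "AE \<theta> in M. 0 \<le> g \<sigma> \<theta>" using g_nonneg by (auto intro!: AE_I2)
  have "integral\<^sup>L M (g \<sigma>) \<ge> 0" by (rule integral_nonneg_AE[OF nn])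
  with e show "entropy S (rho_exp x) \<le> entropy S \<sigma>" by linarith
  assume "entropy S (rho_exp x) = entropy S \<sigma>"
  with e have "AE \<theta> in M. g \<sigma> \<theta> = 0"
    using integral_nonneg_eq_0_iff_AE[OF ig[OF \<sigma>] nn] by simp
  then show "AE \<theta> in M. \<sigma> \<theta> = rho_exp x \<theta>"
    by (rule AE_mp) (use g_0 in \<open>auto intro!: AE_I2\<close>)
qed

lemma unique_entropy_min_rho_exp:
  "unique_entropy_min S (pos_solutions S Gl Gr (kappa x)) (rho_exp x)"
proof -
  have in_sol: "rho_exp x \<in> pos_solutions S Gl Gr (kappa x)"
    by (simp add: pos_solutions_def rho_exp_pos_L2 kappa_eq_moment_map)
  have sol: "\<sigma> \<in> pos_L2 S" "L \<sigma> = kappa x" if "\<sigma> \<in> pos_solutions S Gl Gr (kappa x)" for \<sigma>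
    using that by (simp_all add: pos_solutions_def)
  have "is_arg_min (entropy S) (\<lambda>\<sigma>. \<sigma> \<in> pos_solutions S Gl Gr (kappa x)) (rho_exp x)"
    unfolding is_arg_min_linorder using in_sol entropy_gibbs(1) sol by blast
  moreover have "AE \<theta> in M. \<sigma> \<theta> = rho_exp x \<theta>"
    if "is_arg_min (entropy S) (\<lambda>\<sigma>. \<sigma> \<in> pos_solutions S Gl Gr (kappa x)) \<sigma>" for \<sigma>
  proof -
    have \<sigma>: "\<sigma> \<in> pos_solutions S Gl Gr (kappa x)" and le: "entropy S \<sigma> \<le> entropy S (rho_exp x)"
      using that in_sol unfolding is_arg_min_linorder by blast+
    show ?thesis
      using entropy_gibbs[OF sol[OF \<sigma>]] le by simp
  qed
  ultimately show ?thesis unfolding unique_entropy_min_def by blast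
qed

section \<open>The flow as the preimage of a segment\<close>

lemma residual_eq: "residual S Gl Gr R x = R - kappa x"
  by (simp add: residual_def kappa_def)

lemma flow_field_eq: "flow_field S Gl Gr R x = inv_into V (kappa' x) (R - kappa x)"
  by (simp add: flow_field_def residual_eq)

lemma kappa'_flow_field:
  assumes "x \<in> V" "R \<in> V" shows "kappa' x (flow_field S Gl Gr R x) = R - kappa x"
proof -
  have "R - kappa x \<in> kappa' x ` V"
    using bij_betw_k'[OF assms(1)] subspace_diff[OF subspace_V assms(2) kappa_in[of x]] by (simp add: bij_betw_def)
  then show ?thesis unfolding flow_field_eq by (rule f_inv_into_f)
qed

text \<open>The solution of \<open>y' = R - y\<close> starting at \<open>kappa x\<close>, the linear
  equation that the flow becomes under \<open>kappa\<close>.\<close>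

definition target where
  "target R x t = R + exp (- t) *\<^sub>R (kappa x - R)"

definition lifespan where
  "lifespan R x = {t. 0 \<le> t \<and> target R x t \<in> kappa ` V}"

definition trajectory where
  "trajectory R x t = k_inv (target R x t)"

lemma target_0: "target R x 0 = kappa x"
  by (simp add: target_def)

lemma has_vector_derivative_target:
  "(target R x has_vector_derivative R - target R x t) (at t within J)"
  unfolding target_def[abs_def]
  by (auto intro!: derivative_eq_intros simp: has_vector_derivative_def)

lemma trajectory_in: "t \<in> lifespan R x \<Longrightarrow> trajectory R x t \<in> V"
  and kappa_trajectory: "t \<in> lifespan R x \<Longrightarrow> kappa (trajectory R x t) = target R x t"
  by (simp_all add: lifespan_def trajectory_def k_inv_in k_k_inv)

lemma convex_image: "convex (kappa ` V)"
  using convex_W kappa_image by simp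

lemma lifespan_0: "x \<in> V \<Longrightarrow> 0 \<in> lifespan R x"
  by (simp add: lifespan_def target_0)

lemma lifespan_downward:
  assumes x: "x \<in> V" and t: "t \<in> lifespan R x" and s: "0 \<le> s" "s \<le> t"
  shows "s \<in> lifespan R x"
proof (cases "t = 0")
  case True
  then show ?thesis using t s by simp
next
  case False
  then have t0: "t > 0" using s by simp
  \<comment> \<open>\<open>c\<close> is the position of \<open>target R x s\<close> on the segment
    from \<open>kappa x\<close> to \<open>target R x t\<close>. The case \<open>t = 0\<close> is
    separate because the denominator vanishes.\<close>
  define c where "c = (1 - exp (- s)) / (1 - exp (- t))"
  have d: "1 - exp (- t) > 0" using t0 by simp
  have c: "0 \<le> c" "c \<le> 1" using d s by (simp_all add: c_def divide_simps)
  have cd: "c * (1 - exp (- t)) = 1 - exp (- s)" using d by (simp add: c_def)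
  then have e: "exp (- s) = (1 - c) + c * exp (- t)" by (simp add: algebra_simps)
  have "target R x s = (1 - c) *\<^sub>R kappa x + c *\<^sub>R target R x t"
    unfolding target_def e by (simp add: algebra_simps)
  also have "\<dots> \<in> kappa ` V"
    using convexD[OF convex_image, of "kappa x" "target R x t" "1 - c" c] x t c by (simp add: lifespan_def)
  finally show ?thesis using s by (simp add: lifespan_def)
qed

lemma lifespan_interval:
  assumes "x \<in> V" shows "is_interval (lifespan R x)"
  unfolding is_interval_1
proof (intro ballI allI impI)
  fix s t u assume s: "s \<in> lifespan R x" and t: "t \<in> lifespan R x" and u: "s \<le> u \<and> u \<le> t"
  from s u have "0 \<le> u" by (simp add: lifespan_def)
  with u show "u \<in> lifespan R x" by (intro lifespan_downward[OF assms t]) simp_all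
qed

lemma trajectory_flow_solution:
  assumes x: "x \<in> V" and R: "R \<in> V"
  shows "flow_solution S Gl Gr R x (lifespan R x) (trajectory R x)"
  unfolding flow_solution_def
proof (intro conjI ballI)
  show "is_interval (lifespan R x)" "0 \<in> lifespan R x" "lifespan R x \<subseteq> {0..}"
    using lifespan_interval lifespan_0 x by (auto simp: lifespan_def)
  show "trajectory R x 0 = x"
    using inv_into_f_f[OF inj_on_k x] by (simp add: trajectory_def target_0)
  fix t assume t: "t \<in> lifespan R x"
  show "trajectory R x t \<in> V" using t by (rule trajectory_in)
  have tV: "target R x t \<in> V" using t by (auto simp: lifespan_def kappa_in)
  have "((\<lambda>s. k_inv (target R x s)) has_vector_derivative
      inv_into V (kappa' (k_inv (target R x t))) (R - target R x t)) (at t within lifespan R x)"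
    by (rule k_inv_path[OF _ t subspace_diff[OF subspace_V R tV] has_vector_derivative_target])
      (simp add: lifespan_def)
  then show "(trajectory R x has_vector_derivative flow_field S Gl Gr R (trajectory R x t)) (at t within lifespan R x)"
    unfolding flow_field_eq kappa_trajectory[OF t] by (simp add: trajectory_def[abs_def])
qed

text \<open>Along any solution \<open>exp t *\<^sub>R (kappa (\<Lambda> t) - R)\<close> is constant, which determines \<open>kappa (\<Lambda> t)\<close>
  and hence \<open>\<Lambda> t\<close>.\<close>

lemma flow_solution_unique:
  assumes R: "R \<in> V" and sol: "flow_solution S Gl Gr R x J \<Lambda>" and t: "t \<in> J"
  shows "t \<in> lifespan R x" "\<Lambda> t = trajectory R x t"
proof -
  have J: "is_interval J" "0 \<in> J" "J \<subseteq> {0..}" "\<Lambda> 0 = x"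
    and \<Lambda>: "\<And>t. t \<in> J \<Longrightarrow> \<Lambda> t \<in> V"
    and d\<Lambda>: "\<And>t. t \<in> J \<Longrightarrow> (\<Lambda> has_vector_derivative flow_field S Gl Gr R (\<Lambda> t)) (at t within J)"
    using sol by (simp_all add: flow_solution_def)
  let ?h = "\<lambda>t. exp t *\<^sub>R (kappa (\<Lambda> t) - R)"
  have "(?h has_derivative (\<lambda>_. 0)) (at s within J)" if s: "s \<in> J" for s
  proof -
    have "((\<lambda>t. kappa (\<Lambda> t)) has_derivative (\<lambda>h. kappa' (\<Lambda> s) (h *\<^sub>R flow_field S Gl Gr R (\<Lambda> s)))) (at s within J)"
      by (rule has_derivative_compose[OF d\<Lambda>[OF s, unfolded has_vector_derivative_def] has_derivative_kappa])
    then have "((\<lambda>t. kappa (\<Lambda> t)) has_vector_derivative R - kappa (\<Lambda> s)) (at s within J)"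
      by (simp add: has_vector_derivative_def linear_cmul[OF linear_kappa'] kappa'_flow_field[OF \<Lambda>[OF s] R])
    then have "((\<lambda>t. kappa (\<Lambda> t) - R) has_vector_derivative R - kappa (\<Lambda> s)) (at s within J)"
      by (rule has_vector_derivative_diff_const[THEN iffD2])
    moreover have "(exp has_real_derivative exp s) (at s within J)"
      by (auto intro!: derivative_eq_intros)
    ultimately have "(?h has_vector_derivative exp s *\<^sub>R (R - kappa (\<Lambda> s)) + exp s *\<^sub>R (kappa (\<Lambda> s) - R)) (at s within J)"
      by (intro has_vector_derivative_scaleR)
    then show ?thesis by (simp add: has_vector_derivative_def scaleR_add_right[symmetric])
  qed
  then have "\<exists>c. \<forall>s\<in>J. ?h s = c"
    by (rule has_derivative_zero_constant[OF is_interval_convex[OF J(1)]])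
  then obtain c where c: "\<And>s. s \<in> J \<Longrightarrow> ?h s = c" by blast
  have "exp (- t) *\<^sub>R ?h t = exp (- t) *\<^sub>R (kappa x - R)"
    using c[OF t] c[OF J(2)] J(4) by simp
  then have k: "kappa (\<Lambda> t) = target R x t"
    by (simp add: target_def exp_minus algebra_simps)
  then show "t \<in> lifespan R x"
    using imageI[OF \<Lambda>[OF t], of kappa] J(3) t by (auto simp only: lifespan_def)
  show "\<Lambda> t = trajectory R x t"
    unfolding trajectory_def k[symmetric] using inv_into_f_f[OF inj_on_k \<Lambda>[OF t]] by simp
qed

text \<open>Every solution is a restriction of the trajectory, so maximality and uniqueness reduce
  to inclusions between time intervals.\<close>

lemma trajectory_the_flow_solution:
  assumes x: "x \<in> V" and R: "R \<in> V"
  shows "the_flow_solution S Gl Gr R x (lifespan R x) (trajectory R x)"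
proof -
  note sol = trajectory_flow_solution[OF x R] and uniq = flow_solution_unique[OF R]
  have 1: "maximal_flow_solution S Gl Gr R x (lifespan R x) (trajectory R x)"
    unfolding maximal_flow_solution_def
  proof (intro conjI allI impI sol)
    fix J' \<Lambda>' assume *: "flow_solution S Gl Gr R x J' \<Lambda>' \<and> lifespan R x \<subseteq> J' \<and>
        (\<forall>t\<in>lifespan R x. \<Lambda>' t = trajectory R x t)"
    then have "J' \<subseteq> lifespan R x" by (intro subsetI) (rule uniq(1)[of x J' \<Lambda>'], simp_all)
    then show "J' = lifespan R x" using * by (intro subset_antisym) simp_all
  qed
  have 2: "J' = lifespan R x \<and> (\<forall>t\<in>lifespan R x. \<Lambda>' t = trajectory R x t)"
    if max: "maximal_flow_solution S Gl Gr R x J' \<Lambda>'" for J' \<Lambda>'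
  proof -
    have s': "flow_solution S Gl Gr R x J' \<Lambda>'" using max by (simp add: maximal_flow_solution_def)
    have sub: "J' \<subseteq> lifespan R x" by (rule subsetI) (rule uniq(1)[OF s'])
    have eq: "trajectory R x t = \<Lambda>' t" if "t \<in> J'" for t using uniq(2)[OF s' that] by simp
    have "lifespan R x = J'"
      using max[unfolded maximal_flow_solution_def, THEN conjunct2, rule_format, of "lifespan R x" "trajectory R x"]
        sol sub eq by simp
    with eq show ?thesis by simp
  qed
  show ?thesis
    unfolding the_flow_solution_def by (rule conjI[OF 1]) (intro allI impI, rule 2)
qed

lemma lifespan_UNIV:
  assumes x: "x \<in> V" and R: "R \<in> W" shows "lifespan R x = {0..}"
proof -
  have "target R x t \<in> kappa ` V" if "t \<ge> 0" for t
  proof -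
    have "target R x t = (1 - exp (- t)) *\<^sub>R R + exp (- t) *\<^sub>R kappa x"
      by (simp add: target_def algebra_simps)
    also have "\<dots> \<in> kappa ` V"
      by (rule convexD[OF convex_image _ imageI[OF x]]) (use R that in \<open>auto simp: kappa_image\<close>)
    finally show ?thesis .
  qed
  then show ?thesis by (auto simp: lifespan_def)
qed

lemma norm_target_diff: "norm (target R x t - R) = exp (- t) * norm (kappa x - R)"
  by (simp add: target_def)

lemma trajectory_tendsto:
  assumes x: "x \<in> V" and R: "R \<in> W"
  shows "(trajectory R x \<longlongrightarrow> k_inv R) at_top"
    and "\<exists>c. \<forall>t\<ge>0. norm (trajectory R x t - k_inv R) \<le> c * exp (- t)"
    and "bounded (trajectory R x ` {0..})"
proof -
  have RV: "R \<in> kappa ` V" using R kappa_image by simp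
  have im: "target R x t \<in> kappa ` V" if "t \<ge> 0" for t
    using lifespan_UNIV[OF x R] that by (auto simp: lifespan_def)
  obtain C d where d: "d > 0" and C: "\<And>z. z \<in> kappa ` V \<Longrightarrow> norm (z - R) < d \<Longrightarrow> norm (k_inv z - k_inv R) \<le> C * norm (z - R)"
    using k_inv_locally_lipschitz[OF RV] by blast
  define N where "N = norm (kappa x - R)"
  have "((\<lambda>t. exp (- t) * N) \<longlongrightarrow> 0 * N) at_top"
    by (intro tendsto_intros filterlim_compose[OF exp_at_bot] filterlim_uminus_at_bot_at_top)
  then have "\<forall>\<^sub>F t in at_top. exp (- t) * N < d" using d by (auto dest: order_tendstoD(2))
  then obtain T0 where T0: "\<And>t. t \<ge> T0 \<Longrightarrow> exp (- t) * N < d" unfolding eventually_at_top_linorder by blast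
  define T where "T = max 0 T0"
  have late: "norm (trajectory R x t - k_inv R) \<le> C * N * exp (- t)" if "t \<ge> T" for t
    using C[OF im, of t] T0[of t] that
    by (simp add: T_def trajectory_def norm_target_diff N_def[symmetric] algebra_simps)
  have RinV: "R \<in> V" using R W_subset by blast
  have "(trajectory R x has_vector_derivative flow_field S Gl Gr R (trajectory R x t)) (at t within {0..})"
    if "t \<in> {0..}" for t
    using trajectory_flow_solution[OF x RinV] that
    unfolding flow_solution_def lifespan_UNIV[OF x R] by blast
  then have "continuous_on {0..} (trajectory R x)" by (rule continuous_on_vector_derivative)
  from continuous_on_subset[OF this, of "{0..T}"] have "compact (trajectory R x ` {0..T})"
    by (intro compact_continuous_image) auto
  from compact_imp_bounded[OF this]
  obtain B where "B > 0" "\<forall>y\<in>trajectory R x ` {0..T}. norm y \<le> B"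
    unfolding bounded_pos by blast
  then have B: "B > 0" "\<And>t. 0 \<le> t \<Longrightarrow> t \<le> T \<Longrightarrow> norm (trajectory R x t) \<le> B" by auto
  \<comment> \<open>The first summand covers \<open>{0..T}\<close>, where
    \<open>exp T * exp (- t) \<ge> 1\<close>; the second is the local Lipschitz estimate valid after
    \<open>T\<close>.\<close>
  define c where "c = (B + norm (k_inv R)) * exp T + \<bar>C * N\<bar>"
  have est: "norm (trajectory R x t - k_inv R) \<le> c * exp (- t)" if "t \<ge> 0" for t
  proof (cases "t \<le> T")
    case True
    have "norm (trajectory R x t - k_inv R) \<le> (B + norm (k_inv R)) * 1"
      using norm_triangle_ineq4[of "trajectory R x t" "k_inv R"] B(2)[OF that True] by simp
    also have "\<dots> \<le> (B + norm (k_inv R)) * (exp T * exp (- t))"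
      using B(1) True by (intro mult_left_mono) (simp_all add: exp_add[symmetric])
    also have "\<dots> \<le> c * exp (- t)" by (simp add: c_def algebra_simps)
    finally show ?thesis .
  next
    case False
    then have "norm (trajectory R x t - k_inv R) \<le> C * N * exp (- t)" using late by simp
    also have "\<dots> \<le> c * exp (- t)"
      using B(1) by (intro mult_right_mono) (auto simp: c_def intro!: add_increasing)
    finally show ?thesis .
  qed
  then show "\<exists>c. \<forall>t\<ge>0. norm (trajectory R x t - k_inv R) \<le> c * exp (- t)" by blast
  have lim: "((\<lambda>t. c * exp (- t)) \<longlongrightarrow> c * 0) at_top"
    by (intro tendsto_intros filterlim_compose[OF exp_at_bot] filterlim_uminus_at_bot_at_top)
  have ev: "\<forall>\<^sub>F t in at_top. norm (trajectory R x t - k_inv R) \<le> c * exp (- t)"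
    using est by (rule eventually_at_top_linorderI)
  have "((\<lambda>t. trajectory R x t - k_inv R) \<longlongrightarrow> 0) at_top"
    using Lim_null_comparison[OF ev] lim by simp
  then show "(trajectory R x \<longlongrightarrow> k_inv R) at_top" by (simp add: LIM_zero_iff)
  have "c \<ge> 0" using B(1) by (simp add: c_def)
  show "bounded (trajectory R x ` {0..})"
    unfolding bounded_iff
  proof (intro exI ballI)
    fix y assume "y \<in> trajectory R x ` {0..}"
    then obtain t where t: "t \<ge> 0" "y = trajectory R x t" by auto
    have "c * exp (- t) \<le> c * 1" using t(1) \<open>c \<ge> 0\<close> by (intro mult_left_mono) auto
    then show "norm y \<le> norm (k_inv R) + c"
      using est[OF t(1), folded t(2)] norm_triangle_sub[of y "k_inv R"] by linarith
  qed
qed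

text \<open>Along the trajectory the norm of the residual is exactly \<open>exp (- s)\<close> times
  its initial value.\<close>

lemma residual_trajectory_derivative:
  assumes x: "x \<in> V" and R: "R \<in> W" and t: "t \<ge> 0"
  shows "((\<lambda>s. (norm (residual S Gl Gr R (trajectory R x s)))\<^sup>2) has_real_derivative
      - 2 * (norm (residual S Gl Gr R (trajectory R x t)))\<^sup>2) (at t within {0..})"
proof -
  define N where "N = norm (kappa x - R)"
  have eq: "(norm (residual S Gl Gr R (trajectory R x s)))\<^sup>2 = (exp (- s) * N)\<^sup>2" if "s \<in> {0..}" for s
  proof -
    have "kappa (trajectory R x s) = target R x s"
      by (rule kappa_trajectory) (use lifespan_UNIV[OF x R] that in simp)
    then show ?thesis
      by (simp add: residual_eq norm_minus_commute[of R] norm_target_diff N_def)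
  qed
  have "((\<lambda>s. (exp (- s) * N)\<^sup>2) has_real_derivative - 2 * (exp (- t) * N)\<^sup>2) (at t within {0..})"
    by (auto intro!: derivative_eq_intros simp: power2_eq_square)
  moreover have t': "t \<in> {0..}" using t by simp
  ultimately show ?thesis
    unfolding has_field_derivative_def eq[OF t'] by (intro has_derivative_transform[OF t' eq])
qed

text \<open>If the trajectory were bounded, all points \<open>target R x t\<close> with \<open>t\<close> in the lifespan would lie in the
  image of a compact set; then the lifespan would be closed as well as open in \<open>{0..}\<close>, and \<open>R\<close>, the limit
  of \<open>target R x t\<close>, would belong to that image.\<close>

lemma trajectory_unbounded:
  assumes x: "x \<in> V" and R: "R \<in> V" and notW: "R \<notin> W"
  shows "\<not> bounded (trajectory R x ` lifespan R x)"
proof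
  assume "bounded (trajectory R x ` lifespan R x)"
  then obtain B where B: "\<And>t. t \<in> lifespan R x \<Longrightarrow> norm (trajectory R x t) \<le> B"
    unfolding bounded_iff by auto
  define K where "K = kappa ` (cball 0 B \<inter> V)"
  have "compact K"
    unfolding K_def
    by (intro compact_continuous_image continuous_on_subset[OF continuous_on_k] compact_Int_closed
        closed_subspace subspace_V compact_cball) auto
  then have cK: "closed K" by (rule compact_imp_closed)
  have target_K: "target R x t \<in> K" if "t \<in> lifespan R x" for t
    unfolding K_def kappa_trajectory[OF that, symmetric] using B trajectory_in that by simp
  have cont: "continuous_on A (target R x)" for A
    unfolding target_def[abs_def] by (intro continuous_intros)
  have "K \<subseteq> kappa ` V" by (auto simp: K_def)
  then have J1: "lifespan R x = {0..} \<inter> target R x -` K"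
    using target_K by (auto simp: lifespan_def)
  have J2: "lifespan R x = {0..} \<inter> target R x -` (kappa ` V)"
    by (auto simp: lifespan_def)
  have tV: "target R x \<in> {0..} \<rightarrow> V"
    using R kappa_in by (auto simp: target_def intro!: subspace_add subspace_scale subspace_diff subspace_V)
  have "closedin (top_of_set {0..}) (lifespan R x)"
    unfolding J1 by (rule continuous_closedin_preimage[OF cont cK])
  moreover have "openin (top_of_set {0..}) (lifespan R x)"
    unfolding J2 by (rule continuous_openin_preimage[OF cont tV openin_k_image])
  moreover have "connected {0::real..}" by (simp add: convex_connected)
  ultimately have "lifespan R x = {0..}"
    using lifespan_0[OF x] unfolding connected_clopen by blast
  then have "\<And>n::nat. target R x (real n) \<in> K" using target_K by simp
  moreover have "(\<lambda>n. target R x (real n)) \<longlonglongrightarrow> R + 0 *\<^sub>R (kappa x - R)"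
    unfolding target_def
    by (intro tendsto_intros filterlim_compose[OF exp_at_bot] filterlim_compose[OF filterlim_uminus_at_bot_at_top]
        filterlim_real_sequentially)
  ultimately have "R \<in> K" using closed_sequentially[OF cK, of "\<lambda>n. target R x (real n)" R] by simp
  then show False using \<open>K \<subseteq> kappa ` V\<close> kappa_image notW by blast
qed

end

text \<open>The first conjunct certifies that \<open>inv_into\<close> in \<open>flow_field\<close>
  is a genuine inverse on the range space, so that the differential equation is the intended one.
  Both the minimizer and the limit of the flow come from the single parameter
  \<open>k_inv R\<close>, and the exponential rate obtained is \<open>r = 1\<close>.\<close>

theorem theorem5:
  fixes a b :: "'s::euclidean_space"
    and S :: "'s set"
    and Gl :: "'s \<Rightarrow> complex^'m^'nl"
    and Gr :: "'s \<Rightarrow> complex^'nr^'m"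
    and R :: "complex^'nr^'nl"
  assumes "S = cbox a b" and "interior S \<noteq> {}"
    and "cont_diff_on S Gl" and "cont_diff_on S Gr"
  shows
    "(\<forall>\<Lambda>\<in>moment_range S Gl Gr.
        bij_betw (grad_kappa S Gl Gr \<Lambda>) (moment_range S Gl Gr) (moment_range S Gl Gr)) \<and>
     (R \<in> int_moment_cone S Gl Gr \<longrightarrow>
        (\<exists>\<rho>\<in>exp_family S Gl Gr. unique_entropy_min S (pos_solutions S Gl Gr R) \<rho>) \<and>
        (\<forall>\<Lambda>0\<in>moment_range S Gl Gr. \<exists>\<Lambda>.
           the_flow_solution S Gl Gr R \<Lambda>0 {0..} \<Lambda> \<and>
           bounded (\<Lambda> ` {0..}) \<and>
           (\<exists>\<Lambda>h\<in>moment_range S Gl Gr.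
              (\<Lambda> \<longlongrightarrow> \<Lambda>h) at_top \<and>
              unique_entropy_min S (pos_solutions S Gl Gr R) (exp_density Gl Gr \<Lambda>h) \<and>
              (\<exists>c r. 0 < r \<and> (\<forall>t\<ge>0. norm (\<Lambda> t - \<Lambda>h) \<le> c * exp (- r * t)))) \<and>
           (\<forall>t\<ge>0. ((\<lambda>s. (norm (residual S Gl Gr R (\<Lambda> s)))\<^sup>2) has_real_derivative
                     - 2 * (norm (residual S Gl Gr R (\<Lambda> t)))\<^sup>2) (at t within {0..})))) \<and>
     (R \<in> moment_range S Gl Gr \<and> R \<notin> int_moment_cone S Gl Gr \<longrightarrow>
        (\<forall>\<Lambda>0\<in>moment_range S Gl Gr. \<exists>J \<Lambda>.
           the_flow_solution S Gl Gr R \<Lambda>0 J \<Lambda> \<and> \<not> bounded (\<Lambda> ` J)))"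
proof -
  have cont: "continuous_on S f" if "cont_diff_on S f" for f :: "'s \<Rightarrow> 'b::real_normed_vector"
  proof -
    obtain f' where "\<And>x. x \<in> S \<Longrightarrow> (f has_derivative blinfun_apply (f' x)) (at x within S)"
      using \<open>cont_diff_on S f\<close> unfolding cont_diff_on_def by blast
    then show ?thesis
      unfolding continuous_on_eq_continuous_within using has_derivative_continuous by blast
  qed
  interpret moment_problem a b S Gl Gr
    by (rule moment_problem.intro[OF assms(1,2) cont[OF assms(3)] cont[OF assms(4)]])
  show ?thesis
  proof (intro conjI ballI impI)
    show "bij_betw (kappa' x) V V" if "x \<in> V" for x using that by (rule bij_betw_k')
  next
    assume R: "R \<in> W"
    then have RV: "R \<in> kappa ` V" by (simp add: kappa_image)
    have min: "unique_entropy_min S (pos_solutions S Gl Gr R) (rho_exp (k_inv R))"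
      using unique_entropy_min_rho_exp[of "k_inv R"] k_k_inv[OF RV] by simp
    show "\<exists>\<rho>\<in>exp_family S Gl Gr. unique_entropy_min S (pos_solutions S Gl Gr R) \<rho>"
      unfolding exp_family_def using min k_inv_in[OF RV] by blast
    fix x assume x: "x \<in> V"
    have RinV: "R \<in> V" using R W_subset by blast
    obtain c where c: "\<And>t. t \<ge> 0 \<Longrightarrow> norm (trajectory R x t - k_inv R) \<le> c * exp (- 1 * t)"
      using trajectory_tendsto(2)[OF x R] by auto
    show "\<exists>\<Lambda>. the_flow_solution S Gl Gr R x {0..} \<Lambda> \<and> bounded (\<Lambda> ` {0..}) \<and>
       (\<exists>\<Lambda>h\<in>V. (\<Lambda> \<longlongrightarrow> \<Lambda>h) at_top \<and>
          unique_entropy_min S (pos_solutions S Gl Gr R) (rho_exp \<Lambda>h) \<and>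
          (\<exists>c r. 0 < r \<and> (\<forall>t\<ge>0. norm (\<Lambda> t - \<Lambda>h) \<le> c * exp (- r * t)))) \<and>
       (\<forall>t\<ge>0. ((\<lambda>s. (norm (residual S Gl Gr R (\<Lambda> s)))\<^sup>2) has_real_derivative
          - 2 * (norm (residual S Gl Gr R (\<Lambda> t)))\<^sup>2) (at t within {0..}))"
    proof (intro exI[of _ "trajectory R x"] conjI bexI[of _ "k_inv R"] allI impI)
      show "the_flow_solution S Gl Gr R x {0..} (trajectory R x)"
        using trajectory_the_flow_solution[OF x RinV] lifespan_UNIV[OF x R] by simp
      show "\<exists>c r. 0 < r \<and> (\<forall>t\<ge>0. norm (trajectory R x t - k_inv R) \<le> c * exp (- r * t))"
        using c by (intro exI[of _ c] exI[of _ 1]) simp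
    qed (use trajectory_tendsto[OF x R] min k_inv_in[OF RV] residual_trajectory_derivative[OF x R] in auto)
  next
    fix x assume R: "R \<in> V \<and> R \<notin> W" and x: "x \<in> V"
    then show "\<exists>J \<Lambda>. the_flow_solution S Gl Gr R x J \<Lambda> \<and> \<not> bounded (\<Lambda> ` J)"
      using trajectory_the_flow_solution[OF x] trajectory_unbounded[OF x] by blast
  qed
qed

end
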